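(* Let $N\in\mathbb{N}$, $d\in\mathbb{N}$, and let $S_0,S_1,\dots,S_d$ be complex $N\times N$ matrices. Consider the truncated matrix trigonometric moment problem with moments $\{S_n\}_{n=0}^d$: find all solutions $M$, i.e. all non-decreasing $\mathbb{C}_{N\times N}$-valued functions $M(t)=(m_{k,l}(t))_{k,l=0}^{N-1}$, $t\in[0,2\pi]$, with $M(0)=0$, left-continuous in $(0,2\pi]$, such that $$\int_0^{2\pi} e^{int}\,dM(t)=S_n,\qquad n=0,1,\dots,d.$$ Assume that $T_d=(S_{i-j})_{i,j=0}^d\ge 0$, where $S_{-n}:=S_n^*$ for $n=1,\dots,d$. Let $H$, $\{x_n\}_{n=0}^{(d+1)N-1}$ and the isometric operator $A$ in $H$ be constructed from the moments as described in the context. Then all solutions of the moment problem have the form $$M(t)=(m_{k,j}(t))_{k,j=0}^{N-1},\qquad t\in[0,2\pi],$$ where the $m_{k,j}$ are obtained from the relation $$\int_0^{2\pi}\frac{1}{1-\zeta e^{it}}\,dm_{k,j}(t)=(\mathbf{R}_\zeta x_k,x_j)_H,\qquad \zeta\in\mathbb{C}:\ |\zeta|\ne1,$$ and $$\mathbf{R}_\zeta=\left[E_H-\zeta(A\oplus\Phi_\zeta)\right]^{-1}\quad(\zeta\in\mathbb{D}),\qquad \mathbf{R}_{1/\overline{\zeta}}=E_H-\mathbf{R}_\zeta^*\quad(\zeta\in\mathbb{D}\setminus\{0\}).$$ Here $\Phi_\zeta$ is an analytic in $\mathbb{D}$ operator-valued function whose values are linear contractions (i.e. $\|\Phi_\zeta\|\le1$)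 from $H\ominus D(A)$ into $H\ominus R(A)$. Conversely, each analytic in $\mathbb{D}$ operator-valued function $\Phi_\zeta$ whose values are linear contractions from $H\ominus D(A)$ into $H\ominus R(A)$ generates by these relations a solution of the moment problem. Moreover, the correspondence between all such functions $\Phi_\zeta$ and all solutions of the moment problem is bijective.
   Context: $\mathbb{D}=\{z\in\mathbb{C}:|z|<1\}$. $\mathbb{C}_{N\times N}$ is the set of complex $N\times N$ matrices. A matrix function $M$ on $[0,2\pi]$ is non-decreasing if $M(t)-M(s)\ge 0$ (positive semidefinite) whenever $s\le t$. Scalar products are linear in the first argument and conjugate-linear in the second. $E_H$ is the identity operator on $H$; $D(A)$ and $R(A)$ are the domain and range of $A$; $H\ominus L$ is the orthogonal complement of a subspace $L$ in $H$. The block matrix $T_d=(S_{i-j})_{i,j=0}^d$ (block row index $i$, block column index $j$) is of size $(d+1)N\times(d+1)N$. Write $T_d=(\gamma_{n,m})_{n,m=0}^{(d+1)N-1}$ with complex entries $\gamma_{n,m}$, and $S_k=(S_{k;s,l})_{s,l=0}^{N-1}$ for $-d\le k\le d$, so that $\gamma_{kN+s,rN+l}=S_{k-r;s,l}$ for $0\le k,r\le d$, $0\le s,l\le N-1$. Construction of $H$, $x_n$ and $A$ (for $d\in\mathbb{N}$ and $T_d\ge 0$): since $T_d\ge0$, there exist a Hilbert space $H$ and elements $\{x_n\}_{n=0}^{(d+1)N-1}$ of $H$ such that $(x_n,x_m)_H=\gamma_{n,m}$ for $0\le n,m\le (d+1)N-1$ and $H$ is the linear span of $\{x_n\}_{n=0}^{(d+1)N-1}$;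 fix such a choice. Set $D(A)=H_0:=\mathrm{Lin}\{x_n\}_{n=0}^{dN-1}$ and $$A x=\sum_{k=0}^{dN-1}\alpha_k x_{k+N}\quad\text{for } x=\sum_{k=0}^{dN-1}\alpha_k x_k,\ \alpha_k\in\mathbb{C}.$$ This is a well-defined isometric operator from $D(A)\subseteq H$ into $H$. For a linear operator $\Phi: H\ominus D(A)\to H\ominus R(A)$, $A\oplus\Phi$ denotes the operator on $H=D(A)\oplus(H\ominus D(A))$ given by $(A\oplus\Phi)(u+v)=Au+\Phi v$ for $u\in D(A)$, $v\in H\ominus D(A)$. The entries $m_{k,j}$ are understood as functions of bounded variation on $[0,2\pi]$, left-continuous in $(0,2\pi]$ and with $m_{k,j}(0)=0$; the stated integral relation for all $|\zeta|\ne1$ determines such functions uniquely. *)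

theory Defs
  imports "HOL-Analysis.Analysis" "Jordan_Normal_Form.Schur_Decomposition"
begin

section \<open>Complex Hilbert spaces\<close>

text \<open>
  The inner product is linear in its first and conjugate-linear in its second argument.
  The axiom \<open>cinner_self\<close> makes the form real and non-negative on the diagonal, definite,
  and compatible with the norm.
\<close>

class complex_inner = real_normed_vector +
  fixes scaleC :: "complex \<Rightarrow> 'a \<Rightarrow> 'a"  (infixr "*\<^sub>C" 75)
    and cinner :: "'a \<Rightarrow> 'a \<Rightarrow> complex"
  assumes scaleC_add_right: "a *\<^sub>C (x + y) = a *\<^sub>C x + a *\<^sub>C y"
    and scaleC_add_left: "(a + b) *\<^sub>C x = a *\<^sub>C x + b *\<^sub>C x"
    and scaleC_scaleC: "a *\<^sub>C (b *\<^sub>C x) = (a * b) *\<^sub>C x"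
    and scaleR_scaleC: "r *\<^sub>R x = complex_of_real r *\<^sub>C x"
    and cinner_add_left: "cinner (x + y) z = cinner x z + cinner y z"
    and cinner_scaleC_left: "cinner (a *\<^sub>C x) y = a * cinner x y"
    and cinner_commute: "cinner x y = cnj (cinner y x)"
    and cinner_self: "cinner x x = complex_of_real ((norm x)\<^sup>2)"

class chilbert_space = complex_inner + complete_space

global_interpretation complex_vector?: vector_space "scaleC :: complex \<Rightarrow> 'a \<Rightarrow> 'a::complex_inner"
  defines cspan = complex_vector.span
proof
  fix x :: 'a
  show "1 *\<^sub>C x = x" using scaleR_scaleC[of 1 x] by simp
qed (simp_all add: scaleC_add_right scaleC_add_left scaleC_scaleC)

instantiation complex :: chilbert_space
begin

definition scaleC_complex :: "complex \<Rightarrow> complex \<Rightarrow> complex"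
  where "scaleC_complex a x = a * x"

definition cinner_complex :: "complex \<Rightarrow> complex \<Rightarrow> complex"
  where "cinner_complex x y = x * cnj y"

instance
  by standard
    (auto simp: scaleC_complex_def cinner_complex_def algebra_simps scaleR_conv_of_real
      complex_norm_square simp flip: of_real_power)

end

instantiation Finite_Cartesian_Product.vec :: (complex_inner, finite) complex_inner
begin

definition scaleC_vec :: "complex \<Rightarrow> 'a^'b \<Rightarrow> 'a^'b"
  where "scaleC_vec a x = (\<chi> i. a *\<^sub>C vec_nth x i)"

definition cinner_vec :: "'a^'b \<Rightarrow> 'a^'b \<Rightarrow> complex"
  where "cinner_vec x y = (\<Sum>i\<in>UNIV. cinner (vec_nth x i) (vec_nth y i))"

instance
proof
  fix x y z :: "'a^'b" and a b :: complex and r :: real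
  show "a *\<^sub>C (x + y) = a *\<^sub>C x + a *\<^sub>C y" "(a + b) *\<^sub>C x = a *\<^sub>C x + b *\<^sub>C x"
    "a *\<^sub>C (b *\<^sub>C x) = (a * b) *\<^sub>C x" "r *\<^sub>R x = complex_of_real r *\<^sub>C x"
    by (simp_all add: scaleC_vec_def Finite_Cartesian_Product.vec_eq_iff scaleC_add_right
        scaleC_add_left scaleC_scaleC scaleR_scaleC)
  show "cinner (x + y) z = cinner x z + cinner y z"
    by (simp add: cinner_vec_def cinner_add_left sum.distrib)
  show "cinner (a *\<^sub>C x) y = a * cinner x y"
    by (simp add: cinner_vec_def scaleC_vec_def cinner_scaleC_left sum_distrib_left)
  show "cinner x y = cnj (cinner y x)"
    unfolding cinner_vec_def cnj_sum by (intro sum.cong refl cinner_commute)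
  have "cinner x x = complex_of_real (\<Sum>i\<in>UNIV. (norm (vec_nth x i))\<^sup>2)"
    by (simp only: cinner_vec_def cinner_self of_real_sum)
  also have "(\<Sum>i\<in>UNIV. (norm (vec_nth x i))\<^sup>2) = (norm x)\<^sup>2"
    by (simp add: norm_vec_def L2_set_def sum_nonneg)
  finally show "cinner x x = complex_of_real ((norm x)\<^sup>2)" .
qed

end

instance Finite_Cartesian_Product.vec :: (chilbert_space, finite) chilbert_space ..

text \<open>The orthogonal complement $H \ominus L$.\<close>

definition orth_compl :: "'h::complex_inner set \<Rightarrow> 'h set"
  where "orth_compl L = {v. \<forall>u\<in>L. cinner v u = 0}"

definition adj_op :: "('h::complex_inner \<Rightarrow> 'h) \<Rightarrow> 'h \<Rightarrow> 'h"
  where "adj_op T g = (THE w. \<forall>h. cinner (T h) g = cinner h w)"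


section \<open>Operators on subspaces\<close>

definition clinear_on :: "'h::complex_inner set \<Rightarrow> ('h \<Rightarrow> 'h) \<Rightarrow> bool"
  where "clinear_on U T \<longleftrightarrow>
    (\<forall>u\<in>U. \<forall>v\<in>U. T (u + v) = T u + T v) \<and> (\<forall>a. \<forall>u\<in>U. T (a *\<^sub>C u) = a *\<^sub>C T u)"

text \<open>
  Operators from \<open>U\<close> to \<open>W\<close> are extensional functions (value \<^const>\<open>undefined\<close> outside \<open>U\<close>), so
  that equality in HOL is equality of operators with domain \<open>U\<close>.
\<close>

definition contractions :: "'h::complex_inner set \<Rightarrow> 'h set \<Rightarrow> ('h \<Rightarrow> 'h) set"
  where "contractions U W = {T \<in> U \<rightarrow>\<^sub>E W. clinear_on U T \<and> (\<forall>u\<in>U. norm (T u) \<le> norm u)}"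

text \<open>Complex differentiability at every point of \<open>D\<close>, with respect to the operator norm.\<close>

definition op_analytic_on ::
    "complex set \<Rightarrow> 'h::complex_inner set \<Rightarrow> 'h set \<Rightarrow> (complex \<Rightarrow> 'h \<Rightarrow> 'h) \<Rightarrow> bool"
  where "op_analytic_on D U W \<Phi> \<longleftrightarrow>
    (\<forall>z\<in>D. \<exists>L \<in> U \<rightarrow> W. clinear_on U L \<and> (\<exists>B. \<forall>u\<in>U. norm (L u) \<le> B * norm u) \<and>
      (\<forall>e>0. \<forall>\<^sub>F w in at z. \<forall>u\<in>U.
        norm (inverse (w - z) *\<^sub>C (\<Phi> w u - \<Phi> z u) - L u) \<le> e * norm u))"

definition analytic_contractions ::
    "'h::complex_inner set \<Rightarrow> 'h set \<Rightarrow> (complex \<Rightarrow> 'h \<Rightarrow> 'h) set"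
  where "analytic_contractions U W =
    {\<Phi> \<in> ball 0 1 \<rightarrow>\<^sub>E contractions U W. op_analytic_on (ball 0 1) U W \<Phi>}"

text \<open>The operator $A \oplus \Phi$ on $H$, for \<open>A\<close> with domain \<open>U\<close> and $\Phi$ with domain $H \ominus U$.\<close>

definition oplus :: "'h::complex_inner set \<Rightarrow> ('h \<Rightarrow> 'h) \<Rightarrow> ('h \<Rightarrow> 'h) \<Rightarrow> 'h \<Rightarrow> 'h"
  where "oplus U A \<Phi> h = (THE w. \<exists>u\<in>U. \<exists>v\<in>orth_compl U. h = u + v \<and> w = A u + \<Phi> v)"

text \<open>
  For $|\zeta| > 1$ the relation $R_{1/\overline{z}} = E_H - R_z^*$ is used
  with $z = 1/\overline{\zeta}$. The value at $|\zeta| = 1$ is irrelevant.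
\<close>

definition disc_resolvent ::
    "'h::complex_inner set \<Rightarrow> ('h \<Rightarrow> 'h) \<Rightarrow> (complex \<Rightarrow> 'h \<Rightarrow> 'h) \<Rightarrow> complex \<Rightarrow> 'h \<Rightarrow> 'h"
  where "disc_resolvent U A \<Phi> \<zeta> = inv_into UNIV (\<lambda>h. h - \<zeta> *\<^sub>C oplus U A (\<Phi> \<zeta>) h)"

definition gen_resolvent ::
    "'h::complex_inner set \<Rightarrow> ('h \<Rightarrow> 'h) \<Rightarrow> (complex \<Rightarrow> 'h \<Rightarrow> 'h) \<Rightarrow> complex \<Rightarrow> 'h \<Rightarrow> 'h"
  where "gen_resolvent U A \<Phi> \<zeta> =
    (if cmod \<zeta> < 1 then disc_resolvent U A \<Phi> \<zeta>
     else (\<lambda>h. h - adj_op (disc_resolvent U A \<Phi> (1 / cnj \<zeta>)) h))"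


section \<open>Stieltjes integrals and functions of bounded variation\<close>

text \<open>The Riemann--Stieltjes integral $\int_a^b f\,dg = I$, as a limit of sums over tagged
  partitions whose mesh tends to zero. A jump of \<open>g\<close> at an endpoint contributes to it.\<close>

definition has_stieltjes_integral ::
    "(real \<Rightarrow> complex) \<Rightarrow> (real \<Rightarrow> complex) \<Rightarrow> real \<Rightarrow> real \<Rightarrow> complex \<Rightarrow> bool"
  where "has_stieltjes_integral f g a b I \<longleftrightarrow>
    (\<forall>e>0. \<exists>\<delta>>0. \<forall>p. p tagged_division_of {a..b} \<and> (\<lambda>t. ball t \<delta>) fine p \<longrightarrow>
      cmod ((\<Sum>(t, K)\<in>p. f t * (g (Sup K) - g (Inf K))) - I) < e)"

definition bounded_variation :: "(real \<Rightarrow> complex) \<Rightarrow> real \<Rightarrow> real \<Rightarrow> bool"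
  where "bounded_variation g a b \<longleftrightarrow>
    (\<exists>B. \<forall>\<D>. \<D> division_of {a..b} \<longrightarrow> (\<Sum>K\<in>\<D>. cmod (g (Sup K) - g (Inf K))) \<le> B)"

text \<open>Matrix functions on $[0,2\pi]$ are extensional, with entries indexed from 0.\<close>

definition left_cont_mat :: "nat \<Rightarrow> (real \<Rightarrow> complex mat) \<Rightarrow> bool"
  where "left_cont_mat N M \<longleftrightarrow>
    (\<forall>k<N. \<forall>j<N. \<forall>t\<in>{0<..2*pi}. ((\<lambda>s. M s $$ (k, j)) \<longlongrightarrow> M t $$ (k, j)) (at_left t))"

definition bv_mat_functions :: "nat \<Rightarrow> (real \<Rightarrow> complex mat) set"
  where "bv_mat_functions N =
    {M \<in> {0..2*pi} \<rightarrow>\<^sub>E carrier_mat N N.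
      M 0 = 0\<^sub>m N N \<and> left_cont_mat N M \<and>
      (\<forall>k<N. \<forall>j<N. bounded_variation (\<lambda>t. M t $$ (k, j)) 0 (2*pi))}"


section \<open>The truncated matrix trigonometric moment problem\<close>

text \<open>In the order on \<^typ>\<open>complex\<close>, \<open>0 \<le> z\<close> means that \<open>z\<close> is real and non-negative.\<close>

definition pos_semidef :: "complex mat \<Rightarrow> bool"
  where "pos_semidef B \<longleftrightarrow>
    (\<exists>n. B \<in> carrier_mat n n \<and> (\<forall>v\<in>carrier_vec n. 0 \<le> (B *\<^sub>v v) \<bullet>c v))"

definition moment_solutions :: "nat \<Rightarrow> nat \<Rightarrow> (nat \<Rightarrow> complex mat) \<Rightarrow> (real \<Rightarrow> complex mat) set"
  where "moment_solutions N d S =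
    {M \<in> {0..2*pi} \<rightarrow>\<^sub>E carrier_mat N N.
      (\<forall>s\<in>{0..2*pi}. \<forall>t\<in>{0..2*pi}. s \<le> t \<longrightarrow> pos_semidef (M t - M s)) \<and>
      M 0 = 0\<^sub>m N N \<and> left_cont_mat N M \<and>
      (\<forall>n\<le>d. \<forall>k<N. \<forall>j<N.
        has_stieltjes_integral (\<lambda>t. exp (\<i> * of_nat n * of_real t)) (\<lambda>t. M t $$ (k, j))
          0 (2*pi) (S n $$ (k, j)))}"

definition moment_ext :: "(nat \<Rightarrow> complex mat) \<Rightarrow> int \<Rightarrow> complex mat"
  where "moment_ext S i = (if 0 \<le> i then S (nat i) else mat_adjoint (S (nat (- i))))"

definition block_toeplitz :: "nat \<Rightarrow> nat \<Rightarrow> (nat \<Rightarrow> complex mat) \<Rightarrow> complex mat"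
  where "block_toeplitz N d S =
    Matrix.mat ((d + 1) * N) ((d + 1) * N) (\<lambda>(n, m).
      moment_ext S (int (n div N) - int (m div N)) $$ (n mod N, m mod N))"


section \<open>The isometric operator and the generated functions\<close>

definition A_dom :: "nat \<Rightarrow> nat \<Rightarrow> (nat \<Rightarrow> 'h::complex_inner) \<Rightarrow> 'h set"
  where "A_dom N d x = cspan (x ` {..<d * N})"

definition A_op :: "nat \<Rightarrow> nat \<Rightarrow> (nat \<Rightarrow> 'h::complex_inner) \<Rightarrow> 'h \<Rightarrow> 'h"
  where "A_op N d x u = (THE w. \<exists>\<alpha>.
    u = (\<Sum>k<d * N. \<alpha> k *\<^sub>C x k) \<and> w = (\<Sum>k<d * N. \<alpha> k *\<^sub>C x (k + N)))"

definition A_ran :: "nat \<Rightarrow> nat \<Rightarrow> (nat \<Rightarrow> 'h::complex_inner) \<Rightarrow> 'h set"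
  where "A_ran N d x = A_op N d x ` A_dom N d x"

definition parameters :: "nat \<Rightarrow> nat \<Rightarrow> (nat \<Rightarrow> 'h::complex_inner) \<Rightarrow> (complex \<Rightarrow> 'h \<Rightarrow> 'h) set"
  where "parameters N d x =
    analytic_contractions (orth_compl (A_dom N d x)) (orth_compl (A_ran N d x))"

definition generates ::
    "nat \<Rightarrow> nat \<Rightarrow> (nat \<Rightarrow> 'h::complex_inner) \<Rightarrow> (complex \<Rightarrow> 'h \<Rightarrow> 'h) \<Rightarrow> (real \<Rightarrow> complex mat) \<Rightarrow> bool"
  where "generates N d x \<Phi> M \<longleftrightarrow>
    M \<in> bv_mat_functions N \<and>
    (\<forall>\<zeta>. cmod \<zeta> \<noteq> 1 \<longrightarrow> (\<forall>k<N. \<forall>j<N.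
      has_stieltjes_integral (\<lambda>t. 1 / (1 - \<zeta> * exp (\<i> * of_real t))) (\<lambda>t. M t $$ (k, j))
        0 (2*pi) (cinner (gen_resolvent (A_dom N d x) (A_op N d x) \<Phi> \<zeta> (x k)) (x j))))"

end

theory Submission
  imports Defs "HOL-Complex_Analysis.Complex_Analysis" "HOL-Probability.Helly_Selection"
begin

text \<open>
  A parameter $\Phi$ turns \<open>T z = A \<oplus> \<Phi> z\<close> into an analytic family of contractions, and
  $\|z\,T_z\| \le 1$ is the same as $R_z + R_z^* \ge E$ for the resolvent. Hence each
  $(R_z h, h)$ has a Herglotz representation, and polarization assembles these scalar measures into a
  matrix measure; since $R_z x_n = x_n + z R_z x_{n+N}$, the first Taylor coefficients of
  $(R_z x_k, x_j)$ are the prescribed moments.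

  Conversely, a solution $M$ defines on $H$ the compression of multiplication by a function $f$ of $t$.
  The compression $R_z$ of $1/(1 - z e^{it})$ satisfies $R_z + R_z^* \ge E$, so that $E - R_z^{-1}$ is
  an analytic contraction vanishing at $0$; by the Schwarz lemma it equals $z T_z$ with contractions
  $T_z$. They extend the isometry $A$, and therefore split as $A \oplus \Phi_z$.

  The measure is determined by its resolvent integrals because these yield all trigonometric moments.
  The parameter is determined by the block $(R_z x_k, x_j)$, $k, j < N$, because the shift relations
  for $R_z$ and for its adjoint propagate it to all $x_n$, $x_m$.
\<close>

section \<open>Inner product spaces\<close>

text \<open>The \<open>x n\<close> may be linearly dependent, since the Gram matrix may be singular.
  Anything prescribed through them must therefore be shown to send null combinations to 0. For
  \<open>A\<close> this follows from isometry of the shift. For the compression of multiplication by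
  f it follows from positivity: if 0 \<le> f \<le> C, the form of f is at most C times the form of
  1, which is the inner product of H.

  The splitting rests on one fact about a contraction T: if T does not shrink u, then (T h, T u) =
  (h, u) for all h. Hence a contraction extending A maps the complement of D(A) into that of R(A).
  The same fact gives the shift relation for the adjoint of the resolvent.

  Off-diagonal entries of M are neither real nor monotone. Their integrals are obtained by
  polarization, and their negative frequencies are visible only through points z outside the disc.

  H is finite-dimensional, so holomorphy is carried by the scalar functions (T_z u, g) and returns
  to the operator norm through an orthonormal basis. At z = 0 the relation between R_z and T_z is
  empty; T_0 is reached by continuity or by a formula without division.\<close>

lemma cinner_add_right: "cinner x (y + z) = cinner x y + cinner x z"
  by (metis cinner_add_left cinner_commute complex_cnj_add)

lemma cinner_scaleC_right: "cinner x (a *\<^sub>C y) = cnj a * cinner x y"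
  by (metis cinner_scaleC_left cinner_commute complex_cnj_mult)

lemma cinner_zero_left [simp]: "cinner 0 x = 0"
  using cinner_add_left[of 0 0 x] by simp

lemma cinner_zero_right [simp]: "cinner x 0 = 0"
  using cinner_add_right[of x 0 0] by simp

lemma cinner_minus_left [simp]: "cinner (- x) y = - cinner x y"
  using cinner_add_left[of x "- x" y] by (simp add: eq_neg_iff_add_eq_0 add.commute)

lemma cinner_minus_right [simp]: "cinner x (- y) = - cinner x y"
  using cinner_add_right[of x y "- y"] by (simp add: eq_neg_iff_add_eq_0 add.commute)

lemma cinner_diff_left: "cinner (x - y) z = cinner x z - cinner y z"
  using cinner_add_left[of x "- y" z] by simp

lemma cinner_diff_right: "cinner x (y - z) = cinner x y - cinner x z"
  using cinner_add_right[of x y "- z"] by simp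

lemma cinner_sum_left: "cinner (sum f A) y = (\<Sum>i\<in>A. cinner (f i) y)"
  by (induction A rule: infinite_finite_induct) (auto simp: cinner_add_left)

lemma cinner_sum_right: "cinner x (sum f A) = (\<Sum>i\<in>A. cinner x (f i))"
  by (induction A rule: infinite_finite_induct) (auto simp: cinner_add_right)

lemmas cinner_simps = cinner_add_left cinner_add_right cinner_diff_left cinner_diff_right
  cinner_scaleC_left cinner_scaleC_right cinner_sum_left cinner_sum_right

lemma cinner_self_eq_0 [simp]: "cinner x x = 0 \<longleftrightarrow> x = 0"
  by (simp add: cinner_self)

lemma cinner_left_eqI: "(\<And>y. cinner u y = cinner v y) \<Longrightarrow> u = v"
  by (metis cinner_diff_left cinner_self_eq_0 eq_iff_diff_eq_0)

lemma norm_scaleC [simp]: "norm (a *\<^sub>C x) = cmod a * norm x"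
proof -
  have "complex_of_real ((norm (a *\<^sub>C x))\<^sup>2) = (a * cnj a) * cinner x x"
    unfolding cinner_self[symmetric] cinner_scaleC_left cinner_scaleC_right by simp
  also have "\<dots> = complex_of_real ((cmod a * norm x)\<^sup>2)"
    by (simp only: complex_norm_square[symmetric] cinner_self power_mult_distrib of_real_mult)
  finally have "(norm (a *\<^sub>C x))\<^sup>2 = (cmod a * norm x)\<^sup>2"
    by (simp only: of_real_eq_iff)
  then show ?thesis
    by (simp add: power2_eq_iff_nonneg)
qed

lemma norm_diff_sq: "(norm (x - y))\<^sup>2 = (norm x)\<^sup>2 - 2 * Re (cinner x y) + (norm y)\<^sup>2"
proof -
  have "complex_of_real ((norm (x - y))\<^sup>2) =
      complex_of_real ((norm x)\<^sup>2) - (cinner x y + cnj (cinner x y)) + complex_of_real ((norm y)\<^sup>2)"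
    unfolding cinner_self[symmetric] cinner_commute[of x y, symmetric]
    by (simp add: cinner_simps cinner_commute[of x y, symmetric] flip: cinner_commute[of y x])
  also have "\<dots> = complex_of_real ((norm x)\<^sup>2 - 2 * Re (cinner x y) + (norm y)\<^sup>2)"
    by (simp add: complex_eq_iff)
  finally show ?thesis
    by (simp only: of_real_eq_iff)
qed

lemma norm_add_sq: "(norm (x + y))\<^sup>2 = (norm x)\<^sup>2 + 2 * Re (cinner x y) + (norm y)\<^sup>2"
  for x :: "'h::complex_inner"
  using norm_diff_sq[of x "- y"] by simp

lemma cauchy_schwarz: "cmod (cinner x y) \<le> norm x * norm y"
proof (cases "y = 0")
  case False
  define a where "a = cinner x y / complex_of_real ((norm y)\<^sup>2)"
  have "0 \<le> (norm (x - a *\<^sub>C y))\<^sup>2" by simp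
  also have "\<dots> = (norm x)\<^sup>2 - 2 * Re (cnj a * cinner x y) + (cmod a * norm y)\<^sup>2"
    by (simp add: norm_diff_sq cinner_scaleC_right)
  also have "cnj a * cinner x y = complex_of_real ((cmod (cinner x y))\<^sup>2 / (norm y)\<^sup>2)"
    by (simp add: a_def complex_norm_square[symmetric, of "cinner x y"] mult.commute del: of_real_power)
  also have "(norm x)\<^sup>2 - 2 * Re (complex_of_real ((cmod (cinner x y))\<^sup>2 / (norm y)\<^sup>2)) + (cmod a * norm y)\<^sup>2
     = (norm x)\<^sup>2 - (cmod (cinner x y))\<^sup>2 / (norm y)\<^sup>2"
  proof -
    have "cmod a = cmod (cinner x y) / (norm y)\<^sup>2"
      by (simp add: a_def norm_divide norm_power)
    then have "(cmod a * norm y)\<^sup>2 = (cmod (cinner x y))\<^sup>2 / (norm y)\<^sup>2"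
      using False by (simp add: power2_eq_square)
    then show ?thesis
      unfolding Re_complex_of_real by linarith
  qed
  finally have "(cmod (cinner x y))\<^sup>2 \<le> (norm x * norm y)\<^sup>2"
    using False by (simp add: field_simps)
  then show ?thesis
    by (rule power2_le_imp_le) simp
qed simp

lemma cinner_scaleR_left: "cinner (r *\<^sub>R x) y = complex_of_real r * cinner x y"
  by (simp add: scaleR_scaleC[of r x] cinner_scaleC_left)

lemma bounded_linear_cinner_left: "bounded_linear (\<lambda>x. cinner x y)"
  by (rule bounded_linear_intro[where K = "norm y"])
    (simp_all add: cinner_add_left cinner_scaleR_left cauchy_schwarz scaleR_conv_of_real)

lemmas tendsto_cinner_left = bounded_linear.tendsto[OF bounded_linear_cinner_left]

lemma scaleR_scaleC_scaleC: "r *\<^sub>R (a *\<^sub>C x) = (complex_of_real r * a) *\<^sub>C x"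
  by (simp add: scaleR_scaleC[of r "a *\<^sub>C x"] scaleC_scaleC)

lemma bounded_linear_scaleC_left: "bounded_linear (\<lambda>a. a *\<^sub>C x)"
  by (rule bounded_linear_intro[where K = "norm x"])
    (simp_all add: scaleC_add_left scaleR_conv_of_real scaleR_scaleC_scaleC)

lemma scaleC_zero_left [simp]: "0 *\<^sub>C x = 0"
  by (rule complex_vector.scale_zero_left)

lemma scaleC_zero_right [simp]: "a *\<^sub>C 0 = 0"
  by (rule complex_vector.scale_zero_right)

lemma scaleC_one [simp]: "1 *\<^sub>C x = x"
  by (rule complex_vector.scale_one)

section \<open>Orthonormal bases and orthogonal decomposition\<close>

definition orthonormal :: "'h::complex_inner set \<Rightarrow> bool"
  where "orthonormal E \<longleftrightarrow> (\<forall>e\<in>E. \<forall>f\<in>E. cinner e f = (if e = f then 1 else 0))"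

lemma orthonormal_coeff:
  assumes "orthonormal E" "finite E" "e \<in> E"
  shows "cinner (\<Sum>f\<in>E. c f *\<^sub>C f) e = c e"
proof -
  have "cinner (\<Sum>f\<in>E. c f *\<^sub>C f) e = (\<Sum>f\<in>E. if f = e then c f else 0)"
    using assms unfolding cinner_simps orthonormal_def by (intro sum.cong) auto
  then show ?thesis
    using assms by (simp add: sum.delta)
qed

lemma orthonormal_expansion:
  assumes "orthonormal E" "finite E" "h \<in> cspan E"
  shows "(\<Sum>e\<in>E. cinner h e *\<^sub>C e) = h"
proof -
  obtain c where c: "h = (\<Sum>f\<in>E. c f *\<^sub>C f)"
    using assms(2,3) by (auto simp: complex_vector.span_finite)
  then show ?thesis
    using assms by (auto intro!: sum.cong simp: orthonormal_coeff)
qed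

lemma orthonormal_residual:
  assumes "orthonormal E" "finite E" "u \<in> cspan E"
  shows "cinner (h - (\<Sum>e\<in>E. cinner h e *\<^sub>C e)) u = 0"
proof -
  have "cinner (h - (\<Sum>e\<in>E. cinner h e *\<^sub>C e)) e = 0" if "e \<in> E" for e
    using assms that by (simp add: cinner_diff_left orthonormal_coeff)
  then have "cinner (h - (\<Sum>e\<in>E. cinner h e *\<^sub>C e)) (\<Sum>f\<in>E. cinner u f *\<^sub>C f) = 0"
    by (simp add: cinner_sum_right cinner_scaleC_right)
  then show ?thesis
    using assms by (simp add: orthonormal_expansion)
qed

text \<open>Gram-Schmidt. A vector that equals its projection onto the earlier ones is skipped, so a
  linearly dependent family such as \<open>x\<close> is admissible.\<close>

lemma orthonormal_basis_exists:
  assumes "finite X"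
  shows "\<exists>E. finite E \<and> orthonormal E \<and> cspan E = cspan X"
  using assms
proof (induction X)
  case empty
  then show ?case by (intro exI[of _ "{}"]) (simp add: orthonormal_def)
next
  case (insert x X)
  then obtain E where E: "finite E" "orthonormal E" "cspan E = cspan X" by blast
  define p where "p = (\<Sum>e\<in>E. cinner x e *\<^sub>C e)"
  have p: "p \<in> cspan E"
    unfolding p_def
    by (intro complex_vector.span_sum complex_vector.span_scale complex_vector.span_base)
  have span_eq: "cspan (insert x X) = cspan (insert x E)"
    unfolding complex_vector.span_insert[of x X] complex_vector.span_insert[of x E] E(3) ..
  show ?case
  proof (cases "x = p")
    case True
    then show ?thesis
      using E p complex_vector.span_redundant[of x E] span_eq by auto
  next
    case False
    define n where "n = complex_of_real (norm (x - p))"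
    define e where "e = inverse n *\<^sub>C (x - p)"
    have n: "n \<noteq> 0" using False by (simp add: n_def)
    have orth: "cinner e f = 0" if "f \<in> E" for f
      using orthonormal_residual[OF E(2,1), of f x] that
      by (auto simp: e_def p_def cinner_scaleC_left intro: complex_vector.span_base)
    have "norm e = 1"
      using False by (simp add: e_def n_def norm_inverse)
    have orth_e: "e \<notin> E"
      using orth[of e] \<open>norm e = 1\<close> by (auto simp: cinner_self)
    have "orthonormal (insert e E)"
      using E(2) orth cinner_commute[of _ e] orth_e \<open>norm e = 1\<close> unfolding orthonormal_def
      by (auto simp: cinner_self)
    moreover have "cspan (insert e E) = cspan (insert x E)"
    proof
      show "cspan (insert e E) \<subseteq> cspan (insert x E)"
      proof (rule complex_vector.span_minimal)
        have "p \<in> cspan (insert x E)"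
          using p complex_vector.span_mono[of E "insert x E"] by auto
        then show "insert e E \<subseteq> cspan (insert x E)"
          unfolding e_def by (auto intro!: complex_vector.span_scale complex_vector.span_diff
              intro: complex_vector.span_base)
      qed (rule complex_vector.subspace_span)
      show "cspan (insert x E) \<subseteq> cspan (insert e E)"
      proof (rule complex_vector.span_minimal)
        have "p \<in> cspan (insert e E)"
          using p complex_vector.span_mono[of E "insert e E"] by auto
        moreover have "x = n *\<^sub>C e + p"
          using n by (simp add: e_def scaleC_scaleC)
        ultimately show "insert x E \<subseteq> cspan (insert e E)"
          by (auto intro!: complex_vector.span_add complex_vector.span_scale
              intro: complex_vector.span_base)
      qed (rule complex_vector.subspace_span)
    qed
    ultimately show ?thesis
      using E(1) span_eq by (intro exI[of _ "insert e E"]) simp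
  qed
qed

lemma orth_decomposition:
  assumes "finite X"
  shows "\<exists>u\<in>cspan X. h - u \<in> orth_compl (cspan X)"
proof -
  obtain E where E: "finite E" "orthonormal E" "cspan E = cspan X"
    using orthonormal_basis_exists[OF assms] by blast
  have "(\<Sum>e\<in>E. cinner h e *\<^sub>C e) \<in> cspan X"
    unfolding E(3)[symmetric]
    by (intro complex_vector.span_sum complex_vector.span_scale complex_vector.span_base)
  then show ?thesis
    using orthonormal_residual[OF E(2,1)] E(3) unfolding orth_compl_def by blast
qed

lemma orth_decomposition_unique:
  assumes "complex_vector.subspace U" "u \<in> U" "u' \<in> U"
    and "v \<in> orth_compl U" "v' \<in> orth_compl U" "u + v = u' + v'"
  shows "u = u'" "v = v'"
proof -
  have "u - u' = v' - v"
    using assms(6) by (metis add.commute add_diff_cancel_right diff_add_eq diff_diff_add)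
  moreover have "u - u' \<in> U"
    using assms complex_vector.subspace_diff by blast
  ultimately have "cinner (v' - v) (u - u') = 0"
    using assms by (auto simp: orth_compl_def cinner_diff_left)
  with \<open>u - u' = v' - v\<close> have "cinner (u - u') (u - u') = 0" by simp
  then show "u = u'" by simp
  with assms show "v = v'" by simp
qed

lemma subspace_orth_compl: "complex_vector.subspace (orth_compl U)"
  by (auto simp: complex_vector.subspace_def orth_compl_def cinner_add_left cinner_scaleC_left)

section \<open>Linear operators, representing vectors and adjoints\<close>

lemma clinear_onD:
  assumes "clinear_on UNIV T"
  shows clinear_add: "T (u + v) = T u + T v" and clinear_scale: "T (a *\<^sub>C u) = a *\<^sub>C T u"
  using assms by (auto simp: clinear_on_def)

lemma clinear_zero: "clinear_on UNIV T \<Longrightarrow> T 0 = 0"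
  using clinear_add[of T 0 0] by simp

lemma clinear_diff: "clinear_on UNIV T \<Longrightarrow> T (u - v) = T u - T v"
  by (metis clinear_add add_diff_cancel diff_add_cancel)

lemma clinear_sum: "clinear_on UNIV T \<Longrightarrow> T (sum f A) = (\<Sum>i\<in>A. T (f i))"
  by (induction A rule: infinite_finite_induct) (auto simp: clinear_zero clinear_add)

lemma clinear_orthonormal_expansion:
  assumes "clinear_on UNIV T" "finite E" "orthonormal E" "h \<in> cspan E"
  shows "T h = (\<Sum>e\<in>E. cinner h e *\<^sub>C T e)"
proof -
  have "T h = T (\<Sum>e\<in>E. cinner h e *\<^sub>C e)"
    using assms by (simp add: orthonormal_expansion)
  also have "\<dots> = (\<Sum>e\<in>E. cinner h e *\<^sub>C T e)"
    by (simp add: clinear_sum[OF assms(1)] clinear_scale[OF assms(1)])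
  finally show ?thesis .
qed

lemma riesz_representation:
  fixes \<phi> :: "'h::complex_inner \<Rightarrow> complex"
  assumes E: "finite E" "orthonormal E" "cspan E = (UNIV :: 'h set)"
    and \<phi>: "\<And>u v. \<phi> (u + v) = \<phi> u + \<phi> v" "\<And>a u. \<phi> (a *\<^sub>C u) = a * \<phi> u"
  shows "\<exists>w. \<forall>h. \<phi> h = cinner h w"
proof (intro exI allI)
  fix h
  have "\<phi> 0 = 0"
    using \<phi>(2)[of 0 0] by simp
  then have sum: "\<phi> (sum f A) = (\<Sum>i\<in>A. \<phi> (f i))" for f :: "'h \<Rightarrow> 'h" and A
    by (induction A rule: infinite_finite_induct) (simp_all add: \<phi>(1))
  have "\<phi> h = \<phi> (\<Sum>e\<in>E. cinner h e *\<^sub>C e)"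
    using E by (simp add: orthonormal_expansion)
  also have "\<dots> = cinner h (\<Sum>e\<in>E. cnj (\<phi> e) *\<^sub>C e)"
    by (simp add: sum \<phi>(2) cinner_sum_right cinner_scaleC_right mult.commute)
  finally show "\<phi> h = cinner h (\<Sum>e\<in>E. cnj (\<phi> e) *\<^sub>C e)" .
qed

text \<open>Justifies the definite description in \<open>adj_op\<close>: the representing vector
  exists by Riesz and is unique because the inner product is non-degenerate.\<close>

lemma adj_op_cinner:
  fixes T :: "'h::complex_inner \<Rightarrow> 'h"
  assumes "finite E" "orthonormal E" "cspan E = (UNIV :: 'h set)" "clinear_on UNIV T"
  shows "cinner h (adj_op T g) = cinner (T h) g"
proof -
  obtain w where w: "\<forall>h. cinner (T h) g = cinner h w"
    using riesz_representation[OF assms(1-3), of "\<lambda>h. cinner (T h) g"] assms(4)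
    by (auto simp: clinear_add clinear_scale cinner_add_left cinner_scaleC_left)
  have "adj_op T g = w"
    unfolding adj_op_def
  proof (rule the_equality[where P = "\<lambda>w. \<forall>h. cinner (T h) g = cinner h w", OF w])
    fix w' assume "\<forall>h. cinner (T h) g = cinner h w'"
    with w have "cinner w' h = cinner w h" for h by (metis cinner_commute)
    then show "w' = w" by (rule cinner_left_eqI)
  qed
  with w show ?thesis by simp
qed

text \<open>A vector is a finite sum over its coordinates, so limits of scalar products suffice. In
  this way facts about scalar holomorphic functions become facts about vectors.\<close>

lemma weak_imp_strong_tendsto:
  fixes f :: "'b \<Rightarrow> 'h::complex_inner"
  assumes E: "finite E" "orthonormal E" "cspan E = (UNIV :: 'h set)"
    and "\<And>g. ((\<lambda>w. cinner (f w) g) \<longlongrightarrow> cinner l g) F"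
  shows "(f \<longlongrightarrow> l) F"
proof -
  have "((\<lambda>w. \<Sum>e\<in>E. cinner (f w) e *\<^sub>C e) \<longlongrightarrow> (\<Sum>e\<in>E. cinner l e *\<^sub>C e)) F"
    by (intro tendsto_sum bounded_linear.tendsto[OF bounded_linear_scaleC_left] assms)
  then show ?thesis
    using E by (simp add: orthonormal_expansion)
qed

section \<open>Stieltjes integrals\<close>

text \<open>Vanishing mesh as a filter: linearity, bounds and uniqueness of the integral become
  instances of general facts about \<open>tendsto\<close>.\<close>

definition mesh_filter :: "real \<Rightarrow> real \<Rightarrow> (real \<times> real set) set filter"
  where "mesh_filter a b =
    (INF \<delta>\<in>{0<..}. principal {p. p tagged_division_of {a..b} \<and> (\<lambda>t. ball t \<delta>) fine p})"

definition stieltjes_sum :: "(real \<Rightarrow> complex) \<Rightarrow> (real \<Rightarrow> complex) \<Rightarrow> (real \<times> real set) set \<Rightarrow> complex"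
  where "stieltjes_sum f g p = (\<Sum>(t, K)\<in>p. f t * (g (Sup K) - g (Inf K)))"

lemma eventually_mesh_filter:
  "eventually P (mesh_filter a b) \<longleftrightarrow>
    (\<exists>\<delta>>0. \<forall>p. p tagged_division_of {a..b} \<and> (\<lambda>t. ball t \<delta>) fine p \<longrightarrow> P p)"
proof -
  define X where "X \<delta> = {p. p tagged_division_of {a..b} \<and> (\<lambda>t. ball t \<delta>) fine p}" for \<delta>
  have X_mono: "X c \<subseteq> X d" if "c \<le> d" for c d
    using subset_ball[OF that] unfolding X_def fine_def by blast
  have "eventually P (INF \<delta>\<in>{0<..}. principal (X \<delta>)) \<longleftrightarrow>
      (\<exists>\<delta>\<in>{0<..}. eventually P (principal (X \<delta>)))"
  proof (rule eventually_INF_base)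
    fix c d :: real assume "c \<in> {0<..}" "d \<in> {0<..}"
    then show "\<exists>x\<in>{0<..}. principal (X x) \<le> inf (principal (X c)) (principal (X d))"
      using X_mono[of "min c d" c] X_mono[of "min c d" d]
      by (intro bexI[of _ "min c d"]) auto
  qed auto
  then show ?thesis
    unfolding mesh_filter_def X_def by (simp add: eventually_principal Bex_def)
qed

lemma eventually_mesh_filterI:
  "(\<And>p. p tagged_division_of {a..b} \<Longrightarrow> P p) \<Longrightarrow> eventually P (mesh_filter a b)"
  unfolding eventually_mesh_filter by (auto intro: exI[of _ 1])

text \<open>Cousin's lemma: every gauge admits a fine tagged division. Uniqueness of Stieltjes
  integrals depends on it.\<close>

lemma mesh_filter_neq_bot [simp]: "mesh_filter a b \<noteq> bot"
proof
  assume "mesh_filter a b = bot"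
  then have "eventually (\<lambda>_. False) (mesh_filter a b)" by simp
  then obtain \<delta> where "\<delta> > 0"
      "\<forall>p. p tagged_division_of {a..b} \<and> (\<lambda>t. ball t \<delta>) fine p \<longrightarrow> False"
    unfolding eventually_mesh_filter by blast
  with fine_division_exists_real[of "\<lambda>t. ball t \<delta>" a b] show False
    by (auto simp: gauge_def)
qed

lemma has_stieltjes_integral_iff:
  "has_stieltjes_integral f g a b I \<longleftrightarrow> (stieltjes_sum f g \<longlongrightarrow> I) (mesh_filter a b)"
  unfolding has_stieltjes_integral_def tendsto_iff eventually_mesh_filter stieltjes_sum_def
    dist_norm ..

lemma stieltjes_integral_unique:
  "has_stieltjes_integral f g a b I \<Longrightarrow> has_stieltjes_integral f g a b J \<Longrightarrow> I = J"
  unfolding has_stieltjes_integral_iff using tendsto_unique[OF mesh_filter_neq_bot] .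

lemma stieltjes_integral_scale:
  assumes "has_stieltjes_integral f g a b I"
  shows "has_stieltjes_integral (\<lambda>t. c * f t) g a b (c * I)"
    and "has_stieltjes_integral f (\<lambda>t. c * g t) a b (c * I)"
proof -
  have "stieltjes_sum (\<lambda>t. c * f t) g = (\<lambda>p. c * stieltjes_sum f g p)"
    "stieltjes_sum f (\<lambda>t. c * g t) = (\<lambda>p. c * stieltjes_sum f g p)"
    by (auto simp: stieltjes_sum_def sum_distrib_left algebra_simps intro!: sum.cong ext)
  with assms show "has_stieltjes_integral (\<lambda>t. c * f t) g a b (c * I)"
    "has_stieltjes_integral f (\<lambda>t. c * g t) a b (c * I)"
    by (auto simp: has_stieltjes_integral_iff intro!: tendsto_intros)
qed

lemma stieltjes_integral_diff:
  assumes "has_stieltjes_integral f g a b I" "has_stieltjes_integral f' g a b I'"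
  shows "has_stieltjes_integral (\<lambda>t. f t - f' t) g a b (I - I')"
proof -
  have "stieltjes_sum (\<lambda>t. f t - f' t) g = (\<lambda>p. stieltjes_sum f g p - stieltjes_sum f' g p)"
    by (auto simp: stieltjes_sum_def sum_subtractf[symmetric] algebra_simps intro!: sum.cong ext)
  with assms show ?thesis
    by (auto simp: has_stieltjes_integral_iff intro!: tendsto_intros)
qed

lemma stieltjes_integral_sum_integrator:
  assumes "\<And>i. i \<in> A \<Longrightarrow> has_stieltjes_integral f (g i) a b (I i)"
  shows "has_stieltjes_integral f (\<lambda>t. \<Sum>i\<in>A. g i t) a b (\<Sum>i\<in>A. I i)"
proof -
  have "stieltjes_sum f (\<lambda>t. \<Sum>i\<in>A. g i t) p = (\<Sum>i\<in>A. stieltjes_sum f (g i) p)" for p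
    unfolding stieltjes_sum_def
    by (subst sum.swap)
      (auto simp: sum_distrib_left sum_subtractf[symmetric] intro!: sum.cong)
  then have "stieltjes_sum f (\<lambda>t. \<Sum>i\<in>A. g i t) = (\<lambda>p. \<Sum>i\<in>A. stieltjes_sum f (g i) p)"
    by blast
  with assms show ?thesis
    by (auto simp: has_stieltjes_integral_iff intro!: tendsto_sum)
qed

lemma stieltjes_integral_cnj:
  assumes "has_stieltjes_integral f g a b I"
  shows "has_stieltjes_integral (\<lambda>t. cnj (f t)) (\<lambda>t. cnj (g t)) a b (cnj I)"
proof -
  have "stieltjes_sum (\<lambda>t. cnj (f t)) (\<lambda>t. cnj (g t)) = (\<lambda>p. cnj (stieltjes_sum f g p))"
    by (auto simp: stieltjes_sum_def intro!: sum.cong ext)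
  with assms show ?thesis
    by (auto simp: has_stieltjes_integral_iff intro!: tendsto_intros)
qed

section \<open>Tagged divisions and total variation\<close>

lemma tagged_division_interval:
  assumes "p tagged_division_of {a..b::real}" "(t, K) \<in> p"
  shows "K = {Inf K..Sup K}" "Inf K \<le> t" "t \<le> Sup K" "a \<le> Inf K" "Sup K \<le> b"
proof -
  obtain u v where "K = cbox u v"
    using assms by blast
  moreover have "t \<in> K" "K \<subseteq> {a..b}"
    using assms by blast+
  ultimately show "K = {Inf K..Sup K}" "Inf K \<le> t" "t \<le> Sup K" "a \<le> Inf K" "Sup K \<le> b"
    by auto
qed

lemma stieltjes_sum_cong:
  assumes "p tagged_division_of {a..b}"
    and "\<And>t. a \<le> t \<Longrightarrow> t \<le> b \<Longrightarrow> f t = f' t" "\<And>t. a \<le> t \<Longrightarrow> t \<le> b \<Longrightarrow> g t = g' t"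
  shows "stieltjes_sum f g p = stieltjes_sum f' g' p"
  unfolding stieltjes_sum_def
proof (intro sum.cong refl, clarify)
  fix t K assume "(t, K) \<in> p"
  from tagged_division_interval[OF assms(1) this]
  show "f t * (g (Sup K) - g (Inf K)) = f' t * (g' (Sup K) - g' (Inf K))"
    using assms(2)[of t] assms(3)[of "Sup K"] assms(3)[of "Inf K"] by simp
qed

lemma stieltjes_integral_cong:
  assumes "has_stieltjes_integral f g a b I"
    and "\<And>t. a \<le> t \<Longrightarrow> t \<le> b \<Longrightarrow> f t = f' t" "\<And>t. a \<le> t \<Longrightarrow> t \<le> b \<Longrightarrow> g t = g' t"
  shows "has_stieltjes_integral f' g' a b I"
proof -
  have "eventually (\<lambda>p. stieltjes_sum f g p = stieltjes_sum f' g' p) (mesh_filter a b)"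
    by (intro eventually_mesh_filterI stieltjes_sum_cong assms)
  then show ?thesis
    using assms(1) unfolding has_stieltjes_integral_iff by (auto elim: Lim_transform_eventually)
qed

lemma tagged_division_telescope:
  fixes h :: "real \<Rightarrow> 'a::real_normed_vector"
  assumes "a \<le> b" "p tagged_division_of {a..b}"
  shows "(\<Sum>(t, K)\<in>p. h (Sup K) - h (Inf K)) = h b - h a"
  using additive_tagged_division_1[OF assms] by simp

text \<open>A bound \<open>V\<close> on the total variation, in the form in which it controls Stieltjes sums.\<close>

definition variation_le :: "(real \<Rightarrow> complex) \<Rightarrow> real \<Rightarrow> real \<Rightarrow> real \<Rightarrow> bool"
  where "variation_le g a b V \<longleftrightarrow>
    (\<forall>p. p tagged_division_of {a..b} \<longrightarrow> (\<Sum>(t, K)\<in>p. cmod (g (Sup K) - g (Inf K))) \<le> V)"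

lemma variation_le_nonneg:
  assumes "variation_le g a b V"
  shows "0 \<le> V"
proof -
  have "gauge (\<lambda>t::real. ball t 1)" by (simp add: gauge_def)
  from fine_division_exists_real[OF this, of a b]
  obtain p where "p tagged_division_of {a..b}" .
  then have "(\<Sum>(t, K)\<in>p. cmod (g (Sup K) - g (Inf K))) \<le> V"
    using assms by (auto simp: variation_le_def)
  then show ?thesis
    by (rule order_trans[rotated]) (auto intro!: sum_nonneg)
qed

text \<open>Increments of \<open>\<phi>\<close> telescope over every division. In the applications
  \<open>\<phi>\<close> is the trace of a positive matrix function or a sum of monotone spectral
  functions.\<close>

lemma variation_le_dominated:
  assumes "a \<le> b"
    and "\<And>u v. a \<le> u \<Longrightarrow> u \<le> v \<Longrightarrow> v \<le> b \<Longrightarrow> cmod (g v - g u) \<le> \<phi> v - \<phi> u"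
  shows "variation_le g a b (\<phi> b - \<phi> a)"
  unfolding variation_le_def
proof (intro allI impI)
  fix p assume p: "p tagged_division_of {a..b}"
  have "(\<Sum>(t, K)\<in>p. cmod (g (Sup K) - g (Inf K))) \<le> (\<Sum>(t, K)\<in>p. \<phi> (Sup K) - \<phi> (Inf K))"
  proof (rule sum_mono, clarify)
    fix t K assume "(t, K) \<in> p"
    from tagged_division_interval[OF p this]
    show "cmod (g (Sup K) - g (Inf K)) \<le> \<phi> (Sup K) - \<phi> (Inf K)"
      by (intro assms) linarith+
  qed
  also have "\<dots> = \<phi> b - \<phi> a"
    by (rule tagged_division_telescope[OF assms(1) p])
  finally show "(\<Sum>(t, K)\<in>p. cmod (g (Sup K) - g (Inf K))) \<le> \<phi> b - \<phi> a" .
qed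

lemma bounded_variation_dominated:
  assumes "a \<le> b"
    and "\<And>u v. a \<le> u \<Longrightarrow> u \<le> v \<Longrightarrow> v \<le> b \<Longrightarrow> cmod (g v - g u) \<le> \<phi> v - \<phi> u"
  shows "bounded_variation g a b"
  unfolding bounded_variation_def
proof (intro exI[of _ "\<phi> b - \<phi> a"] allI impI)
  fix \<D> assume D: "\<D> division_of {a..b}"
  have "(\<Sum>K\<in>\<D>. cmod (g (Sup K) - g (Inf K))) \<le> (\<Sum>K\<in>\<D>. \<phi> (Sup K) - \<phi> (Inf K))"
  proof (rule sum_mono)
    fix K assume K: "K \<in> \<D>"
    obtain u v where "K = cbox u v" using D K by blast
    moreover have "K \<noteq> {}" "K \<subseteq> {a..b}" using D K by blast+
    ultimately show "cmod (g (Sup K) - g (Inf K)) \<le> \<phi> (Sup K) - \<phi> (Inf K)"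
      by (auto intro!: assms)
  qed
  \<comment> \<open>Tagging each interval with its left end makes the division a tagged one, over
    which increments telescope.\<close>
  also have "\<dots> = (\<Sum>(t, K)\<in>(\<lambda>K. (Inf K, K)) ` \<D>. \<phi> (Sup K) - \<phi> (Inf K))"
    by (subst sum.reindex) (auto simp: inj_on_def)
  also have "\<dots> = \<phi> b - \<phi> a"
  proof (rule tagged_division_telescope[OF assms(1)], rule tagged_division_ofI)
    fix t K assume K: "(t, K) \<in> (\<lambda>K. (Inf K, K)) ` \<D>"
    then have "K \<in> \<D>" by auto
    then have "\<exists>u v. K = cbox u v" "K \<noteq> {}" "K \<subseteq> {a..b}" using D by blast+
    then show "\<exists>u v. K = cbox u v" "t \<in> K" "K \<subseteq> {a..b}" using K by auto
  next
    show "finite ((\<lambda>K. (Inf K, K)) ` \<D>)" using D by auto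
    have "{K. \<exists>t. (t, K) \<in> (\<lambda>K. (Inf K, K)) ` \<D>} = \<D>" by auto
    then show "\<Union>{K. \<exists>t. (t, K) \<in> (\<lambda>K. (Inf K, K)) ` \<D>} = {a..b}" using D by auto
  qed (use D in auto)
  finally show "(\<Sum>K\<in>\<D>. cmod (g (Sup K) - g (Inf K))) \<le> \<phi> b - \<phi> a" .
qed

lemma variation_le_if_bounded_variation:
  assumes "bounded_variation g a b"
  shows "\<exists>V. variation_le g a b V"
proof -
  obtain B where B: "\<And>\<D>. \<D> division_of {a..b} \<Longrightarrow>
      (\<Sum>K\<in>\<D>. cmod (g (Sup K) - g (Inf K))) \<le> B"
    using assms unfolding bounded_variation_def by blast
  \<comment> \<open>The passage from tagged to plain divisions asks for weight 0 on every degenerate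
    interval. This includes the empty one, where \<open>Sup\<close> and \<open>Inf\<close> carry no
    information.\<close>
  define d where "d K = (if K = {} then 0 else cmod (g (Sup K) - g (Inf K)))" for K :: "real set"
  have "(\<Sum>(t, K)\<in>p. cmod (g (Sup K) - g (Inf K))) \<le> B" if p: "p tagged_division_of {a..b}" for p
  proof -
    have "(\<Sum>(t, K)\<in>p. cmod (g (Sup K) - g (Inf K))) = (\<Sum>(t, K)\<in>p. d K)"
      using p by (intro sum.cong refl) (auto simp: d_def)
    also have "\<dots> = (\<Sum>K\<in>snd ` p. d K)"
      by (rule sum.over_tagged_division_lemma[OF p]) (auto simp: d_def not_less)
    also have "\<dots> = (\<Sum>K\<in>snd ` p. cmod (g (Sup K) - g (Inf K)))"
      using p by (intro sum.cong refl) (auto simp: d_def)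
    also have "\<dots> \<le> B"
      by (rule B[OF division_of_tagged_division[OF p]])
    finally show ?thesis .
  qed
  then show ?thesis
    unfolding variation_le_def by blast
qed

lemma variation_le_sum:
  assumes "\<And>i. i \<in> A \<Longrightarrow> variation_le (g i) a b (V i)"
  shows "variation_le (\<lambda>t. \<Sum>i\<in>A. c i * g i t) a b (\<Sum>i\<in>A. cmod (c i) * V i)"
  unfolding variation_le_def
proof (intro allI impI)
  fix p assume p: "p tagged_division_of {a..b}"
  have "(\<Sum>(t, K)\<in>p. cmod ((\<Sum>i\<in>A. c i * g i (Sup K)) - (\<Sum>i\<in>A. c i * g i (Inf K))))
      \<le> (\<Sum>(t, K)\<in>p. \<Sum>i\<in>A. cmod (c i) * cmod (g i (Sup K) - g i (Inf K)))"
  proof (rule sum_mono, clarify)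
    fix t K
    have "cmod (\<Sum>i\<in>A. c i * (g i (Sup K) - g i (Inf K)))
      \<le> (\<Sum>i\<in>A. cmod (c i) * cmod (g i (Sup K) - g i (Inf K)))"
      by (rule order_trans[OF norm_sum]) (simp add: norm_mult)
    then show "cmod ((\<Sum>i\<in>A. c i * g i (Sup K)) - (\<Sum>i\<in>A. c i * g i (Inf K)))
      \<le> (\<Sum>i\<in>A. cmod (c i) * cmod (g i (Sup K) - g i (Inf K)))"
      by (simp add: sum_subtractf right_diff_distrib)
  qed
  also have "\<dots> = (\<Sum>i\<in>A. cmod (c i) * (\<Sum>(t, K)\<in>p. cmod (g i (Sup K) - g i (Inf K))))"
    unfolding sum_distrib_left split_def by (rule sum.swap)
  also have "\<dots> \<le> (\<Sum>i\<in>A. cmod (c i) * V i)"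
    using assms p by (intro sum_mono mult_left_mono) (auto simp: variation_le_def)
  finally show "(\<Sum>(t, K)\<in>p. cmod ((\<Sum>i\<in>A. c i * g i (Sup K)) - (\<Sum>i\<in>A. c i * g i (Inf K))))
    \<le> (\<Sum>i\<in>A. cmod (c i) * V i)" .
qed

section \<open>Estimates, limits and existence of Stieltjes integrals\<close>

lemma stieltjes_sum_bound:
  assumes p: "p tagged_division_of {a..b}" and V: "variation_le g a b V"
    and f: "\<And>t. a \<le> t \<Longrightarrow> t \<le> b \<Longrightarrow> cmod (f t) \<le> C" and "0 \<le> C"
  shows "cmod (stieltjes_sum f g p) \<le> C * V"
proof -
  have "cmod (stieltjes_sum f g p) \<le> (\<Sum>(t, K)\<in>p. C * cmod (g (Sup K) - g (Inf K)))"
    unfolding stieltjes_sum_def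
  proof (rule sum_norm_le, clarify)
    fix t K assume "(t, K) \<in> p"
    from tagged_division_interval[OF p this] f[of t]
    show "cmod (f t * (g (Sup K) - g (Inf K))) \<le> C * cmod (g (Sup K) - g (Inf K))"
      unfolding norm_mult by (intro mult_right_mono) auto
  qed
  also have "\<dots> = C * (\<Sum>(t, K)\<in>p. cmod (g (Sup K) - g (Inf K)))"
    by (simp add: sum_distrib_left split_def)
  also have "\<dots> \<le> C * V"
    using V p \<open>0 \<le> C\<close> by (auto intro!: mult_left_mono simp: variation_le_def)
  finally show ?thesis .
qed

lemma stieltjes_integral_bound:
  assumes "has_stieltjes_integral f g a b I" "variation_le g a b V"
    and "\<And>t. a \<le> t \<Longrightarrow> t \<le> b \<Longrightarrow> cmod (f t) \<le> C" "0 \<le> C"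
  shows "cmod I \<le> C * V"
proof (rule tendsto_upperbound)
  show "((\<lambda>p. cmod (stieltjes_sum f g p)) \<longlongrightarrow> cmod I) (mesh_filter a b)"
    using assms(1) unfolding has_stieltjes_integral_iff by (rule tendsto_norm)
  show "eventually (\<lambda>p. cmod (stieltjes_sum f g p) \<le> C * V) (mesh_filter a b)"
    by (intro eventually_mesh_filterI stieltjes_sum_bound[OF _ assms(2-4)])
qed simp

text \<open>The variation bound \<open>V\<close> turns uniform closeness of the integrands into
  closeness of all their Stieltjes sums at once, so limit of sums and uniform limit may be
  exchanged.\<close>

lemma stieltjes_integral_uniform_limit:
  assumes V: "variation_le g a b V"
    and approx: "\<And>e. e > 0 \<Longrightarrow> \<exists>f' I'. has_stieltjes_integral f' g a b I' \<and> cmod (I' - I) \<le> e \<and>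
      (\<forall>t. a \<le> t \<longrightarrow> t \<le> b \<longrightarrow> cmod (f t - f' t) \<le> e)"
  shows "has_stieltjes_integral f g a b I"
  unfolding has_stieltjes_integral_iff tendsto_iff
proof (intro allI impI)
  fix e :: real assume "e > 0"
  have "V \<ge> 0" by (rule variation_le_nonneg[OF V])
  define c where "c = e / (V + 3)"
  have "c > 0" using \<open>e > 0\<close> \<open>V \<ge> 0\<close> by (simp add: c_def)
  obtain f' I' where f': "has_stieltjes_integral f' g a b I'" "cmod (I' - I) \<le> c"
      "\<And>t. a \<le> t \<Longrightarrow> t \<le> b \<Longrightarrow> cmod (f t - f' t) \<le> c"
    using approx[OF \<open>c > 0\<close>] by blast
  have "eventually (\<lambda>p. dist (stieltjes_sum f' g p) I' < c) (mesh_filter a b)"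
    using f'(1) \<open>c > 0\<close> unfolding has_stieltjes_integral_iff tendsto_iff by blast
  moreover have "eventually (\<lambda>p. cmod (stieltjes_sum (\<lambda>t. f t - f' t) g p) \<le> c * V) (mesh_filter a b)"
    using \<open>c > 0\<close> by (intro eventually_mesh_filterI stieltjes_sum_bound[OF _ V f'(3)]) auto
  ultimately show "eventually (\<lambda>p. dist (stieltjes_sum f g p) I < e) (mesh_filter a b)"
  proof eventually_elim
    case (elim p)
    have eq: "stieltjes_sum f g p - I = stieltjes_sum (\<lambda>t. f t - f' t) g p
        + (stieltjes_sum f' g p - I') + (I' - I)"
      by (simp add: stieltjes_sum_def sum_subtractf split_def left_diff_distrib)
    have "cmod (stieltjes_sum f g p - I) \<le> cmod (stieltjes_sum (\<lambda>t. f t - f' t) g p)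
        + cmod (stieltjes_sum f' g p - I') + cmod (I' - I)"
      unfolding eq using norm_triangle_ineq[of "stieltjes_sum (\<lambda>t. f t - f' t) g p + (stieltjes_sum f' g p - I')" "I' - I"]
        norm_triangle_ineq[of "stieltjes_sum (\<lambda>t. f t - f' t) g p" "stieltjes_sum f' g p - I'"]
      by linarith
    also have "\<dots> < c * V + c + c + c"
      using elim f'(2) \<open>c > 0\<close> by (simp add: dist_norm)
    also have "\<dots> = c * (V + 3)" by (simp add: algebra_simps)
    also have "\<dots> = e" using \<open>V \<ge> 0\<close> by (simp add: c_def)
    finally show ?case by (simp add: dist_norm)
  qed
qed

text \<open>Half-open intervals \<open>{u..<v}\<close> fit left-continuous integrators. The measure
  is consequently taken on \<open>{a..<b}\<close>, and a mass at \<open>b\<close> has to be placed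
  elsewhere beforehand.\<close>

lemma stieltjes_integral_measure:
  fixes f :: "real \<Rightarrow> complex" and \<nu> :: "real measure"
  assumes "a \<le> b" and f: "continuous_on UNIV f"
    and \<nu>: "sets \<nu> = sets borel" "emeasure \<nu> {a..<b} < \<infinity>"
    and g: "\<And>u v. a \<le> u \<Longrightarrow> u \<le> v \<Longrightarrow> v \<le> b \<Longrightarrow> g v - g u = complex_of_real (measure \<nu> {u..<v})"
  shows "has_stieltjes_integral f g a b (LINT t:{a..<b}|\<nu>. f t)"
  unfolding has_stieltjes_integral_iff tendsto_iff
proof (intro allI impI)
  fix e :: real assume "e > 0"
  define C where "C = measure \<nu> {a..<b}"
  define e' where "e' = e / (C + 1)"
  have "C \<ge> 0" by (simp add: C_def)
  then have "e' > 0" using \<open>e > 0\<close> by (simp add: e'_def)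
  have "uniformly_continuous_on {a..b} f"
    using f by (intro compact_uniformly_continuous continuous_on_subset[OF f]) auto
  then obtain \<delta> where \<delta>: "\<delta> > 0"
      "\<And>s t. s \<in> {a..b} \<Longrightarrow> t \<in> {a..b} \<Longrightarrow> dist s t < \<delta> \<Longrightarrow> dist (f s) (f t) < e'"
    using \<open>e' > 0\<close> unfolding uniformly_continuous_on_def by metis
  have "bounded (f ` {a..b})"
    by (intro compact_imp_bounded compact_continuous_image continuous_on_subset[OF f]) auto
  then obtain B where B: "\<And>t. t \<in> {a..b} \<Longrightarrow> cmod (f t) \<le> B"
    unfolding bounded_iff by (meson imageI)
  have meas [measurable]: "f \<in> borel_measurable \<nu>"
    using borel_measurable_continuous_onI[OF f] measurable_cong_sets[OF \<nu>(1) refl] by blast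
  have fin: "emeasure \<nu> {u..<v} < \<infinity>" if "a \<le> u" "v \<le> b" for u v
    using that by (intro le_less_trans[OF emeasure_mono \<nu>(2)]) (auto simp: \<nu>(1))
  have si: "set_integrable \<nu> {u..<v} f" if "a \<le> u" "v \<le> b" for u v
    unfolding set_integrable_def using that
    by (intro integrableI_bounded_set_indicator[where B = B] fin)
      (auto intro!: B AE_I2 simp: \<nu>(1))
  have si_const: "set_integrable \<nu> {u..<v} (\<lambda>_. c :: complex)" if "a \<le> u" "v \<le> b" for u v c
    unfolding set_integrable_def using that
    by (intro integrableI_bounded_set_indicator[where B = "cmod c"] fin) (auto simp: \<nu>(1))
  \<comment> \<open>The integral over \<open>{a..<b}\<close> telescopes through \<open>h\<close>, so
    the error of a Stieltjes sum splits into errors on single intervals, where uniform continuity of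
    \<open>f\<close> applies.\<close>
  define h where "h s = (LINT t:{a..<s}|\<nu>. f t)" for s
  have h_diff: "h v - h u = (LINT t:{u..<v}|\<nu>. f t)" if "a \<le> u" "u \<le> v" "v \<le> b" for u v
  proof -
    have "{a..<v} = {a..<u} \<union> {u..<v}" "{a..<u} \<inter> {u..<v} = {}" using that by auto
    then show ?thesis
      using that unfolding h_def by (simp add: set_integral_Un si)
  qed
  show "eventually (\<lambda>p. dist (stieltjes_sum f g p) (LINT t:{a..<b}|\<nu>. f t) < e) (mesh_filter a b)"
    unfolding eventually_mesh_filter
  proof (intro exI[of _ \<delta>] conjI allI impI)
    fix p assume p: "p tagged_division_of {a..b} \<and> (\<lambda>t. ball t \<delta>) fine p"
    have "(LINT t:{a..<b}|\<nu>. f t) = h b - h a"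
      by (simp add: h_def set_lebesgue_integral_def)
    also have "\<dots> = (\<Sum>(t, K)\<in>p. h (Sup K) - h (Inf K))"
      using tagged_division_telescope[OF \<open>a \<le> b\<close>] p by metis
    finally have "stieltjes_sum f g p - (LINT t:{a..<b}|\<nu>. f t)
        = (\<Sum>(t, K)\<in>p. f t * (g (Sup K) - g (Inf K)) - (h (Sup K) - h (Inf K)))"
      by (simp add: stieltjes_sum_def sum_subtractf split_def)
    also have "cmod \<dots> \<le> (\<Sum>(t, K)\<in>p. e' * (measure \<nu> {a..<Sup K} - measure \<nu> {a..<Inf K}))"
    proof (rule sum_norm_le, clarify)
      fix t K assume tK: "(t, K) \<in> p"
      note K = tagged_division_interval[OF conjunct1[OF p] tK]
      let ?u = "Inf K" and ?v = "Sup K"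
      have uv: "a \<le> ?u" "?u \<le> ?v" "?v \<le> b" using K by linarith+
      have "f t * (g ?v - g ?u) = (LINT s:{?u..<?v}|\<nu>. f t)"
        using g[OF uv] fin[OF uv(1,3)]
        by (simp add: set_lebesgue_integral_def scaleR_conv_of_real \<nu>(1)
            less_top[symmetric])
      then have "f t * (g ?v - g ?u) - (h ?v - h ?u) = (LINT s:{?u..<?v}|\<nu>. f t - f s)"
        using uv by (simp add: h_diff set_integral_diff si si_const)
      also have "cmod \<dots> \<le> (LINT s:{?u..<?v}|\<nu>. e')"
        unfolding set_lebesgue_integral_def
      proof (rule Bochner_Integration.integral_norm_bound_integral)
        show "integrable \<nu> (\<lambda>s. indicator {?u..<?v} s *\<^sub>R (f t - f s))"
          using set_integral_diff(1)[OF si_const[of ?u ?v "f t"] si[of ?u ?v]] uv by (simp add: set_integrable_def)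
        show "integrable \<nu> (\<lambda>s. indicator {?u..<?v} s *\<^sub>R e')"
          using fin[OF uv(1,3)] by (intro integrable_scaleR_left) (auto simp: \<nu>(1))
        fix s
        have "cmod (f t - f s) \<le> e'" if "s \<in> {?u..<?v}"
        proof -
          have "s \<in> K" using that K(1) by (metis atLeastLessThan_iff atLeastAtMost_iff less_imp_le)
          then have "s \<in> ball t \<delta>"
            using p tK unfolding fine_def by blast
          then have "dist (f t) (f s) < e'"
            using that K by (intro \<delta>(2)) auto
          then show ?thesis by (simp add: dist_norm)
        qed
        then show "cmod (indicator {?u..<?v} s *\<^sub>R (f t - f s)) \<le> indicator {?u..<?v} s *\<^sub>R e'"
          by (auto simp: indicator_def)
      qed
      also have "\<dots> = e' * measure \<nu> {?u..<?v}"
        using fin[OF uv(1,3)] by (simp add: set_lebesgue_integral_def \<nu>(1) less_top[symmetric])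
      also have "measure \<nu> {?u..<?v} = measure \<nu> {a..<?v} - measure \<nu> {a..<?u}"
      proof -
        have "{a..<?v} - {a..<?u} = {?u..<?v}" using uv by auto
        then show ?thesis
          using measure_Diff[of \<nu> "{a..<?v}" "{a..<?u}"] fin[of a ?v] uv
          by (auto simp: \<nu>(1) less_top)
      qed
      finally show "cmod (f t * (g ?v - g ?u) - (h ?v - h ?u))
        \<le> e' * (measure \<nu> {a..<?v} - measure \<nu> {a..<?u})" .
    qed
    also have "\<dots> = e' * (\<Sum>(t, K)\<in>p. measure \<nu> {a..<Sup K} - measure \<nu> {a..<Inf K})"
      by (simp add: sum_distrib_left split_def)
    also have "(\<Sum>(t, K)\<in>p. measure \<nu> {a..<Sup K} - measure \<nu> {a..<Inf K}) = C"
      using tagged_division_telescope[OF \<open>a \<le> b\<close>, of p "\<lambda>s. measure \<nu> {a..<s}"] p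
      by (simp add: C_def)
    also have "e' * C < e"
      using \<open>C \<ge> 0\<close> \<open>e > 0\<close> by (simp add: e'_def field_simps)
    finally show "dist (stieltjes_sum f g p) (LINT t:{a..<b}|\<nu>. f t) < e"
      by (simp add: dist_norm)
  qed (rule \<delta>(1))
qed

text \<open>The integral is that of \<open>f\<close> against the measure whose masses of half-open
  intervals \<open>{u..<v}\<close> are the increments of \<open>\<phi>\<close>. Since
  \<open>interval_measure\<close> is built on intervals open on the left, the measure is constructed
  for the reflected function and reflected back.\<close>

lemma stieltjes_integral_exists:
  fixes f :: "real \<Rightarrow> complex" and \<phi> :: "real \<Rightarrow> real"
  assumes "a \<le> b" and f: "continuous_on UNIV f"
    and mono: "\<And>u v. a \<le> u \<Longrightarrow> u \<le> v \<Longrightarrow> v \<le> b \<Longrightarrow> \<phi> u \<le> \<phi> v"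
    and left: "\<And>t. a < t \<Longrightarrow> t \<le> b \<Longrightarrow> (\<phi> \<longlongrightarrow> \<phi> t) (at_left t)"
  shows "\<exists>I. has_stieltjes_integral f (\<lambda>t. complex_of_real (\<phi> t)) a b I"
proof -
  \<comment> \<open>Clamping to \<open>{a..b}\<close> gives a monotone function on the whole line,
    and the reflection turns left continuity of \<open>\<phi>\<close> into right continuity of
    \<open>F\<close>.\<close>
  define F where "F x = - \<phi> (max a (min b (- x)))" for x
  have "F u \<le> F v" if "u \<le> v" for u v
    using that \<open>a \<le> b\<close> unfolding F_def neg_le_iff_le by (intro mono) auto
  then have F_mono: "mono F" by (auto simp: mono_def)
  have F_cont: "continuous (at_right x) F" for x
  proof -
    have "(F \<longlongrightarrow> F x) (at_right x)"
    proof (cases "a < - x \<and> - x \<le> b")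
      case True
      have "((\<lambda>y. - \<phi> (- y)) \<longlongrightarrow> - \<phi> (- x)) (at_right x)"
      proof (intro tendsto_minus)
        have "filterlim uminus (at_left (- x)) (at_right x)"
          using at_left_minus[of "- x"] by (simp only: filterlim_def minus_minus order_refl)
        then show "((\<lambda>y. \<phi> (- y)) \<longlongrightarrow> \<phi> (- x)) (at_right x)"
          using True by (intro filterlim_compose[OF left[of "- x"]]) auto
      qed
      moreover have "eventually (\<lambda>y. y \<in> {x<..<- a}) (at_right x)"
        using True by (intro eventually_at_right_real) auto
      then have "eventually (\<lambda>y. - \<phi> (- y) = F y) (at_right x)"
        by (rule eventually_mono) (use True in \<open>simp add: F_def\<close>)
      moreover have "F x = - \<phi> (- x)"
        using True by (simp add: F_def)
      ultimately show ?thesis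
        by (simp add: Lim_transform_eventually)
    next
      case False
      have "eventually (\<lambda>y. F x = F y) (at_right x)"
      proof (cases "- x \<le> a")
        case True
        then show ?thesis
          using eventually_at_right_less[of x] \<open>a \<le> b\<close>
          by (elim eventually_mono) (simp add: F_def)
      next
        case 2: False
        with False have "x < - b" by auto
        then show ?thesis
          using eventually_at_right_real[of x "- b"]
          by (auto elim!: eventually_mono simp: F_def)
      qed
      then show ?thesis
        by (rule Lim_transform_eventually[OF tendsto_const])
    qed
    then show ?thesis by (simp add: continuous_within)
  qed
  define \<nu> where "\<nu> = distr (interval_measure F) borel uminus"
  have em: "emeasure \<nu> {u..<v} = ennreal (\<phi> v - \<phi> u)" if "a \<le> u" "u \<le> v" "v \<le> b" for u v
  proof -
    have "emeasure \<nu> {u..<v} = emeasure (interval_measure F) (uminus -` {u..<v} \<inter> space (interval_measure F))"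
      unfolding \<nu>_def by (rule emeasure_distr) simp_all
    also have "uminus -` {u..<v} \<inter> space (interval_measure F) = {- v<..- u}"
      by auto
    also have "emeasure (interval_measure F) {- v<..- u} = ennreal (F (- u) - F (- v))"
      using that by (intro emeasure_interval_measure_Ioc monoD[OF F_mono] F_cont) simp_all
    finally show ?thesis
      using that by (simp add: F_def)
  qed
  have "has_stieltjes_integral f (\<lambda>t. complex_of_real (\<phi> t)) a b (LINT t:{a..<b}|\<nu>. f t)"
  proof (rule stieltjes_integral_measure[OF \<open>a \<le> b\<close> f])
    show "sets \<nu> = sets borel" by (simp add: \<nu>_def)
    show "emeasure \<nu> {a..<b} < \<infinity>" using em[of a b] \<open>a \<le> b\<close> by simp
    fix u v assume "a \<le> u" "u \<le> v" "v \<le> b"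
    then show "complex_of_real (\<phi> v) - complex_of_real (\<phi> u) = complex_of_real (measure \<nu> {u..<v})"
      using mono[of u v] by (simp add: measure_def em)
  qed
  then show ?thesis ..
qed

section \<open>Uniqueness of functions of bounded variation\<close>

lemma one_minus_nonzero: "cmod z < 1 \<Longrightarrow> 1 - z \<noteq> 0"
  by auto

text \<open>For z \<noteq> 0 the difference of the kernels at z and at 0, divided by z, is the
  kernel with one more power of \<open>E\<close>. At z = 0 the new integrand is a uniform limit of
  those at small z, and continuity of \<open>h'\<close> supplies its integral. With
  \<open>h = 0\<close> this serves uniqueness, with resolvent entries it produces the
  moments.\<close>

lemma resolvent_kernel_shift:
  assumes V: "variation_le g a b V" and E: "\<And>t. cmod (E t) = 1"
    and h: "\<And>z. cmod z < 1 \<Longrightarrow> has_stieltjes_integral (\<lambda>t. E t ^ n / (1 - z * E t)) g a b (h z)"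
    and rel: "\<And>z. cmod z < 1 \<Longrightarrow> h z = h 0 + z * h' z"
    and cont: "(h' \<longlongrightarrow> h' 0) (at 0)"
    and "cmod z < 1"
  shows "has_stieltjes_integral (\<lambda>t. E t ^ Suc n / (1 - z * E t)) g a b (h' z)"
proof -
  have nz: "1 - z * E t \<noteq> 0" if "cmod z < 1" for z t
    using one_minus_nonzero[of "z * E t"] that by (simp add: norm_mult E)
  have *: "has_stieltjes_integral (\<lambda>t. E t ^ Suc n / (1 - z * E t)) g a b (h' z)"
    if z: "cmod z < 1" "z \<noteq> 0" for z
  proof -
    have "has_stieltjes_integral (\<lambda>t. inverse z * (E t ^ n / (1 - z * E t) - E t ^ n / (1 - 0 * E t)))
        g a b (inverse z * (h z - h 0))"
      using z by (intro stieltjes_integral_scale stieltjes_integral_diff h) auto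
    moreover have "inverse z * (h z - h 0) = h' z"
      using z rel[of z] by simp
    moreover have "inverse z * (E t ^ n / (1 - z * E t) - E t ^ n / (1 - 0 * E t))
        = E t ^ Suc n / (1 - z * E t)" for t
      using z nz[of z t] by (simp add: divide_simps) (simp add: algebra_simps)
    ultimately show ?thesis by simp
  qed
  show ?thesis
  proof (cases "z = 0")
    case False
    with * assms show ?thesis by blast
  next
    case True
    show ?thesis
      unfolding True
    proof (rule stieltjes_integral_uniform_limit[OF V])
      fix e :: real assume "e > 0"
      have "eventually (\<lambda>z. dist (h' z) (h' 0) < e) (at 0)"
        using cont \<open>e > 0\<close> by (rule tendstoD)
      \<comment> \<open>Below 1/2 the denominator stays above 1/2, which doubles the error
        \<open>cmod z\<close>; hence the second bound \<open>e / 2\<close>.\<close>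
      moreover have "eventually (\<lambda>z. cmod z < min (1/2) (e / 2)) (at (0::complex))"
        using eventually_at_ball[of "min (1/2) (e/2)" "0::complex" UNIV] \<open>e > 0\<close> by simp
      moreover have "eventually (\<lambda>z. z \<noteq> 0) (at (0::complex))"
        by (simp add: eventually_at_filter)
      ultimately have "eventually (\<lambda>z. dist (h' z) (h' 0) < e \<and> cmod z < min (1/2) (e / 2) \<and> z \<noteq> 0) (at 0)"
        by eventually_elim auto
      then obtain z where z: "dist (h' z) (h' 0) < e" "cmod z < 1/2" "cmod z < e / 2" "z \<noteq> 0"
        using eventually_happens'[OF at_neq_bot] by auto
      have "cmod (E t ^ Suc n / (1 - 0 * E t) - E t ^ Suc n / (1 - z * E t)) \<le> e" for t
      proof -
        have "E t ^ Suc n / (1 - 0 * E t) - E t ^ Suc n / (1 - z * E t)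
          = - (z * E t ^ Suc (Suc n) / (1 - z * E t))"
          using nz[of z t] z by (simp add: divide_simps) (simp add: algebra_simps)
        then have "cmod (E t ^ Suc n / (1 - 0 * E t) - E t ^ Suc n / (1 - z * E t))
          = cmod z / cmod (1 - z * E t)"
          by (simp add: norm_mult norm_divide norm_power E)
        also have "\<dots> \<le> cmod z / (1 / 2)"
        proof (rule divide_left_mono)
          have "cmod (z * E t) = cmod z" by (simp add: norm_mult E)
          then show "1 / 2 \<le> cmod (1 - z * E t)"
            using norm_triangle_ineq2[of 1 "z * E t"] z by simp
          show "0 < cmod (1 - z * E t) * (1 / 2)" using nz[of z t] z by auto
        qed simp
        finally show ?thesis using z by simp
      qed
      moreover have "cmod (h' z - h' 0) \<le> e"
        using z(1) by (simp add: dist_norm)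
      ultimately show "\<exists>f' I'. has_stieltjes_integral f' g a b I' \<and> cmod (I' - h' 0) \<le> e \<and>
          (\<forall>t. a \<le> t \<longrightarrow> t \<le> b \<longrightarrow> cmod (E t ^ Suc n / (1 - 0 * E t) - f' t) \<le> e)"
        using *[of z] z
        by (intro exI[of _ "\<lambda>t. E t ^ Suc n / (1 - z * E t)"] exI[of _ "h' z"]) auto
    qed
  qed
qed

text \<open>\<open>E\<close> is abstract because the argument is run for \<open>cis t\<close> and
  for \<open>cis (- t)\<close>.\<close>

lemma power_moments_zero:
  assumes V: "variation_le g a b V" and E: "\<And>t. cmod (E t) = 1"
    and "\<And>z. cmod z < 1 \<Longrightarrow> has_stieltjes_integral (\<lambda>t. 1 / (1 - z * E t)) g a b 0"
  shows "has_stieltjes_integral (\<lambda>t. E t ^ n) g a b 0"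
proof -
  have "\<forall>z. cmod z < 1 \<longrightarrow> has_stieltjes_integral (\<lambda>t. E t ^ n / (1 - z * E t)) g a b 0"
  proof (induction n)
    case (Suc n)
    then show ?case
      using resolvent_kernel_shift[where n = n and h = "\<lambda>_. 0" and h' = "\<lambda>_. 0", OF V E] by auto
  qed (use assms in simp)
  from this[rule_format, of 0] show ?thesis by simp
qed

text \<open>Points inside the disc see only frequencies k \<ge> 0. For k < 0 points outside are
  used: with u = w e^{-it}, 1 - 1 / (1 - 1/u) = 1 / (1 - u). Conjugation cannot replace them, since
  \<open>g\<close> is complex-valued.\<close>

lemma trig_moments_zero:
  assumes V: "variation_le g a b V"
    and z: "\<And>z. cmod z \<noteq> 1 \<Longrightarrow> has_stieltjes_integral (\<lambda>t. 1 / (1 - z * cis t)) g a b 0"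
  shows "has_stieltjes_integral (\<lambda>t. cis (of_int k * t)) g a b 0"
proof (cases "k \<ge> 0")
  case True
  have "has_stieltjes_integral (\<lambda>t. cis t ^ nat k) g a b 0"
    by (rule power_moments_zero[OF V]) (auto intro: z)
  with True show ?thesis by (simp add: Complex.DeMoivre mult.commute)
next
  case False
  have "has_stieltjes_integral (\<lambda>t. cis (- t) ^ nat (- k)) g a b 0"
  proof (rule power_moments_zero[OF V])
    fix w assume w: "cmod w < 1"
    have one: "has_stieltjes_integral (\<lambda>t. 1) g a b 0"
      using z[of 0] by simp
    show "has_stieltjes_integral (\<lambda>t. 1 / (1 - w * cis (- t))) g a b 0"
    proof (cases "w = 0")
      case False
      have "cmod (inverse w) \<noteq> 1" using w False by (auto simp: norm_inverse)
      from stieltjes_integral_diff[OF one z[OF this]]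
      have "has_stieltjes_integral (\<lambda>t. 1 - 1 / (1 - inverse w * cis t)) g a b 0" by simp
      moreover have "1 - 1 / (1 - inverse w * cis t) = 1 / (1 - w * cis (- t))" for t
      proof -
        have "w \<noteq> cis t" using w by auto
        then have "1 - inverse w * cis t \<noteq> 0" "1 - w * inverse (cis t) \<noteq> 0"
          using False by (auto simp: field_simps)
        then show ?thesis
          unfolding cis_inverse[symmetric]
          using False \<open>w \<noteq> cis t\<close> by (simp add: divide_simps) (auto simp: algebra_simps)
      qed
      ultimately show ?thesis by simp
    qed (use one in simp)
  qed simp
  with False show ?thesis by (simp add: Complex.DeMoivre mult.commute)
qed

section \<open>Integration by parts for left-continuous integrators\<close>

lemma uniform_tagged_division:
  fixes s :: "nat \<Rightarrow> real"
  assumes "strict_mono s"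
  shows "(\<lambda>i. (s (Suc i), {s i..s (Suc i)})) ` {..<Suc n} tagged_division_of {s 0..s (Suc n)}"
proof (induction n)
  case 0
  then show ?case
    using tagged_division_of_self_real[of "s 1" "s 0" "s 1"] strict_monoD[OF assms, of 0 1]
    by (simp add: lessThan_Suc)
next
  case (Suc n)
  have less: "s i < s (Suc i)" for i by (rule strict_monoD[OF assms]) simp
  have "s 0 < s (Suc n)" by (rule strict_monoD[OF assms]) simp
  have "{(s (Suc (Suc n)), {s (Suc n)..s (Suc (Suc n))})} tagged_division_of {s (Suc n)..s (Suc (Suc n))}"
    using less[of "Suc n"] by (intro tagged_division_of_self_real) simp
  then have "(\<lambda>i. (s (Suc i), {s i..s (Suc i)})) ` {..<Suc n} \<union>
      {(s (Suc (Suc n)), {s (Suc n)..s (Suc (Suc n))})}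
      tagged_division_of ({s 0..s (Suc n)} \<union> {s (Suc n)..s (Suc (Suc n))})"
    by (intro tagged_division_Un[OF Suc]) auto
  moreover have "{s 0..s (Suc n)} \<union> {s (Suc n)..s (Suc (Suc n))} = {s 0..s (Suc (Suc n))}"
    using less[of "Suc n"] \<open>s 0 < s (Suc n)\<close> by auto
  ultimately show ?case
    by (simp add: lessThan_Suc insert_commute)
qed

text \<open>The cells are open on the left because \<open>G\<close> will hold the value of a
  left-continuous function at the left end of each cell; the end point itself is a null set.\<close>

lemma step_integral:
  fixes f \<psi> G :: "real \<Rightarrow> complex" and s :: "nat \<Rightarrow> real"
  assumes s: "strict_mono s"
    and G: "\<And>i t. s i < t \<Longrightarrow> t \<le> s (Suc i) \<Longrightarrow> G t = g i"
    and f: "\<And>t. s 0 \<le> t \<Longrightarrow> t \<le> s n \<Longrightarrow> (f has_vector_derivative \<psi> t) (at t)"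
  shows "((\<lambda>t. G t * \<psi> t) has_integral (\<Sum>i<n. g i * (f (s (Suc i)) - f (s i)))) {s 0..s n}"
  using f
proof (induction n)
  case 0
  show ?case using has_integral_refl(2)[of "\<lambda>t. G t * \<psi> t" "s 0"] by simp
next
  case (Suc n)
  have less: "s n \<le> s (Suc n)" "s 0 \<le> s n"
    using s by (simp_all add: strict_mono_less_eq)
  have IH: "((\<lambda>t. G t * \<psi> t) has_integral (\<Sum>i<n. g i * (f (s (Suc i)) - f (s i)))) {s 0..s n}"
    by (rule Suc.IH, rule Suc.prems) (use less in linarith)+
  have deriv: "(f has_vector_derivative \<psi> t) (at t within {s n..s (Suc n)})"
    if "t \<in> {s n..s (Suc n)}" for t
    by (rule has_vector_derivative_at_within, rule Suc.prems) (use less that in auto)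
  have "((\<lambda>t. g n * \<psi> t) has_integral (g n * (f (s (Suc n)) - f (s n)))) {s n..s (Suc n)}"
    by (rule has_integral_mult_right, rule fundamental_theorem_of_calculus[OF less(1) deriv])
  then have "((\<lambda>t. G t * \<psi> t) has_integral (g n * (f (s (Suc n)) - f (s n)))) {s n..s (Suc n)}"
  proof (rule has_integral_spike_finite[where S = "{s n}", rotated 2])
    fix t assume "t \<in> {s n..s (Suc n)} - {s n}"
    then show "G t * \<psi> t = g n * \<psi> t" using G[of n t] by auto
  qed simp
  from has_integral_combine[OF less(2,1) IH this] show ?case
    by (simp only: sum.lessThan_Suc)
qed

text \<open>Sums with \<open>g\<close> frozen at left ends of cells are integrals of step functions.
  These converge pointwise by left continuity, and dominated convergence gives both integrability of
  the limit and its value.\<close>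

lemma left_continuous_integral_limit:
  fixes f \<psi> g :: "real \<Rightarrow> complex" and a b :: real
  defines "w \<equiv> \<lambda>n. (b - a) / real (Suc n)"
  defines "s \<equiv> \<lambda>n i. a + real i * w n"
  assumes "a < b"
    and left: "\<And>t. a < t \<Longrightarrow> t \<le> b \<Longrightarrow> (g \<longlongrightarrow> g t) (at_left t)"
    and B: "\<And>t. a \<le> t \<Longrightarrow> t \<le> b \<Longrightarrow> cmod (g t) \<le> B"
    and f: "\<And>t. a \<le> t \<Longrightarrow> t \<le> b \<Longrightarrow> (f has_vector_derivative \<psi> t) (at t)" and \<psi>: "continuous_on UNIV \<psi>"
  shows "(\<lambda>t. g t * \<psi> t) integrable_on {a..b}"
    and "(\<lambda>n. \<Sum>i<Suc n. g (s n i) * (f (s n (Suc i)) - f (s n i)))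
      \<longlonglongrightarrow> integral {a..b} (\<lambda>t. g t * \<psi> t)"
proof -
  have w: "w n > 0" for n using \<open>a < b\<close> by (simp add: w_def)
  have s_mono: "strict_mono (s n)" for n
    by (rule strict_monoI) (use w[of n] in \<open>auto simp: s_def\<close>)
  have s_ends: "s n 0 = a" "s n (Suc n) = b" for n
    by (auto simp: s_def w_def simp del: of_nat_Suc)
  \<comment> \<open>The left end of the cell containing \<open>t\<close>. A ceiling minus 1, instead
    of a floor, keeps it strictly below \<open>t\<close>, as a limit along \<open>at_left t\<close>
    requires.\<close>
  define u where "u n t = a + (of_int \<lceil>(t - a) / w n\<rceil> - 1) * w n" for n t
  \<comment> \<open>Within \<open>{a..b}\<close> the maximum acts only at \<open>t = a\<close>,
    where \<open>u n a\<close> lies one cell below the interval.\<close>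
  define G where "G n t = g (max a (u n t))" for n t
  have u: "t - w n \<le> u n t" "u n t < t" for n t
  proof -
    have "(t - a) / w n \<le> of_int \<lceil>(t - a) / w n\<rceil>" "of_int \<lceil>(t - a) / w n\<rceil> - 1 < (t - a) / w n"
      by linarith+
    then have "t - a \<le> of_int \<lceil>(t - a) / w n\<rceil> * w n" "(of_int \<lceil>(t - a) / w n\<rceil> - 1) * w n < t - a"
      using w[of n] by (simp_all only: pos_divide_le_eq pos_less_divide_eq)
    then show "t - w n \<le> u n t" "u n t < t"
      by (simp_all add: u_def left_diff_distrib)
  qed
  have G_step: "G n t = g (s n i)" if "s n i < t" "t \<le> s n (Suc i)" for n i t
  proof -
    have "real i < (t - a) / w n" "(t - a) / w n \<le> real i + 1"
      using that w[of n] by (auto simp: s_def field_simps)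
    then have "\<lceil>(t - a) / w n\<rceil> = int i + 1"
      by (intro ceiling_unique) auto
    then show ?thesis
      using w[of n] by (simp add: G_def u_def s_def)
  qed
  have G_int: "((\<lambda>t. G n t * \<psi> t) has_integral
      (\<Sum>i<Suc n. g (s n i) * (f (s n (Suc i)) - f (s n i)))) {a..b}" for n
  proof -
    have "((\<lambda>t. G n t * \<psi> t) has_integral
        (\<Sum>i<Suc n. g (s n i) * (f (s n (Suc i)) - f (s n i)))) {s n 0..s n (Suc n)}"
      by (rule step_integral[OF s_mono G_step f]) (simp_all only: s_ends)
    then show ?thesis by (simp only: s_ends)
  qed
  have conv: "(\<lambda>n. G n t) \<longlonglongrightarrow> g t" if t: "t \<in> {a..b}" for t
  proof (cases "t = a")
    case True
    then show ?thesis using w[THEN less_imp_le] by (simp add: G_def u_def max_absorb1)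
  next
    case False
    then have "a < t" using t by auto
    have ge: "a \<le> u n t" for n
    proof -
      have "0 < (t - a) / w n" using \<open>a < t\<close> w[of n] by simp
      then have "1 \<le> \<lceil>(t - a) / w n\<rceil>" by linarith
      then show ?thesis using w[of n] by (simp add: u_def)
    qed
    have "w \<longlonglongrightarrow> 0"
      unfolding w_def by (rule LIMSEQ_Suc[OF lim_const_over_n])
    then have "(\<lambda>n. t - w n) \<longlonglongrightarrow> t"
      using tendsto_diff[OF tendsto_const, of w 0 sequentially t] by simp
    then have "(\<lambda>n. u n t) \<longlonglongrightarrow> t"
      by (rule tendsto_sandwich[OF _ _ _ tendsto_const, rotated 2])
        (auto intro!: always_eventually u less_imp_le[OF u(2)])
    then have "filterlim (\<lambda>n. u n t) (at_left t) sequentially"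
      unfolding filterlim_at using u(2) by (auto intro!: always_eventually simp: less_imp_neq)
    then have "(\<lambda>n. g (u n t)) \<longlonglongrightarrow> g t"
      using t \<open>a < t\<close> by (intro filterlim_compose[OF left]) auto
    then show ?thesis by (simp add: G_def max_def ge)
  qed
  have "compact (\<psi> ` {a..b})"
    by (intro compact_continuous_image continuous_on_subset[OF \<psi>]) auto
  then have "bounded (\<psi> ` {a..b})" by (rule compact_imp_bounded)
  then obtain C where C: "\<And>t. t \<in> {a..b} \<Longrightarrow> cmod (\<psi> t) \<le> C"
    unfolding bounded_iff by (meson imageI)
  have bound: "norm (G n t * \<psi> t) \<le> B * C" if t: "t \<in> {a..b}" for n t
    unfolding norm_mult
  proof (rule mult_mono)
    show "cmod (G n t) \<le> B"
      using t u(2)[of n t] unfolding G_def by (intro B) auto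
    show "0 \<le> B" using B[of a] \<open>a < b\<close> norm_ge_zero[of "g a"] by linarith
  qed (use C t in auto)
  have *: "(\<lambda>t. G n t * \<psi> t) integrable_on {a..b}" for n
    using G_int by blast
  have **: "(\<lambda>_. B * C) integrable_on {a..b}" by (rule integrable_const_ivl)
  have conv': "(\<lambda>n. G n t * \<psi> t) \<longlonglongrightarrow> g t * \<psi> t" if "t \<in> {a..b}" for t
    by (intro tendsto_mult conv[OF that] tendsto_const)
  show "(\<lambda>t. g t * \<psi> t) integrable_on {a..b}"
    by (rule dominated_convergence(1)[OF * ** bound conv'])
  have "(\<lambda>n. integral {a..b} (\<lambda>t. G n t * \<psi> t)) \<longlonglongrightarrow> integral {a..b} (\<lambda>t. g t * \<psi> t)"
    by (rule dominated_convergence(2)[OF * ** bound conv'])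
  then show "(\<lambda>n. \<Sum>i<Suc n. g (s n i) * (f (s n (Suc i)) - f (s n i)))
      \<longlonglongrightarrow> integral {a..b} (\<lambda>t. g t * \<psi> t)"
    by (simp only: integral_unique[OF G_int])
qed

text \<open>Abel summation along uniform divisions. It replaces the integrator by an ordinary
  integrand, so that uniqueness of \<open>g\<close> becomes a question about Fourier
  coefficients.\<close>

lemma stieltjes_integration_by_parts:
  fixes f \<psi> g :: "real \<Rightarrow> complex"
  assumes "a < b"
    and left: "\<And>t. a < t \<Longrightarrow> t \<le> b \<Longrightarrow> (g \<longlongrightarrow> g t) (at_left t)"
    and B: "\<And>t. a \<le> t \<Longrightarrow> t \<le> b \<Longrightarrow> cmod (g t) \<le> B"
    and f: "\<And>t. a \<le> t \<Longrightarrow> t \<le> b \<Longrightarrow> (f has_vector_derivative \<psi> t) (at t)" and \<psi>: "continuous_on UNIV \<psi>"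
    and I: "has_stieltjes_integral f g a b I"
  shows "integral {a..b} (\<lambda>t. g t * \<psi> t) = f b * g b - f a * g a - I"
proof -
  define w where "w n = (b - a) / real (Suc n)" for n
  define s where "s n i = a + real i * w n" for n i
  \<comment> \<open>With tags at right ends, Abel summation leaves \<open>g\<close> at left ends,
    which are the sums treated in \<open>left_continuous_integral_limit\<close>.\<close>
  define p where "p n = (\<lambda>i. (s n (Suc i), {s n i..s n (Suc i)})) ` {..<Suc n}" for n
  have w: "w n > 0" for n using \<open>a < b\<close> by (simp add: w_def)
  have s_mono: "strict_mono (s n)" for n
    by (rule strict_monoI) (use w[of n] in \<open>auto simp: s_def\<close>)
  have s_ends: "s n 0 = a" "s n (Suc n) = b" for n
    by (auto simp: s_def w_def simp del: of_nat_Suc)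
  have p: "p n tagged_division_of {a..b}" for n
    using uniform_tagged_division[OF s_mono[of n], of n] by (simp only: p_def s_ends)
  have s_le: "s n i \<le> s n (Suc i)" for n i
    using s_mono[of n] by (simp add: strict_mono_less_eq)
  have "w \<longlonglongrightarrow> 0"
    unfolding w_def by (rule LIMSEQ_Suc[OF lim_const_over_n])
  have "filterlim p (mesh_filter a b) sequentially"
    unfolding filterlim_iff
  proof (intro allI impI)
    fix P assume "eventually P (mesh_filter a b)"
    then obtain \<delta> where \<delta>: "\<delta> > 0"
        "\<And>q. q tagged_division_of {a..b} \<Longrightarrow> (\<lambda>t. ball t \<delta>) fine q \<Longrightarrow> P q"
      unfolding eventually_mesh_filter by blast
    have "eventually (\<lambda>n. w n < \<delta>) sequentially"
      using order_tendstoD(2)[OF \<open>w \<longlonglongrightarrow> 0\<close> \<delta>(1)] .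
    then show "eventually (\<lambda>n. P (p n)) sequentially"
    proof eventually_elim
      case (elim n)
      have "(\<lambda>t. ball t \<delta>) fine p n"
        unfolding fine_def p_def
      proof clarify
        fix i t assume "t \<in> {s n i..s n (Suc i)}"
        then show "t \<in> ball (s n (Suc i)) \<delta>"
          using elim by (auto simp: s_def dist_real_def algebra_simps)
      qed
      then show ?case by (rule \<delta>(2)[OF p])
    qed
  qed
  with I have "(\<lambda>n. stieltjes_sum f g (p n)) \<longlonglongrightarrow> I"
    unfolding has_stieltjes_integral_iff by (rule filterlim_compose)
  moreover have "stieltjes_sum f g (p n) = f b * g b - f a * g a
      - (\<Sum>i<Suc n. g (s n i) * (f (s n (Suc i)) - f (s n i)))" for n
  proof -
    have inj: "inj_on (\<lambda>i. (s n (Suc i), {s n i..s n (Suc i)})) {..<Suc n}"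
      using strict_mono_eq[OF s_mono[of n]] by (auto simp: inj_on_def)
    have "stieltjes_sum f g (p n) = (\<Sum>i<Suc n. f (s n (Suc i)) * (g (s n (Suc i)) - g (s n i)))"
      unfolding stieltjes_sum_def p_def sum.reindex[OF inj] using s_le by simp
    also have "\<dots> = (\<Sum>i<Suc n. f (s n (Suc i)) * g (s n (Suc i)) - f (s n i) * g (s n i))
        - (\<Sum>i<Suc n. g (s n i) * (f (s n (Suc i)) - f (s n i)))"
      unfolding sum_subtractf[symmetric] by (intro sum.cong) (auto simp: algebra_simps)
    also have "(\<Sum>i<Suc n. f (s n (Suc i)) * g (s n (Suc i)) - f (s n i) * g (s n i))
        = f b * g b - f a * g a"
      unfolding sum_lessThan_telescope[of "\<lambda>i. f (s n i) * g (s n i)"] s_ends ..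
    finally show ?thesis .
  qed
  ultimately have "(\<lambda>n. f b * g b - f a * g a
      - (\<Sum>i<Suc n. g (s n i) * (f (s n (Suc i)) - f (s n i)))) \<longlonglongrightarrow> I"
    by simp
  moreover have "(\<lambda>n. f b * g b - f a * g a
      - (\<Sum>i<Suc n. g (s n i) * (f (s n (Suc i)) - f (s n i))))
      \<longlonglongrightarrow> f b * g b - f a * g a - integral {a..b} (\<lambda>t. g t * \<psi> t)"
    unfolding s_def w_def
    by (intro tendsto_diff tendsto_const left_continuous_integral_limit(2)[OF \<open>a < b\<close> left B f \<psi>])
  ultimately show ?thesis
    using LIMSEQ_unique by fastforce
qed

section \<open>Trigonometric polynomials and Fourier uniqueness\<close>

inductive_set trig_poly :: "(real \<Rightarrow> complex) set" where
  basis: "(\<lambda>t. cis (of_int k * t)) \<in> trig_poly"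
| add: "p \<in> trig_poly \<Longrightarrow> q \<in> trig_poly \<Longrightarrow> (\<lambda>t. p t + q t) \<in> trig_poly"
| scale: "p \<in> trig_poly \<Longrightarrow> (\<lambda>t. c * p t) \<in> trig_poly"

lemma trig_poly_mult:
  assumes "p \<in> trig_poly" "q \<in> trig_poly"
  shows "(\<lambda>t. p t * q t) \<in> trig_poly"
  using assms
proof (induction p)
  case (basis k)
  then show ?case
  proof (induction q)
    case (basis l)
    show ?case
      using trig_poly.basis[of "k + l"] by (simp add: cis_mult distrib_right)
  qed (auto simp: distrib_left mult.left_commute intro: trig_poly.intros)
qed (auto simp: distrib_right mult.assoc intro: trig_poly.intros)

text \<open>The bridge to Stone-Weierstrass. Real polynomials on the plane are generated by
  real-linear functionals f, and f (cis t) = f 1 cos t + f \<i> sin t involves only the frequencies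
  1 and -1.\<close>

lemma trig_poly_real_polynomial:
  assumes "real_polynomial_function P"
  shows "(\<lambda>t. complex_of_real (P (cis t))) \<in> trig_poly"
  using assms
proof (induction P)
  case (linear f)
  interpret bounded_linear f by fact
  have "complex_of_real (f (cis t)) = (f 1 / 2 - \<i> * f \<i> / 2) * cis (of_int 1 * t)
      + (f 1 / 2 + \<i> * f \<i> / 2) * cis (of_int (- 1) * t)" for t
  proof -
    have "cis t = cos t *\<^sub>R 1 + sin t *\<^sub>R \<i>" by (simp add: complex_eq_iff)
    then have "f (cis t) = cos t * f 1 + sin t * f \<i>" by (simp only: add scaleR) simp
    then show ?thesis by (simp add: complex_eq_iff field_simps)
  qed
  then have "(\<lambda>t. complex_of_real (f (cis t))) = (\<lambda>t. (f 1 / 2 - \<i> * f \<i> / 2) * cis (of_int 1 * t)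
      + (f 1 / 2 + \<i> * f \<i> / 2) * cis (of_int (- 1) * t))" by (rule ext)
  then show ?case by (simp only: trig_poly.intros)
next
  case (const c)
  have "(\<lambda>t. complex_of_real c * cis (of_int 0 * t)) \<in> trig_poly"
    by (intro trig_poly.intros)
  then show ?case by simp
next
  case (add p q)
  then show ?case by (auto intro: trig_poly.intros)
next
  case (mult p q)
  then show ?case by (auto intro: trig_poly_mult)
qed

lemma trig_poly_continuous: "p \<in> trig_poly \<Longrightarrow> continuous_on S p"
  by (induction rule: trig_poly.induct) (auto intro!: continuous_intros)

text \<open>A non-zero value at \<open>\<tau>\<close> forces a non-zero integral against a bump on the circle that is supported
  just to the left of \<open>\<tau>\<close>.\<close>

lemma fourier_uniqueness:
  fixes h :: "real \<Rightarrow> complex"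
  assumes left: "\<And>t. 0 < t \<Longrightarrow> t \<le> 2 * pi \<Longrightarrow> (h \<longlongrightarrow> h t) (at_left t)"
    and B: "\<And>t. 0 \<le> t \<Longrightarrow> t \<le> 2 * pi \<Longrightarrow> cmod (h t) \<le> B"
    and int: "\<And>\<psi>. continuous_on UNIV \<psi> \<Longrightarrow> (\<lambda>t. h t * \<psi> t) integrable_on {0..2 * pi}"
    and zero: "\<And>k. integral {0..2 * pi} (\<lambda>t. h t * cis (of_int k * t)) = 0"
    and \<tau>: "0 < \<tau>" "\<tau> \<le> 2 * pi"
  shows "h \<tau> = 0"
proof (rule ccontr)
  assume nz: "h \<tau> \<noteq> 0"
  have "B \<ge> 0" using B[of 0] norm_ge_zero[of "h 0"] pi_ge_zero by linarith
  have trig: "integral {0..2 * pi} (\<lambda>t. h t * p t) = 0" if "p \<in> trig_poly" for p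
    using that
  proof induction
    case (add p q)
    then show ?case
      by (simp add: distrib_left integral_add int trig_poly_continuous)
  next
    case (scale p c)
    then show ?case by (simp add: mult.left_commute[of _ c])
  qed (rule zero)
  \<comment> \<open>Stone-Weierstrass on the circle: as \<open>h\<close> is bounded, orthogonality
    to trigonometric polynomials extends to all continuous functions of
    \<open>cis t\<close>.\<close>
  have circle: "integral {0..2 * pi} (\<lambda>t. h t * complex_of_real (F (cis t))) = 0"
    if F: "continuous_on UNIV F" for F :: "complex \<Rightarrow> real"
  proof -
    have cF: "continuous_on UNIV (\<lambda>t. complex_of_real (F (cis t)))"
      by (rule continuous_on_of_real, rule continuous_on_compose2[OF F])
        (auto intro: continuous_intros)
    have "cmod (integral {0..2 * pi} (\<lambda>t. h t * complex_of_real (F (cis t)))) \<le> e" if "e > 0" for e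
    proof -
      define e' where "e' = e / (B * (2 * pi) + 1)"
      have pos: "B * (2 * pi) + 1 > 0" using \<open>B \<ge> 0\<close> by (simp add: add_nonneg_pos)
      have "e' > 0" using that pos by (simp add: e'_def)
      obtain P where P: "real_polynomial_function P"
          "\<And>x. x \<in> sphere 0 1 \<Longrightarrow> \<bar>F x - P x\<bar> < e'"
        using Stone_Weierstrass_real_polynomial_function[OF compact_sphere
            continuous_on_subset[OF F subset_UNIV] \<open>e' > 0\<close>] by metis
      note tp = trig_poly_real_polynomial[OF P(1)]
      have "integral {0..2 * pi} (\<lambda>t. h t * complex_of_real (F (cis t)))
        = integral {0..2 * pi} (\<lambda>t. h t * complex_of_real (F (cis t)) - h t * complex_of_real (P (cis t)))"
        using integral_diff[OF int[OF cF] int[OF trig_poly_continuous[OF tp]]] trig[OF tp] by simp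
      also have "cmod \<dots> \<le> B * e' * measure lborel {0..2 * pi}"
      proof (rule has_integral_bound_real[where S = "{}"])
        show "((\<lambda>t. h t * complex_of_real (F (cis t)) - h t * complex_of_real (P (cis t))) has_integral
          integral {0..2 * pi} (\<lambda>t. h t * complex_of_real (F (cis t)) - h t * complex_of_real (P (cis t))))
          {0..2 * pi}"
          by (intro integrable_integral integrable_diff int cF trig_poly_continuous[OF tp])
        fix t assume t: "t \<in> {0..2 * pi} - {}"
        have "cmod (complex_of_real (F (cis t)) - complex_of_real (P (cis t))) \<le> e'"
          using P(2)[of "cis t"] by (simp flip: of_real_diff)
        then have "cmod (h t) * cmod (complex_of_real (F (cis t)) - complex_of_real (P (cis t))) \<le> B * e'"
          using B[of t] t \<open>B \<ge> 0\<close> by (intro mult_mono) auto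
        then show "cmod (h t * complex_of_real (F (cis t)) - h t * complex_of_real (P (cis t))) \<le> B * e'"
          by (simp only: norm_mult right_diff_distrib[symmetric])
      qed (use \<open>B \<ge> 0\<close> \<open>e' > 0\<close> in auto)
      also have "\<dots> = (B * (2 * pi)) * e'" by simp
      also have "\<dots> \<le> e"
        using pos \<open>e' > 0\<close> that by (simp add: e'_def field_simps)
      finally show ?thesis .
    qed
    then have "cmod (integral {0..2 * pi} (\<lambda>t. h t * complex_of_real (F (cis t)))) \<le> 0"
      by (rule field_le_epsilon) simp
    then show ?thesis by simp
  qed
  define \<kappa> where "\<kappa> = (cmod (h \<tau>))\<^sup>2 / 2"
  have "\<kappa> > 0" using nz by (simp add: \<kappa>_def)
  have "((\<lambda>t. Re (cnj (h \<tau>) * h t)) \<longlongrightarrow> Re (cnj (h \<tau>) * h \<tau>)) (at_left \<tau>)"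
    by (intro tendsto_intros left \<tau>)
  moreover have "Re (cnj (h \<tau>) * h \<tau>) = (cmod (h \<tau>))\<^sup>2"
    unfolding cmod_power2 by (simp add: power2_eq_square)
  then have "\<kappa> < Re (cnj (h \<tau>) * h \<tau>)" using \<open>\<kappa> > 0\<close> unfolding \<kappa>_def by linarith
  ultimately have "eventually (\<lambda>t. \<kappa> < Re (cnj (h \<tau>) * h t)) (at_left \<tau>)"
    by (rule order_tendstoD)
  then obtain l where l: "l < \<tau>" "\<And>t. l < t \<Longrightarrow> t < \<tau> \<Longrightarrow> \<kappa> < Re (cnj (h \<tau>) * h t)"
    unfolding eventually_at_left[OF \<tau>(1)] by blast
  \<comment> \<open>The arc from \<open>\<sigma> - r\<close> to \<open>\<sigma> + r\<close> runs
    from \<open>max l 0\<close> to \<open>\<tau>\<close>. Its centre is interior to the period even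
    if \<open>\<tau> = 2 * pi\<close>, so the arc does not wrap around.\<close>
  define r where "r = (\<tau> - max l 0) / 2"
  define \<sigma> where "\<sigma> = \<tau> - r"
  have r: "0 < r" and \<sigma>: "0 < \<sigma>" "\<sigma> < 2 * pi" "\<sigma> + r = \<tau>" "l \<le> \<sigma> - r"
    using l(1) \<tau> by (auto simp: r_def \<sigma>_def max_def field_simps)
  define K where "K = {0..2 * pi} - ball \<sigma> r"
  \<comment> \<open>Since \<open>\<sigma>\<close> is interior to the period,
    \<open>cis t = cis \<sigma>\<close> forces \<open>t = \<sigma>\<close> there; compactness of the
    complement \<open>K\<close> of the arc turns this into a positive distance.\<close>
  have "\<exists>\<rho>>0. \<forall>t\<in>K. \<rho> \<le> cmod (cis t - cis \<sigma>)"
  proof (cases "K = {}")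
    case True
    then show ?thesis by (auto intro: exI[of _ 1])
  next
    case False
    have "compact K" unfolding K_def by (intro compact_diff) auto
    moreover have "continuous_on K (\<lambda>t. cmod (cis t - cis \<sigma>))"
      by (intro continuous_intros)
    ultimately obtain t0 where t0: "t0 \<in> K"
        "\<And>t. t \<in> K \<Longrightarrow> cmod (cis t0 - cis \<sigma>) \<le> cmod (cis t - cis \<sigma>)"
      using continuous_attains_inf[OF _ False] by meson
    have "cis t0 \<noteq> cis \<sigma>"
    proof
      assume "cis t0 = cis \<sigma>"
      then have "sin t0 = sin \<sigma> \<and> cos t0 = cos \<sigma>" by (simp add: complex_eq_iff)
      then obtain n where "t0 = \<sigma> + 2 * pi * of_int n"
        using sin_cos_eq_iff[of t0 \<sigma>] by blast
      moreover have "\<bar>t0 - \<sigma>\<bar> < 2 * pi" using t0(1) \<sigma> by (auto simp: K_def)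
      ultimately have "\<bar>of_int n\<bar> * (2 * pi) < 1 * (2 * pi)" by (simp add: abs_mult mult.commute)
      then have "n = 0" by (simp only: mult_less_cancel_right) auto
      then have "t0 = \<sigma>" using \<open>t0 = \<sigma> + 2 * pi * of_int n\<close> by simp
      then show False using t0(1) r by (simp add: K_def)
    qed
    then show ?thesis
      using t0(2) by (intro exI[of _ "cmod (cis t0 - cis \<sigma>)"]) auto
  qed
  then obtain \<rho> where \<rho>: "\<rho> > 0" "\<And>t. t \<in> K \<Longrightarrow> \<rho> \<le> cmod (cis t - cis \<sigma>)" by blast
  \<comment> \<open>A tent around \<open>cis \<sigma>\<close>; by the choice of
    \<open>\<rho>\<close> it vanishes for every t outside the arc.\<close>
  define F where "F z = max 0 (\<rho> - cmod (z - cis \<sigma>))" for z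
  have F: "continuous_on UNIV F" unfolding F_def by (intro continuous_intros)
  have cF: "continuous_on S (\<lambda>t. F (cis t))" for S
    by (rule continuous_on_compose2[OF F]) (auto intro: continuous_intros)
  have "((\<lambda>t. h t * complex_of_real (F (cis t))) has_integral 0) {0..2 * pi}"
    using integrable_integral[OF int[OF continuous_on_of_real[OF cF]]] circle[OF F] by simp
  then have upper: "((\<lambda>t. Re (cnj (h \<tau>) * (h t * complex_of_real (F (cis t))))) has_integral
      Re (cnj (h \<tau>) * 0)) {0..2 * pi}"
    by (intro has_integral_Re has_integral_mult_right)
  have lower: "((\<lambda>t. \<kappa> * F (cis t)) has_integral integral {0..2 * pi} (\<lambda>t. \<kappa> * F (cis t))) {0..2 * pi}"
    by (intro integrable_integral integrable_continuous_real continuous_intros cF)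
  have "\<kappa> * F (cis t) \<le> Re (cnj (h \<tau>) * (h t * complex_of_real (F (cis t))))"
    if t: "t \<in> {0..2 * pi}" for t
  proof (cases "t \<in> K")
    case True
    then have "F (cis t) = 0" using \<rho>(2)[of t] by (simp add: F_def)
    then show ?thesis by simp
  next
    case False
    then have "l < t" "t < \<tau>"
      using t \<sigma> by (auto simp: K_def dist_real_def)
    then have "\<kappa> * F (cis t) \<le> Re (cnj (h \<tau>) * h t) * F (cis t)"
      using l(2)[of t] by (intro mult_right_mono) (auto simp: F_def)
    also have "\<dots> = Re (cnj (h \<tau>) * h t * complex_of_real (F (cis t)))"
      by simp
    finally show ?thesis by (simp only: mult.assoc)
  qed
  with lower upper have "integral {0..2 * pi} (\<lambda>t. \<kappa> * F (cis t)) \<le> Re (cnj (h \<tau>) * 0)"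
    by (rule has_integral_le)
  moreover have "0 < integral {0..2 * pi} (\<lambda>t. \<kappa> * F (cis t))"
  proof -
    have nonneg: "0 \<le> integral {0..2 * pi} (\<lambda>t. \<kappa> * F (cis t))"
      using \<open>\<kappa> > 0\<close>
      by (intro Henstock_Kurzweil_Integration.integral_nonneg integrable_continuous_real continuous_intros cF)
        (auto simp: F_def)
    have "integral {0..2 * pi} (\<lambda>t. \<kappa> * F (cis t)) \<noteq> 0"
    proof
      assume "integral {0..2 * pi} (\<lambda>t. \<kappa> * F (cis t)) = 0"
      moreover have "continuous_on {0..2 * pi} (\<lambda>t. \<kappa> * F (cis t))"
        by (intro continuous_intros cF)
      moreover have "0 \<le> \<kappa> * F (cis t)" for t
        using \<open>\<kappa> > 0\<close> by (simp add: F_def)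
      ultimately have "\<forall>t\<in>{0..2 * pi}. \<kappa> * F (cis t) = 0"
        using integral_eq_0_iff[of 0 "2 * pi" "\<lambda>t. \<kappa> * F (cis t)"] by auto
      then have "\<kappa> * F (cis \<sigma>) = 0" using \<sigma> by auto
      then show False using \<rho>(1) \<open>\<kappa> > 0\<close> by (simp add: F_def)
    qed
    with nonneg show ?thesis by linarith
  qed
  ultimately show False by simp
qed

lemma stieltjes_resolvent_uniqueness:
  assumes V: "variation_le g 0 (2 * pi) V" and "g 0 = 0"
    and left: "\<And>t. 0 < t \<Longrightarrow> t \<le> 2 * pi \<Longrightarrow> (g \<longlongrightarrow> g t) (at_left t)"
    and B: "\<And>t. 0 \<le> t \<Longrightarrow> t \<le> 2 * pi \<Longrightarrow> cmod (g t) \<le> B"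
    and z: "\<And>z. cmod z \<noteq> 1 \<Longrightarrow> has_stieltjes_integral (\<lambda>t. 1 / (1 - z * cis t)) g 0 (2 * pi) 0"
    and t: "0 \<le> t" "t \<le> 2 * pi"
  shows "g t = 0"
proof -
  have moment: "has_stieltjes_integral (\<lambda>t. cis (of_int k * t)) g 0 (2 * pi) 0" for k
    by (rule trig_moments_zero[OF V z])
  have deriv: "((\<lambda>t. cis (of_int k * t)) has_vector_derivative \<i> * of_int k * cis (of_int k * t)) (at t)"
    for k t
  proof -
    have "((\<lambda>z. exp (\<i> * of_int k * z)) has_field_derivative \<i> * of_int k * exp (\<i> * of_int k * z)) (at z)" for z
      by (auto intro!: derivative_eq_intros)
    from has_vector_derivative_real_field[OF this, of t UNIV]
    show ?thesis by (simp add: cis_conv_exp mult.assoc)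
  qed
  have parts: "integral {0..2 * pi} (\<lambda>t. g t * (\<i> * of_int k * cis (of_int k * t))) = g (2 * pi)" for k
  proof -
    have "integral {0..2 * pi} (\<lambda>t. g t * (\<i> * of_int k * cis (of_int k * t)))
        = cis (of_int k * (2 * pi)) * g (2 * pi) - cis (of_int k * 0) * g 0 - 0"
    proof (rule stieltjes_integration_by_parts[OF _ left B deriv _ moment])
      show "continuous_on UNIV (\<lambda>t. \<i> * of_int k * cis (real_of_int k * t))"
        by (intro continuous_intros)
    qed simp
    moreover have "cis (of_int k * (2 * pi)) = 1"
      using cis_multiple_2pi[of "of_int k"] by (simp add: mult.commute)
    ultimately show ?thesis using \<open>g 0 = 0\<close> by simp
  qed
  have g_end: "g (2 * pi) = 0"
    using parts[of 0] by simp
  have int_g: "(\<lambda>t. g t * \<psi> t) integrable_on {0..2 * pi}" if \<psi>: "continuous_on UNIV \<psi>" for \<psi>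
  proof -
    \<comment> \<open>A larger interval gives an antiderivative of \<open>\<psi>\<close> with
      two-sided derivatives at 0 and \<open>2 * pi\<close> as well.\<close>
    have "continuous_on {- 1..2 * pi + 1} \<psi>"
      using \<psi> by (rule continuous_on_subset) simp
    note f = integral_has_vector_derivative[OF this]
    have "((\<lambda>u. integral {- 1..u} \<psi>) has_vector_derivative \<psi> t) (at t)"
      if "0 \<le> t" "t \<le> 2 * pi" for t
    proof -
      have "t \<in> interior {- 1..2 * pi + 1}" using that by simp
      then show ?thesis using f[of t] that by (simp only: at_within_interior atLeastAtMost_iff) simp
    qed
    from left_continuous_integral_limit(1)[OF _ left B this \<psi>] show ?thesis by simp
  qed
  have zero: "integral {0..2 * pi} (\<lambda>t. g t * cis (of_int k * t)) = 0" if "k \<noteq> 0" for k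
    using parts[of k] g_end that by (simp add: mult.left_commute[of _ "\<i> * of_int k"])
  \<comment> \<open>Subtracting the mean removes the one Fourier coefficient that is still
    free.\<close>
  define c where "c = integral {0..2 * pi} g / (2 * pi)"
  have eq: "g \<tau> - c = 0" if "0 < \<tau>" "\<tau> \<le> 2 * pi" for \<tau>
  proof (rule fourier_uniqueness[OF _ _ _ _ that])
    fix t assume t: "0 < t" "t \<le> 2 * pi"
    show "((\<lambda>t. g t - c) \<longlongrightarrow> g t - c) (at_left t)"
      by (intro tendsto_intros left t)
  next
    fix t assume "0 \<le> t" "t \<le> 2 * pi"
    then show "cmod (g t - c) \<le> B + cmod c"
      using norm_triangle_ineq4[of "g t" c] B[of t] by linarith
  next
    fix \<psi> :: "real \<Rightarrow> complex" assume \<psi>: "continuous_on UNIV \<psi>"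
    have "\<psi> integrable_on {0..2 * pi}"
      by (intro integrable_continuous_real continuous_on_subset[OF \<psi>]) simp
    then show "(\<lambda>t. (g t - c) * \<psi> t) integrable_on {0..2 * pi}"
      unfolding left_diff_distrib
      by (intro integrable_diff int_g[OF \<psi>] integrable_on_mult_right)
  next
    fix k
    have cont: "continuous_on S (\<lambda>t. cis (of_int k * t))" for S by (intro continuous_intros)
    have "integral {0..2 * pi} (\<lambda>t. (g t - c) * cis (of_int k * t))
      = integral {0..2 * pi} (\<lambda>t. g t * cis (of_int k * t)) - integral {0..2 * pi} (\<lambda>t. c * cis (of_int k * t))"
      unfolding left_diff_distrib
      by (rule integral_diff[OF int_g[OF cont] integrable_on_mult_right[OF integrable_continuous_real[OF cont]]])
    also have "\<dots> = integral {0..2 * pi} (\<lambda>t. g t * cis (of_int k * t)) - c * integral {0..2 * pi} (\<lambda>t. cis (of_int k * t))"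
      by simp
    also have "\<dots> = 0"
    proof (cases "k = 0")
      case True
      then show ?thesis by (simp add: c_def scaleR_conv_of_real)
    next
      case False
      have "((\<lambda>t. \<i> * of_int k * cis (of_int k * t)) has_integral
          (cis (of_int k * (2 * pi)) - cis (of_int k * 0))) {0..2 * pi}"
        by (rule fundamental_theorem_of_calculus[OF _ has_vector_derivative_at_within[OF deriv]]) simp
      moreover have "cis (of_int k * (2 * pi)) = 1"
        using cis_multiple_2pi[of "of_int k"] by (simp add: mult.commute)
      ultimately have "((\<lambda>t. \<i> * of_int k * cis (of_int k * t)) has_integral 0) {0..2 * pi}"
        by simp
      from integral_unique[OF this] have "integral {0..2 * pi} (\<lambda>t. cis (of_int k * t)) = 0"
        using False by simp
      then show ?thesis by (simp add: zero[OF False])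
    qed
    finally show "integral {0..2 * pi} (\<lambda>t. (g t - c) * cis (of_int k * t)) = 0" .
  qed
  have "c = 0" using eq[of "2 * pi"] g_end by simp
  show ?thesis
  proof (cases "t = 0")
    case False
    then have "g t - c = 0" using t by (intro eq) auto
    with \<open>c = 0\<close> show ?thesis by simp
  qed (simp add: \<open>g 0 = 0\<close>)
qed

section \<open>The Herglotz representation\<close>

text \<open>The numerator is F + cnj F - c on the circle. Cauchy's formula at the point r z handles
  F. The conjugate term reduces to Cauchy's formula at the centre and contributes c, which the
  constant cancels. The formula produces \<open>cis (- t)\<close> in the kernel; the orientation is
  reversed in \<open>herglotz_representation\<close>.\<close>

lemma herglotz_circle_integral:
  fixes F :: "complex \<Rightarrow> complex" and c r :: real and z :: complex
  assumes F: "F holomorphic_on ball 0 1" and F0: "F 0 = complex_of_real c"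
    and r: "0 < r" "r < 1" and z: "cmod z < 1"
  shows "((\<lambda>t. complex_of_real (2 * Re (F (r * cis t)) - c) / (1 - z * cis (- t)))
    has_integral 2 * pi * F (r * z)) {0..2 * pi}"
proof -
  have nz1: "1 - z * cis (- t) \<noteq> 0" for t
    by (rule one_minus_nonzero) (use z in \<open>simp add: norm_mult\<close>)
  have sub: "cball 0 r \<subseteq> ball (0::complex) 1" using r by auto
  have poisson: "((\<lambda>t. G (r * cis t) / (1 - z * cis (- t))) has_integral 2 * pi * G (r * z)) {0..2 * pi}"
    if G: "G holomorphic_on cball 0 r" for G :: "complex \<Rightarrow> complex"
  proof -
    have "cmod (r * z - 0) < r" using r z mult_strict_left_mono[OF z r(1)] by (simp add: norm_mult)
    from Cauchy_integral_circlepath_simple[OF G this]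
    have "((\<lambda>t. G (0 + r * cis t) / (0 + r * cis t - r * z) * r * \<i> * cis t)
        has_integral 2 * pi * \<i> * G (r * z)) {0..2 * pi}"
      unfolding circlepath_def by (subst (asm) has_contour_integral_part_circlepath_iff) auto
    then have "((\<lambda>t. - \<i> * (G (0 + r * cis t) / (0 + r * cis t - r * z) * r * \<i> * cis t))
        has_integral - \<i> * (2 * pi * \<i> * G (r * z))) {0..2 * pi}"
      by (rule has_integral_mult_right)
    moreover have "- \<i> * (G (0 + r * cis t) / (0 + r * cis t - r * z) * r * \<i> * cis t)
        = G (r * cis t) / (1 - z * cis (- t))" for t
    proof -
      have "r * cis t - r * z = r * cis t * (1 - z * cis (- t))"
        by (simp add: right_diff_distrib cis_mult mult.left_commute[of "cis t" z])
      moreover have "- \<i> * (g / (a * b) * r * \<i> * cis t) = g / b"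
        if "a = r * cis t" "a \<noteq> 0" for a b g :: complex
        using that by (cases "b = 0") (simp_all add: field_simps)
      ultimately show ?thesis using r by simp
    qed
    ultimately show ?thesis by (simp add: mult_ac)
  qed
  have A: "((\<lambda>t. F (r * cis t) / (1 - z * cis (- t))) has_integral 2 * pi * F (r * z)) {0..2 * pi}"
    by (rule poisson[OF holomorphic_on_subset[OF F sub]])
  have B: "((\<lambda>t. 1 / (1 - z * cis (- t))) has_integral complex_of_real (2 * pi) * 1) {0..2 * pi}"
    by (rule poisson[of "\<lambda>_. 1"]) (rule holomorphic_on_const)
  have nz2: "1 - cnj z * u / r \<noteq> 0" if "u \<in> cball 0 r" for u
  proof (rule one_minus_nonzero)
    have "cmod (cnj z * u / r) \<le> cmod z * r / r"
      unfolding norm_mult norm_divide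
      using that r by (intro frac_le mult_mono) auto
    then show "cmod (cnj z * u / r) < 1" using r z by simp
  qed
  \<comment> \<open>On the circle the denominator is the conjugate of
    \<open>1 - z * cis (- t)\<close>, and it is holomorphic and non-zero in the closed disc.
    Conjugating the resulting integral gives the term with \<open>cnj F\<close>.\<close>
  have "(\<lambda>u. F u / (1 - cnj z * u / r)) holomorphic_on cball 0 r"
    by (intro holomorphic_intros holomorphic_on_subset[OF F sub]) (use nz2 r in auto)
  from Cauchy_integral_circlepath_simple[OF this, of 0]
  have "((\<lambda>t. F (0 + r * cis t) / (1 - cnj z * (0 + r * cis t) / r) / (0 + r * cis t - 0) * r * \<i> * cis t)
      has_integral 2 * pi * \<i> * (F 0 / (1 - cnj z * 0 / r))) {0..2 * pi}"
    using r(1) unfolding circlepath_def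
    by (simp only: has_contour_integral_part_circlepath_iff zero_less_mult_iff zero_less_numeral
        pi_gt_zero diff_self norm_zero simp_thms of_real_mult of_real_numeral)
  then have "((\<lambda>t. - \<i> * (F (0 + r * cis t) / (1 - cnj z * (0 + r * cis t) / r) / (0 + r * cis t - 0) * r * \<i> * cis t))
      has_integral - \<i> * (2 * pi * \<i> * (F 0 / (1 - cnj z * 0 / r)))) {0..2 * pi}"
    by (rule has_integral_mult_right)
  moreover have "- \<i> * (F (0 + r * cis t) / (1 - cnj z * (0 + r * cis t) / r) / (0 + r * cis t - 0) * r * \<i> * cis t)
      = F (r * cis t) / (1 - cnj z * cis t)" for t
  proof -
    have "- \<i> * (g / b / a * r * \<i> * cis t) = g / b"
      if "a = r * cis t" for a b g :: complex
      using that r by (simp add: field_simps)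
    from this[of "r * cis t" "F (r * cis t)" "1 - cnj z * cis t"] show ?thesis
      using r by simp
  qed
  ultimately have "((\<lambda>t. F (r * cis t) / (1 - cnj z * cis t)) has_integral 2 * pi * F 0) {0..2 * pi}"
    by (simp add: mult_ac)
  then have "((\<lambda>t. cnj (F (r * cis t) / (1 - cnj z * cis t))) has_integral cnj (2 * pi * F 0)) {0..2 * pi}"
    using has_integral_cnj[of "\<lambda>t. F (r * cis t) / (1 - cnj z * cis t)"] by (simp only: comp_def)
  then have C: "((\<lambda>t. cnj (F (r * cis t)) / (1 - z * cis (- t))) has_integral 2 * pi * c) {0..2 * pi}"
    by (simp add: F0 cis_cnj)
  have "((\<lambda>t. F (r * cis t) / (1 - z * cis (- t)) + cnj (F (r * cis t)) / (1 - z * cis (- t))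
      - c * (1 / (1 - z * cis (- t)))) has_integral 2 * pi * F (r * z) + 2 * pi * c - c * (complex_of_real (2 * pi) * 1)) {0..2 * pi}"
    by (intro has_integral_diff has_integral_add A C has_integral_mult_right[OF B])
  moreover have "F (r * cis t) / (1 - z * cis (- t)) + cnj (F (r * cis t)) / (1 - z * cis (- t))
      - c * (1 / (1 - z * cis (- t))) = complex_of_real (2 * Re (F (r * cis t)) - c) / (1 - z * cis (- t))" for t
  proof -
    have "complex_of_real (2 * Re w - c) = w + cnj w - c" for w
      by (simp add: complex_add_cnj)
    then show ?thesis by (simp add: add_divide_distrib diff_divide_distrib)
  qed
  ultimately show ?thesis by simp
qed

lemma lborel_integral_Icc:
  fixes f :: "real \<Rightarrow> complex"
  assumes "(f has_integral I) {a..b}" "continuous_on {a..b} f"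
  shows "(LINT t:{a..b}|lborel. f t) = I"
  using set_borel_integral_eq_integral(2)[OF borel_integrable_atLeastAtMost'[OF assms(2)]] integral_unique[OF assms(1)]
  by simp

text \<open>The bound on \<open>Re (F z)\<close> makes the density non-negative, and the kernel at z
  = 0 shows that division by \<open>2 * pi * c\<close> gives total mass 1. As 2 pi < 7, the interval
  (-1, 7] carries the measure for every r, which will be tightness.\<close>

lemma herglotz_approximant:
  fixes F :: "complex \<Rightarrow> complex" and c r :: real
  assumes F: "F holomorphic_on ball 0 1" and F0: "F 0 = complex_of_real c" and c: "c > 0"
    and Re: "\<And>z. cmod z < 1 \<Longrightarrow> c \<le> 2 * Re (F z)"
    and r: "0 < r" "r < 1"
  shows "\<exists>\<mu>. real_distribution \<mu> \<and> measure \<mu> {- 1<..7} = 1 \<and>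
    (\<forall>z::complex. cmod z < 1 \<longrightarrow> (LINT t|\<mu>. 1 / (1 - z * cis (- t))) = F (r * z) / c)"
proof -
  define u where "u t = (2 * Re (F (r * cis t)) - c) / (2 * pi * c)" for t
  have u_nonneg: "u t \<ge> 0" for t
    using Re[of "r * cis t"] r c by (simp add: u_def norm_mult)
  have contF: "continuous_on S (\<lambda>t. F (r * cis t))" for S
    by (rule continuous_on_compose2[OF holomorphic_on_imp_continuous_on[OF F]])
      (use r in \<open>auto intro!: continuous_intros simp: norm_mult\<close>)
  have contu: "continuous_on S u" for S
    unfolding u_def using c by (intro continuous_intros contF) auto
  have [measurable]: "u \<in> borel_measurable borel"
    by (rule borel_measurable_continuous_onI[OF contu])
  define f where "f t = u t * indicator {0..2 * pi} t" for t
  have [measurable]: "f \<in> borel_measurable borel" unfolding f_def by measurable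
  have f_nonneg: "f t \<ge> 0" for t using u_nonneg by (simp add: f_def)
  define \<mu> where "\<mu> = density lborel (\<lambda>t. ennreal (f t))"
  have kernel: "(LINT t|\<mu>. 1 / (1 - z * cis (- t))) = F (r * z) / c" if z: "cmod z < 1" for z :: complex
  proof -
    have nz1: "1 - z * cis (- t) \<noteq> 0" for t
      by (rule one_minus_nonzero) (use z in \<open>simp add: norm_mult\<close>)
    have contk: "continuous_on S (\<lambda>t. 1 / (1 - z * cis (- t)))" for S
      by (intro continuous_intros) (use nz1 in auto)
    have [measurable]: "(\<lambda>t. 1 / (1 - z * cis (- t))) \<in> borel_measurable borel"
      by (rule borel_measurable_continuous_onI[OF contk])
    have "(LINT t|\<mu>. 1 / (1 - z * cis (- t))) = (LINT t|lborel. f t *\<^sub>R (1 / (1 - z * cis (- t))))"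
      unfolding \<mu>_def by (rule integral_density) (auto simp: f_nonneg)
    also have "\<dots> = (LINT t:{0..2 * pi}|lborel. u t * (1 / (1 - z * cis (- t))))"
      unfolding set_lebesgue_integral_def
      by (intro Bochner_Integration.integral_cong refl)
        (simp add: f_def indicator_def scaleR_conv_of_real)
    also have "\<dots> = F (r * z) / c"
    proof (rule lborel_integral_Icc)
      show "continuous_on {0..2 * pi} (\<lambda>t. u t * (1 / (1 - z * cis (- t))))"
        by (intro continuous_on_mult continuous_on_of_real contu contk)
      have "((\<lambda>t. 1 / (2 * pi * c) * (complex_of_real (2 * Re (F (r * cis t)) - c) / (1 - z * cis (- t))))
          has_integral 1 / (2 * pi * c) * (2 * pi * F (r * z))) {0..2 * pi}"
        by (intro has_integral_mult_right herglotz_circle_integral F F0 r z)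
      then show "((\<lambda>t. u t * (1 / (1 - z * cis (- t)))) has_integral F (r * z) / c) {0..2 * pi}"
        by (simp add: u_def)
    qed
    finally show ?thesis .
  qed
  have total: "emeasure \<mu> UNIV = 1"
  proof -
    have "continuous_on {0..2 * pi} u" by (rule contu)
    then have int: "set_integrable lborel {0..2 * pi} u" by (rule borel_integrable_atLeastAtMost')
    then have f_int: "integrable lborel f"
      unfolding set_integrable_def f_def by (simp add: mult.commute)
    have "emeasure \<mu> UNIV = (\<integral>\<^sup>+ t. ennreal (f t) \<partial>lborel)"
      unfolding \<mu>_def by (subst emeasure_density) auto
    also have "\<dots> = ennreal (LINT t|lborel. f t)"
      by (rule nn_integral_eq_integral[OF f_int]) (simp add: f_nonneg)
    also have "(LINT t|lborel. f t) = 1"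
    proof -
      have "complex_of_real (LINT t|lborel. f t) = (LINT t|lborel. complex_of_real (f t))"
        by simp
      also have "\<dots> = (LINT t|\<mu>. 1 / (1 - 0 * cis (- t)))"
        unfolding \<mu>_def by (subst integral_density) (auto simp: f_nonneg scaleR_conv_of_real)
      also have "\<dots> = 1"
        using kernel[of 0] F0 c by simp
      finally show ?thesis using of_real_eq_1_iff by blast
    qed
    finally show ?thesis by simp
  qed
  have "prob_space \<mu>"
    by (rule prob_spaceI) (use total in \<open>simp add: \<mu>_def\<close>)
  then have rd: "real_distribution \<mu>"
    by (simp add: real_distribution_def real_distribution_axioms_def \<mu>_def)
  have "emeasure \<mu> {- 1<..7} = emeasure \<mu> UNIV"
  proof -
    have "2 * pi \<le> 7" using pi_less_4 pi_approx(2) by (simp add: field_simps) 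
    then have "ennreal (f t) * indicator {- 1<..7} t = ennreal (f t) * indicator UNIV t" for t
      by (simp add: f_def indicator_def)
    then show ?thesis
      unfolding \<mu>_def by (simp add: emeasure_density)
  qed
  then have "measure \<mu> {- 1<..7} = 1"
    by (simp add: measure_def total)
  with rd kernel show ?thesis by blast
qed

lemma left_continuous_measure_lessThan:
  fixes \<nu> :: "real measure"
  assumes "finite_measure \<nu>" and sets: "sets \<nu> = sets borel"
  shows "((\<lambda>t. measure \<nu> {..<t}) \<longlongrightarrow> measure \<nu> {..<a}) (at_left a)"
proof (rule tendsto_at_left_sequentially[of "a - 1"])
  interpret finite_measure \<nu> by fact
  fix S :: "nat \<Rightarrow> real" assume S: "\<And>n. S n < a" "incseq S" "S \<longlonglongrightarrow> a"
  have "(\<lambda>n. measure \<nu> {..<S n}) \<longlonglongrightarrow> measure \<nu> (\<Union>n. {..<S n})"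
  proof (rule finite_Lim_measure_incseq)
    show "incseq (\<lambda>n. {..<S n})"
      using S(2) unfolding incseq_def by (meson lessThan_subset_iff)
  qed (auto simp: sets)
  also have "(\<Union>n. {..<S n}) = {..<a}"
  proof (intro equalityI subsetI)
    fix x assume "x \<in> {..<a}"
    then have "eventually (\<lambda>n. x < S n) sequentially"
      using order_tendstoD(1)[OF S(3), of x] by simp
    then show "x \<in> (\<Union>n. {..<S n})"
      using eventually_happens'[OF sequentially_bot] by auto
  qed (use S(1) in \<open>auto intro: less_trans\<close>)
  finally show "(\<lambda>n. measure \<nu> {..<S n}) \<longlonglongrightarrow> measure \<nu> {..<a}" .
qed simp

text \<open>Herglotz' theorem for 2 F - c, since 2 / (1 - w) - 1 = (1 + w) / (1 - w). The circle
  measures for radii tending to 1 are tight, so a subsequence converges weakly, and the kernel,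
  being bounded and continuous for |z| < 1, passes to the limit.\<close>

lemma herglotz_representation:
  fixes F :: "complex \<Rightarrow> complex" and c :: real
  assumes F: "F holomorphic_on ball 0 1" and F0: "F 0 = complex_of_real c" and c: "c > 0"
    and Re: "\<And>z. cmod z < 1 \<Longrightarrow> c \<le> 2 * Re (F z)"
  shows "\<exists>\<phi>::real \<Rightarrow> real. \<phi> 0 = 0 \<and> (\<forall>u v. u \<le> v \<longrightarrow> \<phi> u \<le> \<phi> v) \<and>
    (\<forall>t. (\<phi> \<longlongrightarrow> \<phi> t) (at_left t)) \<and>
    (\<forall>z. cmod z < 1 \<longrightarrow>
      has_stieltjes_integral (\<lambda>t. 1 / (1 - z * cis t)) (\<lambda>t. complex_of_real (\<phi> t)) 0 (2 * pi) (F z))"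
proof -
  \<comment> \<open>The summand 2 keeps the radius positive already for
    \<open>n = 0\<close>.\<close>
  define r where "r n = 1 - 1 / real (n + 2)" for n
  have r: "0 < r n" "r n < 1" for n
    by (auto simp: r_def field_simps)
  have "\<forall>n. \<exists>\<mu>. real_distribution \<mu> \<and> measure \<mu> {- 1<..7} = 1 \<and>
    (\<forall>z::complex. cmod z < 1 \<longrightarrow> (LINT t|\<mu>. 1 / (1 - z * cis (- t))) = F (r n * z) / c)"
    using herglotz_approximant[OF F F0 c Re r] by blast
  then obtain \<mu> where \<mu>: "\<And>n. real_distribution (\<mu> n)" "\<And>n. measure (\<mu> n) {- 1<..7} = 1"
      "\<And>n (z::complex). cmod z < 1 \<Longrightarrow> (LINT t|\<mu> n. 1 / (1 - z * cis (- t))) = F (r n * z) / c"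
    by metis
  have "tight \<mu>"
    unfolding tight_def
  proof (intro conjI allI impI \<mu>(1))
    fix \<epsilon> :: real assume "\<epsilon> > 0"
    then show "\<exists>a b. a < b \<and> (\<forall>n. 1 - \<epsilon> < measure (\<mu> n) {a<..b})"
      by (intro exI[of _ "- 1"] exI[of _ 7]) (simp add: \<mu>(2))
  qed
  from tight_imp_convergent_subsubsequence[OF this strict_mono_id]
  obtain q M where q: "strict_mono (q :: nat \<Rightarrow> nat)" and M: "real_distribution M" "weak_conv_m (\<mu> \<circ> id \<circ> q) M"
    by blast
  interpret M: real_distribution M by (rule M(1))
  have kernel: "(LINT t|M. 1 / (1 - z * cis (- t))) = F z / c" if z: "cmod z < 1" for z
  proof -
    have nz: "1 - z * cis (- t) \<noteq> 0" for t
      by (rule one_minus_nonzero) (use z in \<open>simp add: norm_mult\<close>)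
    have "(\<lambda>n. LINT t|(\<mu> \<circ> id \<circ> q) n. 1 / (1 - z * cis (- t))) \<longlonglongrightarrow> (LINT t|M. 1 / (1 - z * cis (- t)))"
    proof (rule weak_conv_imp_integral_bdd_continuous_conv[OF _ M(1,2)])
      have "continuous_on UNIV (\<lambda>t. 1 / (1 - z * cis (- t)))"
        by (intro continuous_intros) (use nz in auto)
      then show "isCont (\<lambda>t. 1 / (1 - z * cis (- t))) t" for t
        by (simp add: continuous_on_eq_continuous_at)
      show "cmod (1 / (1 - z * cis (- t))) \<le> 1 / (1 - cmod z)" for t
      proof -
        have "1 - cmod z \<le> cmod (1 - z * cis (- t))"
          using norm_triangle_ineq2[of 1 "z * cis (- t)"] by (simp add: norm_mult)
        then show ?thesis
          using z by (simp add: norm_divide frac_le)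
      qed
    qed (simp add: \<mu>(1))
    then have "(\<lambda>n. F (r (q n) * z) / c) \<longlonglongrightarrow> (LINT t|M. 1 / (1 - z * cis (- t)))"
      by (simp add: \<mu>(3)[OF z])
    moreover have "(\<lambda>n. F (r (q n) * z) / c) \<longlonglongrightarrow> F z / c"
    proof -
      have "r \<longlonglongrightarrow> 1 - 0"
        unfolding r_def by (intro tendsto_diff tendsto_const LIMSEQ_ignore_initial_segment[OF lim_1_over_n])
      then have "(\<lambda>n. r (q n)) \<longlonglongrightarrow> 1"
        using LIMSEQ_subseq_LIMSEQ[OF _ q, of r] by (simp add: o_def)
      then have "(\<lambda>n. complex_of_real (r (q n)) * z) \<longlonglongrightarrow> of_real 1 * z"
        by (intro tendsto_mult tendsto_of_real tendsto_const)
      moreover have "isCont F z"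
        using holomorphic_on_imp_continuous_on[OF F] z
        by (simp add: continuous_on_eq_continuous_at)
      ultimately have "(\<lambda>n. F (complex_of_real (r (q n)) * z)) \<longlonglongrightarrow> F z"
        using isCont_tendsto_compose[of z F] by simp
      then show ?thesis
        using c by (intro tendsto_divide tendsto_const) auto
    qed
    ultimately show ?thesis by (rule LIMSEQ_unique)
  qed
  text \<open>Reflect and reduce modulo \<open>2 * pi\<close>, so that a mass at \<open>2 * pi\<close> is moved to the left end point.\<close>
  define h where "h t = - t - 2 * pi * of_int \<lfloor>- t / (2 * pi)\<rfloor>" for t :: real
  have [measurable]: "h \<in> borel_measurable borel" unfolding h_def by measurable
  have h_range: "0 \<le> h t" "h t < 2 * pi" for t
  proof -
    have two_pi: "0 < 2 * pi" by simp
    have "of_int \<lfloor>- t / (2 * pi)\<rfloor> \<le> - t / (2 * pi)" "- t / (2 * pi) < of_int \<lfloor>- t / (2 * pi)\<rfloor> + 1"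
      by linarith+
    then have "of_int \<lfloor>- t / (2 * pi)\<rfloor> * (2 * pi) \<le> - t" "- t < (of_int \<lfloor>- t / (2 * pi)\<rfloor> + 1) * (2 * pi)"
      by (simp_all only: pos_le_divide_eq[OF two_pi] pos_divide_less_eq[OF two_pi])
    then show "0 \<le> h t" "h t < 2 * pi"
      unfolding h_def by (simp_all only: distrib_right mult.commute[of "2 * pi"])
  qed
  have cis_h: "cis (h t) = cis (- t)" for t
  proof -
    have "cis (h t) = cis (- t) * cis (2 * pi * of_int (- \<lfloor>- t / (2 * pi)\<rfloor>))"
      unfolding cis_mult h_def by simp
    then show ?thesis by (simp add: cis_multiple_2pi del: of_int_minus)
  qed
  define \<nu> where "\<nu> = distr M borel h"
  have \<nu>: "prob_space \<nu>" unfolding \<nu>_def by (rule M.prob_space_distr) simp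
  interpret \<nu>: prob_space \<nu> by (rule \<nu>)
  have sets_\<nu>: "sets \<nu> = sets borel" by (simp add: \<nu>_def)
  define \<phi> where "\<phi> t = c * measure \<nu> {..<t}" for t
  have AE: "AE t in \<nu>. t \<in> {0..<2 * pi}"
    unfolding \<nu>_def by (subst AE_distr_iff) (auto simp: h_range)
  have "\<phi> 0 = 0"
  proof -
    have "AE t in \<nu>. t \<notin> {..<0}" using AE by eventually_elim auto
    then have "measure \<nu> {..<0} = 0"
      by (subst \<nu>.prob_eq_0) (auto simp: sets_\<nu>)
    then show ?thesis by (simp add: \<phi>_def)
  qed
  moreover have "\<phi> u \<le> \<phi> v" if "u \<le> v" for u v
    unfolding \<phi>_def using c that
    by (intro mult_left_mono \<nu>.finite_measure_mono) (auto simp: sets_\<nu>)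
  moreover have "(\<phi> \<longlongrightarrow> \<phi> t) (at_left t)" for t
    unfolding \<phi>_def
    by (intro tendsto_mult tendsto_const left_continuous_measure_lessThan sets_\<nu>)
      (rule \<nu>.finite_measure_axioms)
  moreover have "has_stieltjes_integral (\<lambda>t. 1 / (1 - z * cis t)) (\<lambda>t. complex_of_real (\<phi> t)) 0 (2 * pi) (F z)"
    if z: "cmod z < 1" for z
  proof -
    have nz: "1 - z * cis t \<noteq> 0" for t
      by (rule one_minus_nonzero) (use z in \<open>simp add: norm_mult\<close>)
    have cont: "continuous_on UNIV (\<lambda>t. 1 / (1 - z * cis t))"
      using nz by (intro continuous_intros) auto
    have meas [measurable]: "(\<lambda>t. 1 / (1 - z * cis t)) \<in> borel_measurable borel"
      by (rule borel_measurable_continuous_onI[OF cont])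
    have "has_stieltjes_integral (\<lambda>t. 1 / (1 - z * cis t)) (\<lambda>t. complex_of_real (measure \<nu> {..<t})) 0 (2 * pi)
        (LINT t:{0..<2 * pi}|\<nu>. 1 / (1 - z * cis t))"
    proof (rule stieltjes_integral_measure[OF _ cont sets_\<nu>])
      show "emeasure \<nu> {0..<2 * pi} < \<infinity>"
        using \<nu>.emeasure_finite[of "{0..<2 * pi}"] by (simp add: less_top[symmetric])
      fix u v :: real assume "u \<le> v"
      then have "{..<v} - {..<u} = {u..<v}" by auto
      then show "complex_of_real (measure \<nu> {..<v}) - complex_of_real (measure \<nu> {..<u})
          = complex_of_real (measure \<nu> {u..<v})"
        using \<nu>.finite_measure_Diff[of "{..<v}" "{..<u}"] \<open>u \<le> v\<close> by (simp add: sets_\<nu>)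
    qed simp
    also have "(LINT t:{0..<2 * pi}|\<nu>. 1 / (1 - z * cis t)) = (LINT t|\<nu>. 1 / (1 - z * cis t))"
      unfolding set_lebesgue_integral_def
    proof (rule integral_cong_AE)
      show "AE t in \<nu>. indicat_real {0..<2 * pi} t *\<^sub>R (1 / (1 - z * cis t)) = 1 / (1 - z * cis t)"
        using AE by eventually_elim simp
    qed (auto simp: \<nu>_def)
    also have "\<dots> = (LINT t|M. 1 / (1 - z * cis (h t)))"
      unfolding \<nu>_def by (rule integral_distr) (auto simp: meas)
    also have "\<dots> = F z / c"
      unfolding cis_h by (rule kernel[OF z])
    finally have "has_stieltjes_integral (\<lambda>t. 1 / (1 - z * cis t)) (\<lambda>t. c * complex_of_real (measure \<nu> {..<t}))
        0 (2 * pi) (c * (F z / c))"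
      by (rule stieltjes_integral_scale)
    then show ?thesis using c by (simp add: \<phi>_def)
  qed
  ultimately show ?thesis by (intro exI[of _ \<phi>]) blast
qed

section \<open>Resolvents of contractions\<close>

text \<open>E - T*T is non-negative and its form vanishes at u, so it annihilates u. Without
  adjoints: along u + s h the form is non-negative and starts at 0, so its linear term in s must
  vanish.\<close>

lemma contraction_preserves_cinner:
  fixes T :: "'h::complex_inner \<Rightarrow> 'h"
  assumes T: "clinear_on UNIV T" "\<And>h. norm (T h) \<le> norm h" and u: "norm (T u) = norm u"
  shows "cinner (T h) (T u) = cinner h u"
proof (rule ccontr)
  assume neq: "cinner (T h) (T u) \<noteq> cinner h u"
  define \<delta> where "\<delta> = cinner (T h) (T u) - cinner h u"
  define K where "K = (norm h)\<^sup>2 - (norm (T h))\<^sup>2"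
  have "K \<ge> 0" using T(2)[of h] by (simp add: K_def power_mono)
  have \<delta>: "(cmod \<delta>)\<^sup>2 > 0" using neq by (simp add: \<delta>_def)
  \<comment> \<open>Non-negativity along \<open>s *\<^sub>C h + u\<close> would force 2 \<le> t K;
    this t makes t K at most 1.\<close>
  define t where "t = 1 / (K + 1)"
  have "t > 0" using \<open>K \<ge> 0\<close> by (simp add: t_def)
  define s where "s = complex_of_real t * cnj \<delta>"
  have "(norm (T (s *\<^sub>C h + u)))\<^sup>2 \<le> (norm (s *\<^sub>C h + u))\<^sup>2"
    using T(2) by (simp add: power_mono)
  then have "2 * Re (s * \<delta>) \<le> (cmod s)\<^sup>2 * K"
    using u by (simp add: clinear_add[OF T(1)] clinear_scale[OF T(1)] norm_add_sq cinner_scaleC_left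
        power_mult_distrib \<delta>_def K_def right_diff_distrib)
  moreover have "Re (s * \<delta>) = t * (cmod \<delta>)\<^sup>2"
  proof -
    have "s * \<delta> = complex_of_real t * (\<delta> * cnj \<delta>)" by (simp add: s_def mult_ac)
    also have "\<dots> = complex_of_real (t * (cmod \<delta>)\<^sup>2)" by (simp only: complex_norm_square of_real_mult)
    finally show ?thesis by simp
  qed
  moreover have "(cmod s)\<^sup>2 = t\<^sup>2 * (cmod \<delta>)\<^sup>2"
    by (simp add: s_def norm_mult power_mult_distrib)
  ultimately have "(cmod \<delta>)\<^sup>2 * (t * 2) \<le> (cmod \<delta>)\<^sup>2 * (t * (t * K))"
    by (simp add: power2_eq_square mult_ac)
  then have "2 \<le> t * K"
    using \<delta> \<open>t > 0\<close> by (simp only: mult_le_cancel_left_pos)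
  moreover have "t * K \<le> 1" using \<open>K \<ge> 0\<close> by (simp add: t_def)
  ultimately show False by simp
qed

text \<open>Solving \<open>h - T h = g\<close> means finding the fixed point of
  \<open>g + T h\<close>, which Banach's theorem supplies.\<close>

lemma bij_identity_minus_contraction:
  fixes T :: "'h::chilbert_space \<Rightarrow> 'h"
  assumes lip: "\<And>u v. norm (T u - T v) \<le> c * norm (u - v)" and c: "c < 1" "0 \<le> c"
  shows "bij (\<lambda>h. h - T h)"
proof (rule bijI)
  show "inj (\<lambda>h. h - T h)"
  proof (rule injI)
    fix u v assume "u - T u = v - T v"
    then have "u - v = T u - T v" by (simp add: algebra_simps)
    then have "norm (u - v) \<le> c * norm (u - v)" using lip[of u v] by simp
    then have "(1 - c) * norm (u - v) \<le> 0" by (simp add: left_diff_distrib)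
    then show "u = v" using c by (simp add: mult_le_0_iff)
  qed
  show "surj (\<lambda>h. h - T h)"
  proof (rule surjI[where f = "\<lambda>g. SOME h. h - T h = g"])
    fix g
    have "\<exists>!h. (\<lambda>h. g + T h) h = h"
      by (rule banach_fix_type[OF c(2,1)]) (use lip in \<open>simp add: dist_norm\<close>)
    then obtain h where "g + T h = h" by blast
    then have "h - T h = g" by (metis add_diff_cancel_right')
    then have "\<exists>h. h - T h = g" ..
    then show "(SOME h. h - T h = g) - T (SOME h. h - T h = g) = g" by (rule someI_ex)
  qed
qed

text \<open>Lax-Milgram: for small a > 0 coercivity makes E - a R a strict contraction, so a R = E -
  (E - a R) is bijective.\<close>

lemma coercive_bij:
  fixes R :: "'h::chilbert_space \<Rightarrow> 'h"
  assumes lin: "clinear_on UNIV R" and bound: "\<And>h. norm (R h) \<le> B * norm h"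
    and pos: "\<And>h. (norm h)\<^sup>2 \<le> 2 * Re (cinner (R h) h)"
  shows "bij R"
proof -
  define b where "b = \<bar>B\<bar> + 1"
  have b: "b \<ge> 1" "\<And>h. norm (R h) \<le> b * norm h"
  proof -
    show "norm (R h) \<le> b * norm h" for h
      by (rule order_trans[OF bound]) (auto simp: b_def intro!: mult_right_mono)
  qed (simp add: b_def)
  \<comment> \<open>The squared norm of E - a R is at most 1 - a + a^2 b^2; with a b^2 = 1/2 this is
    1 - a/2 < 1.\<close>
  define a where "a = 1 / (2 * b\<^sup>2)"
  have a: "a > 0" "a * b\<^sup>2 = 1 / 2" "a \<le> 1"
  proof -
    have "b\<^sup>2 \<ge> 1" using b(1) by (rule one_le_power)
    then show "a > 0" "a * b\<^sup>2 = 1 / 2" by (auto simp: a_def)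
    show "a \<le> 1" unfolding a_def using \<open>b\<^sup>2 \<ge> 1\<close> by (subst divide_le_eq_1) linarith
  qed
  define c where "c = sqrt (1 - a / 2)"
  have c: "0 \<le> c" "c < 1" "c\<^sup>2 = 1 - a / 2"
    using a by (auto simp: c_def real_sqrt_less_iff[of _ 1, simplified])
  have le: "norm (h - a *\<^sub>R R h) \<le> c * norm h" for h
  proof (rule power2_le_imp_le)
    have "(norm (h - a *\<^sub>R R h))\<^sup>2 = (norm h)\<^sup>2 - a * (2 * Re (cinner (R h) h)) + a\<^sup>2 * (norm (R h))\<^sup>2"
      unfolding norm_diff_sq cinner_commute[of h "a *\<^sub>R R h"]
      by (simp add: cinner_scaleR_left power_mult_distrib)
    also have "\<dots> \<le> (norm h)\<^sup>2 - a * (norm h)\<^sup>2 + a\<^sup>2 * (b * norm h)\<^sup>2"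
      using a pos[of h] b(2)[of h] by (intro add_mono diff_mono mult_left_mono power_mono) auto
    also have "\<dots> = (norm h)\<^sup>2 * (1 - a + a * (a * b\<^sup>2))"
      by (simp add: power_mult_distrib power2_eq_square algebra_simps)
    also have "\<dots> = (c * norm h)\<^sup>2"
      unfolding a(2) power_mult_distrib c(3) by (simp add: algebra_simps)
    finally show "(norm (h - a *\<^sub>R R h))\<^sup>2 \<le> (c * norm h)\<^sup>2" .
  qed (use c in simp)
  have "bij (\<lambda>h. h - (h - a *\<^sub>R R h))"
  proof (rule bij_identity_minus_contraction[where c = c])
    fix u v
    have "(u - a *\<^sub>R R u) - (v - a *\<^sub>R R v) = (u - v) - a *\<^sub>R R (u - v)"
      by (simp add: clinear_diff[OF lin] scaleR_diff_right)
    with le[of "u - v"] show "norm ((u - a *\<^sub>R R u) - (v - a *\<^sub>R R v)) \<le> c * norm (u - v)"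
      by (simp only:)
  qed (use c in auto)
  then have "bij (\<lambda>h. a *\<^sub>R R h)" by simp
  moreover have "bij (\<lambda>h::'h. inverse a *\<^sub>R h)"
    by (rule bij_betw_byWitness[where f' = "\<lambda>h. a *\<^sub>R h"]) (use a in auto)
  ultimately have "bij ((\<lambda>h. inverse a *\<^sub>R h) \<circ> (\<lambda>h. a *\<^sub>R R h))"
    by (rule bij_comp)
  then show ?thesis using a by (simp add: o_def)
qed

lemma clinear_inv:
  assumes "clinear_on UNIV R" "bij R"
  shows "clinear_on UNIV (inv_into UNIV R)"
  unfolding clinear_on_def
proof (intro conjI ballI allI)
  note f_inv = surj_f_inv_f[OF bij_is_surj[OF assms(2)]]
  note inj = injD[OF bij_is_inj[OF assms(2)]]
  fix u v a
  show "inv_into UNIV R (u + v) = inv_into UNIV R u + inv_into UNIV R v"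
    by (rule inj) (simp add: f_inv clinear_add[OF assms(1)])
  show "inv_into UNIV R (a *\<^sub>C u) = a *\<^sub>C inv_into UNIV R u"
    by (rule inj) (simp add: f_inv clinear_scale[OF assms(1)])
qed

text \<open>\<open>2 Re R \<ge> I\<close> is equivalent to \<open>I - inv R\<close> being a contraction.\<close>

lemma resolvent_positive_iff:
  fixes f g :: "'h::complex_inner"
  shows "norm (f - g) \<le> norm f \<longleftrightarrow> (norm g)\<^sup>2 \<le> 2 * Re (cinner f g)"
proof -
  have "norm (f - g) \<le> norm f \<longleftrightarrow> (norm (f - g))\<^sup>2 \<le> (norm f)\<^sup>2"
    by (simp add: abs_le_square_iff[symmetric])
  then show ?thesis by (simp add: norm_diff_sq)
qed

section \<open>Holomorphic operator functions on a finite-dimensional space\<close>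

definition weakly_holomorphic :: "(complex \<Rightarrow> 'h::complex_inner \<Rightarrow> 'h) \<Rightarrow> bool"
  where "weakly_holomorphic T \<longleftrightarrow> (\<forall>u g. (\<lambda>z. cinner (T z u) g) holomorphic_on ball 0 1)"

text \<open>Finite dimension enters as a finite orthonormal basis of the whole type. It makes linear
  operators bounded and lets holomorphy be tested on matrix entries.\<close>

locale finite_hilbert =
  fixes E :: "'h::chilbert_space set"
  assumes finite_E: "finite E" and orthonormal_E: "orthonormal E" and span_E: "cspan E = UNIV"
begin

lemma expansion: "(\<Sum>e\<in>E. cinner h e *\<^sub>C e) = h"
  by (rule orthonormal_expansion) (simp_all add: finite_E orthonormal_E span_E)

lemma linear_expansion: "clinear_on UNIV T \<Longrightarrow> T h = (\<Sum>e\<in>E. cinner h e *\<^sub>C T e)"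
  by (rule clinear_orthonormal_expansion) (simp_all add: finite_E orthonormal_E span_E)

lemma norm_basis: "e \<in> E \<Longrightarrow> norm e = 1"
proof -
  assume "e \<in> E"
  then have "cinner e e = 1" using orthonormal_E by (simp add: orthonormal_def)
  then have "(norm e)\<^sup>2 = 1" unfolding cinner_self of_real_eq_1_iff .
  then show ?thesis by (simp add: power2_eq_1_iff) (metis norm_ge_zero not_one_le_zero neg_0_le_iff_le)
qed

lemma bounded_if_linear:
  fixes T :: "'h \<Rightarrow> 'h"
  assumes "clinear_on UNIV T"
  shows "\<exists>B. \<forall>h. norm (T h) \<le> B * norm h"
proof (intro exI[of _ "\<Sum>e\<in>E. norm (T e)"] allI)
  fix h
  have "norm (T h) = norm (\<Sum>e\<in>E. cinner h e *\<^sub>C T e)"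
    using linear_expansion[OF assms, of h] by simp
  also have "\<dots> \<le> (\<Sum>e\<in>E. norm h * norm (T e))"
  proof (rule sum_norm_le)
    fix e assume "e \<in> E"
    then show "norm (cinner h e *\<^sub>C T e) \<le> norm h * norm (T e)"
      using cauchy_schwarz[of h e] norm_basis[of e] by (simp add: mult_right_mono)
  qed
  finally show "norm (T h) \<le> (\<Sum>e\<in>E. norm (T e)) * norm h"
    by (simp add: sum_distrib_left[symmetric] mult.commute)
qed

lemma weak_tendsto_imp_tendsto:
  fixes f :: "'b \<Rightarrow> 'h"
  shows "(\<And>g. ((\<lambda>w. cinner (f w) g) \<longlongrightarrow> cinner l g) F) \<Longrightarrow> (f \<longlongrightarrow> l) F"
  by (rule weak_imp_strong_tendsto[OF finite_E orthonormal_E span_E])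

lemma weakly_holomorphic_comp:
  assumes S: "weakly_holomorphic S" "\<And>z. cmod z < 1 \<Longrightarrow> clinear_on UNIV (S z)"
    and T: "weakly_holomorphic (T :: complex \<Rightarrow> 'h \<Rightarrow> 'h)"
  shows "weakly_holomorphic (\<lambda>z h. S z (T z h))"
  unfolding weakly_holomorphic_def
proof (intro allI)
  fix u g
  have "(\<lambda>z. \<Sum>e\<in>E. cinner (T z u) e * cinner (S z e) g) holomorphic_on ball 0 1"
    using S(1) T by (intro holomorphic_intros) (auto simp: weakly_holomorphic_def)
  moreover have "cinner (S z (T z u)) g = (\<Sum>e\<in>E. cinner (T z u) e * cinner (S z e) g)"
    if "z \<in> ball 0 1" for z
    using that by (subst linear_expansion[OF S(2)]) (simp_all add: cinner_sum_left cinner_scaleC_left)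
  ultimately show "(\<lambda>z. cinner (S z (T z u)) g) holomorphic_on ball 0 1"
    by (rule holomorphic_transform[OF _ sym])
qed

text \<open>From S_w - S_z = - S_w (R_w - R_z) S_z and a local bound on S_w one gets continuity of S
  at z; dividing the same identity by w - z then gives the derivative.\<close>

lemma weakly_holomorphic_inverse:
  fixes R S :: "complex \<Rightarrow> 'h \<Rightarrow> 'h"
  assumes R: "weakly_holomorphic R" "\<And>z. cmod z < 1 \<Longrightarrow> clinear_on UNIV (R z)"
    and S: "\<And>z. cmod z < 1 \<Longrightarrow> clinear_on UNIV (S z)"
    and inv: "\<And>z h. cmod z < 1 \<Longrightarrow> S z (R z h) = h" "\<And>z h. cmod z < 1 \<Longrightarrow> R z (S z h) = h"
    and bound: "\<And>z. cmod z < 1 \<Longrightarrow> \<exists>C. eventually (\<lambda>w. \<forall>h. norm (S w h) \<le> C * norm h) (at z)"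
  shows "weakly_holomorphic S"
  unfolding weakly_holomorphic_def holomorphic_on_open[OF open_ball]
proof (intro allI ballI)
  fix u g :: 'h and z :: complex assume "z \<in> ball 0 1"
  then have z: "cmod z < 1" by simp
  have near: "eventually (\<lambda>w. cmod w < 1) (at z)"
    using eventually_at_in_open'[OF open_ball \<open>z \<in> ball 0 1\<close>] by simp
  have diff: "S w v - S z v = - S w (R w (S z v) - R z (S z v))" if "cmod w < 1" for w v
    using that z by (simp add: inv clinear_diff[OF S[OF that]])
  have R_tendsto: "((\<lambda>w. R w v) \<longlongrightarrow> R z v) (at z)" for v
  proof (rule weak_tendsto_imp_tendsto)
    fix g
    have "(\<lambda>z. cinner (R z v) g) holomorphic_on ball 0 1"
      using R(1) by (simp add: weakly_holomorphic_def)
    from holomorphic_on_imp_continuous_on[OF this] \<open>z \<in> ball 0 1\<close>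
    show "((\<lambda>w. cinner (R w v) g) \<longlongrightarrow> cinner (R z v) g) (at z)"
      by (simp add: continuous_on_eq_continuous_at isCont_def)
  qed
  have S_tendsto: "((\<lambda>w. S w v) \<longlongrightarrow> S z v) (at z)" for v
  proof -
    obtain C where C: "eventually (\<lambda>w. \<forall>h. norm (S w h) \<le> C * norm h) (at z)"
      using bound[OF z] by blast
    have "((\<lambda>w. R w (S z v) - R z (S z v)) \<longlongrightarrow> R z (S z v) - R z (S z v)) (at z)"
      by (intro tendsto_diff R_tendsto tendsto_const)
    then have "((\<lambda>w. C * norm (R w (S z v) - R z (S z v))) \<longlongrightarrow> C * 0) (at z)"
      by (intro tendsto_mult tendsto_const) (simp add: tendsto_norm_zero_iff)
    then have lim: "((\<lambda>w. C * norm (R w (S z v) - R z (S z v))) \<longlongrightarrow> 0) (at z)"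
      by (simp only: mult_zero_right)
    have "eventually (\<lambda>w. norm (S w v - S z v) \<le> C * norm (R w (S z v) - R z (S z v))) (at z)"
      using near C by eventually_elim (simp only: diff norm_minus_cancel)
    from this lim have "((\<lambda>w. S w v - S z v) \<longlongrightarrow> 0) (at z)"
      by (rule Lim_null_comparison)
    then show ?thesis by (rule LIM_zero_cancel)
  qed
  have "\<exists>D. ((\<lambda>w. (cinner (R w (S z u)) e - cinner (R z (S z u)) e) / (w - z)) \<longlongrightarrow> D) (at z)" for e
  proof -
    have "(\<lambda>w. cinner (R w (S z u)) e) holomorphic_on ball 0 1"
      using R(1) by (simp add: weakly_holomorphic_def)
    then show ?thesis
      using \<open>z \<in> ball 0 1\<close> unfolding holomorphic_on_open[OF open_ball] has_field_derivative_iff by blast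
  qed
  then obtain D where D: "\<And>e. ((\<lambda>w. (cinner (R w (S z u)) e - cinner (R z (S z u)) e) / (w - z)) \<longlongrightarrow> D e) (at z)"
    by metis
  have "((\<lambda>w. - (\<Sum>e\<in>E. (cinner (R w (S z u)) e - cinner (R z (S z u)) e) / (w - z) * cinner (S w e) g))
      \<longlongrightarrow> - (\<Sum>e\<in>E. D e * cinner (S z e) g)) (at z)"
    by (intro tendsto_minus tendsto_sum tendsto_mult D tendsto_cinner_left S_tendsto)
  moreover have "eventually (\<lambda>w. - (\<Sum>e\<in>E. (cinner (R w (S z u)) e - cinner (R z (S z u)) e) / (w - z) * cinner (S w e) g)
      = (cinner (S w u) g - cinner (S z u) g) / (w - z)) (at z)"
    using near
  proof eventually_elim
    case (elim w)
    have "cinner (S w u) g - cinner (S z u) g = - cinner (S w (R w (S z u) - R z (S z u))) g"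
      using diff[OF elim, of u] by (simp add: cinner_diff_left[symmetric])
    also have "S w (R w (S z u) - R z (S z u)) = (\<Sum>e\<in>E. cinner (R w (S z u) - R z (S z u)) e *\<^sub>C S w e)"
      by (rule linear_expansion[OF S[OF elim]])
    finally show ?case
      by (simp add: cinner_sum_left cinner_scaleC_left cinner_diff_left sum_divide_distrib)
  qed
  ultimately have "((\<lambda>w. (cinner (S w u) g - cinner (S z u) g) / (w - z))
      \<longlongrightarrow> - (\<Sum>e\<in>E. D e * cinner (S z e) g)) (at z)"
    by (rule Lim_transform_eventually)
  then show "\<exists>f'. ((\<lambda>z. cinner (S z u) g) has_field_derivative f') (at z)"
    unfolding has_field_derivative_iff by blast
qed

text \<open>The derivatives of the matrix entries assemble to \<open>L\<close>. The finitely many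
  entrywise errors of the difference quotient add up to \<open>\<rho> w\<close>, which bounds the
  error for all vectors simultaneously, that is, in operator norm.\<close>

lemma op_analytic_if_weakly_holomorphic:
  fixes T :: "complex \<Rightarrow> 'h \<Rightarrow> 'h"
  assumes T: "weakly_holomorphic T" "\<And>z. cmod z < 1 \<Longrightarrow> clinear_on UNIV (T z)"
    and maps: "\<And>z u. cmod z < 1 \<Longrightarrow> u \<in> U \<Longrightarrow> T z u \<in> orth_compl X"
    and \<Phi>: "\<And>z u. cmod z < 1 \<Longrightarrow> u \<in> U \<Longrightarrow> \<Phi> z u = T z u"
  shows "op_analytic_on (ball 0 1) U (orth_compl X) \<Phi>"
  unfolding op_analytic_on_def
proof
  fix z :: complex assume zb: "z \<in> ball 0 1"
  then have z: "cmod z < 1" by simp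
  have near: "eventually (\<lambda>w. cmod w < 1) (at z)"
    using eventually_at_in_open'[OF open_ball zb] by simp
  have "\<exists>D. ((\<lambda>w. (cinner (T w f) e - cinner (T z f) e) / (w - z)) \<longlongrightarrow> D) (at z)" for f e
  proof -
    have "(\<lambda>w. cinner (T w f) e) holomorphic_on ball 0 1"
      using T(1) by (simp add: weakly_holomorphic_def)
    then show ?thesis
      using zb unfolding holomorphic_on_open[OF open_ball] has_field_derivative_iff by blast
  qed
  then obtain D where D: "\<And>f e. ((\<lambda>w. (cinner (T w f) e - cinner (T z f) e) / (w - z)) \<longlongrightarrow> D f e) (at z)"
    by metis
  define L where "L u = (\<Sum>f\<in>E. \<Sum>e\<in>E. (cinner u f * D f e) *\<^sub>C e)" for u
  define \<rho> where "\<rho> w = (\<Sum>f\<in>E. \<Sum>e\<in>E. cmod ((cinner (T w f) e - cinner (T z f) e) / (w - z) - D f e))" for w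
  have bound: "norm (\<Sum>f\<in>E. \<Sum>e\<in>E. (cinner u f * c f e) *\<^sub>C e) \<le> (\<Sum>f\<in>E. \<Sum>e\<in>E. cmod (c f e)) * norm u"
    for u and c :: "'h \<Rightarrow> 'h \<Rightarrow> complex"
  proof -
    have "norm (\<Sum>f\<in>E. \<Sum>e\<in>E. (cinner u f * c f e) *\<^sub>C e) \<le> (\<Sum>f\<in>E. \<Sum>e\<in>E. cmod (c f e) * norm u)"
    proof (intro sum_norm_le)
      fix f e assume fe: "f \<in> E" "e \<in> E"
      have "cmod (cinner u f) \<le> norm u"
        using cauchy_schwarz[of u f] norm_basis[OF fe(1)] by simp
      then have "cmod (cinner u f) * cmod (c f e) \<le> norm u * cmod (c f e)"
        by (rule mult_right_mono) simp
      then show "norm ((cinner u f * c f e) *\<^sub>C e) \<le> cmod (c f e) * norm u"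
        by (simp add: norm_basis[OF fe(2)] norm_mult mult.commute)
    qed
    then show ?thesis by (simp add: sum_distrib_right)
  qed
  have quot: "inverse (w - z) *\<^sub>C (T w u - T z u) - L u =
      (\<Sum>f\<in>E. \<Sum>e\<in>E. (cinner u f * ((cinner (T w f) e - cinner (T z f) e) / (w - z) - D f e)) *\<^sub>C e)"
    if w: "cmod w < 1" for w u
  proof -
    have "T w u - T z u = (\<Sum>e\<in>E. cinner (T w u - T z u) e *\<^sub>C e)"
      by (rule expansion[symmetric])
    also have "\<dots> = (\<Sum>e\<in>E. \<Sum>f\<in>E. (cinner u f * (cinner (T w f) e - cinner (T z f) e)) *\<^sub>C e)"
    proof (intro sum.cong refl)
      fix e
      have "cinner (T w u - T z u) e = (\<Sum>f\<in>E. cinner u f * (cinner (T w f) e - cinner (T z f) e))"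
        unfolding cinner_diff_left linear_expansion[OF T(2)[OF w], of u] linear_expansion[OF T(2)[OF z], of u]
        by (simp add: cinner_sum_left cinner_scaleC_left sum_subtractf right_diff_distrib)
      then show "cinner (T w u - T z u) e *\<^sub>C e = (\<Sum>f\<in>E. (cinner u f * (cinner (T w f) e - cinner (T z f) e)) *\<^sub>C e)"
        by (simp add: complex_vector.scale_sum_left)
    qed
    also have "\<dots> = (\<Sum>f\<in>E. \<Sum>e\<in>E. (cinner u f * (cinner (T w f) e - cinner (T z f) e)) *\<^sub>C e)"
      by (rule sum.swap)
    finally have "inverse (w - z) *\<^sub>C (T w u - T z u) =
        (\<Sum>f\<in>E. \<Sum>e\<in>E. (cinner u f * ((cinner (T w f) e - cinner (T z f) e) / (w - z))) *\<^sub>C e)"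
      by (simp only: complex_vector.scale_sum_right scaleC_scaleC divide_inverse mult_ac)
    then show ?thesis
      by (simp add: L_def sum_subtractf[symmetric] complex_vector.scale_left_diff_distrib[symmetric]
          right_diff_distrib)
  qed
  have "(\<rho> \<longlongrightarrow> (\<Sum>f\<in>E. \<Sum>e\<in>E. cmod (D f e - D f e))) (at z)"
    unfolding \<rho>_def by (intro tendsto_sum tendsto_norm tendsto_diff D tendsto_const)
  then have \<rho>: "(\<rho> \<longlongrightarrow> 0) (at z)" by simp
  have close: "\<forall>\<^sub>F w in at z. \<forall>u. norm (inverse (w - z) *\<^sub>C (T w u - T z u) - L u) \<le> e * norm u"
    if "e > 0" for e
    using near order_tendstoD(2)[OF \<rho> that]
  proof eventually_elim
    case (elim w)
    show ?case
    proof
      fix u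
      have "norm (inverse (w - z) *\<^sub>C (T w u - T z u) - L u) \<le> \<rho> w * norm u"
        unfolding quot[OF elim(1)] \<rho>_def by (rule bound)
      also have "\<dots> \<le> e * norm u"
        using elim(2) by (intro mult_right_mono) auto
      finally show "norm (inverse (w - z) *\<^sub>C (T w u - T z u) - L u) \<le> e * norm u" .
    qed
  qed
  \<comment> \<open>Difference quotients lie in the orthogonal complement of \<open>X\<close>, and
    being orthogonal to a vector survives the limit.\<close>
  have L_maps: "L u \<in> orth_compl X" if u: "u \<in> U" for u
    unfolding orth_compl_def
  proof (intro CollectI ballI)
    fix x assume x: "x \<in> X"
    have "((\<lambda>w. inverse (w - z) *\<^sub>C (T w u - T z u) - L u) \<longlongrightarrow> 0) (at z)"
      unfolding tendsto_iff
    proof (intro allI impI)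
      fix e :: real assume "e > 0"
      define e' where "e' = e / (norm u + 1)"
      have "e' > 0" using \<open>e > 0\<close> by (simp add: e'_def add_nonneg_pos)
      have "e' * norm u < e"
        using \<open>e > 0\<close> unfolding e'_def by (simp add: divide_less_eq add_nonneg_pos mult_strict_left_mono)
      show "\<forall>\<^sub>F w in at z. dist (inverse (w - z) *\<^sub>C (T w u - T z u) - L u) 0 < e"
        using close[OF \<open>e' > 0\<close>]
        by eventually_elim (use \<open>e' * norm u < e\<close> in \<open>auto intro: le_less_trans\<close>)
    qed
    then have "((\<lambda>w. cinner (inverse (w - z) *\<^sub>C (T w u - T z u) - L u) x) \<longlongrightarrow> cinner 0 x) (at z)"
      by (rule tendsto_cinner_left)
    moreover have "\<forall>\<^sub>F w in at z. cinner (inverse (w - z) *\<^sub>C (T w u - T z u) - L u) x = - cinner (L u) x"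
      using near
    proof eventually_elim
      case (elim w)
      have "cinner (T w u) x = 0" "cinner (T z u) x = 0"
        using maps[OF elim u] maps[OF z u] x by (auto simp: orth_compl_def)
      then show ?case by (simp add: cinner_diff_left cinner_scaleC_left)
    qed
    ultimately have "((\<lambda>w. - cinner (L u) x) \<longlongrightarrow> cinner 0 x) (at z)"
      by (rule Lim_transform_eventually)
    then show "cinner (L u) x = 0"
      using tendsto_unique[OF at_neq_bot tendsto_const, of "- cinner (L u) x" "cinner 0 x" z] by simp
  qed
  show "\<exists>L\<in>U \<rightarrow> orth_compl X. clinear_on U L \<and> (\<exists>B. \<forall>u\<in>U. norm (L u) \<le> B * norm u) \<and>
      (\<forall>e>0. \<forall>\<^sub>F w in at z. \<forall>u\<in>U. norm (inverse (w - z) *\<^sub>C (\<Phi> w u - \<Phi> z u) - L u) \<le> e * norm u)"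
  proof (intro bexI[of _ L] conjI allI impI)
    show "L \<in> U \<rightarrow> orth_compl X" using L_maps by blast
    show "clinear_on U L"
      unfolding clinear_on_def L_def
      by (simp add: cinner_add_left cinner_scaleC_left distrib_right scaleC_add_left sum.distrib
          complex_vector.scale_sum_right scaleC_scaleC mult.assoc)
    show "\<exists>B. \<forall>u\<in>U. norm (L u) \<le> B * norm u"
      unfolding L_def using bound by blast
    fix e :: real assume "e > 0"
    show "\<forall>\<^sub>F w in at z. \<forall>u\<in>U. norm (inverse (w - z) *\<^sub>C (\<Phi> w u - \<Phi> z u) - L u) \<le> e * norm u"
      using near close[OF \<open>e > 0\<close>] by eventually_elim (simp add: \<Phi> z)
  qed
qed

end

lemma holomorphic_if_op_analytic:
  assumes "op_analytic_on (ball 0 1) U W \<Phi>" "u \<in> U"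
  shows "(\<lambda>z. cinner (\<Phi> z u) g) holomorphic_on ball 0 1"
  unfolding holomorphic_on_open[OF open_ball]
proof
  fix z :: complex assume "z \<in> ball 0 1"
  then obtain L where L: "\<And>e. e > 0 \<Longrightarrow> \<forall>\<^sub>F w in at z. \<forall>u\<in>U.
      norm (inverse (w - z) *\<^sub>C (\<Phi> w u - \<Phi> z u) - L u) \<le> e * norm u"
    using assms(1) unfolding op_analytic_on_def by meson
  have "((\<lambda>w. (cinner (\<Phi> w u) g - cinner (\<Phi> z u) g) / (w - z)) \<longlongrightarrow> cinner (L u) g) (at z)"
    unfolding tendsto_iff
  proof (intro allI impI)
    fix e :: real assume "e > 0"
    define c where "c = norm u * norm g"
    define e' where "e' = e / (c + 1)"
    have c: "c \<ge> 0" by (simp add: c_def)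
    then have e': "e' > 0" "e' * c < e"
      using \<open>e > 0\<close> by (simp_all add: e'_def divide_less_eq)
    show "\<forall>\<^sub>F w in at z. dist ((cinner (\<Phi> w u) g - cinner (\<Phi> z u) g) / (w - z)) (cinner (L u) g) < e"
      using L[OF e'(1)]
    proof eventually_elim
      case (elim w)
      have "(cinner (\<Phi> w u) g - cinner (\<Phi> z u) g) / (w - z) - cinner (L u) g
          = cinner (inverse (w - z) *\<^sub>C (\<Phi> w u - \<Phi> z u) - L u) g"
        by (simp add: cinner_simps divide_inverse mult.commute)
      also have "cmod \<dots> \<le> norm (inverse (w - z) *\<^sub>C (\<Phi> w u - \<Phi> z u) - L u) * norm g"
        by (rule cauchy_schwarz)
      also have "\<dots> \<le> e' * norm u * norm g"
        using elim assms(2) by (intro mult_right_mono) auto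
      also have "\<dots> < e" using e'(2) by (simp add: c_def mult.assoc)
      finally show ?case by (simp add: dist_norm)
    qed
  qed
  then show "\<exists>f'. ((\<lambda>z. cinner (\<Phi> z u) g) has_field_derivative f') (at z)"
    unfolding has_field_derivative_iff by blast
qed

text \<open>The scalar Schwarz lemma applied to z (T_z h, g), which vanishes at 0 and is bounded by
  |h| |g|. It removes the factor \<open>cmod z\<close> for z \<noteq> 0; z = 0 follows by
  continuity, and the choice g = T_z h returns to norms.\<close>

lemma schwarz_contraction:
  fixes T :: "complex \<Rightarrow> 'h::complex_inner \<Rightarrow> 'h"
  assumes T: "weakly_holomorphic T" and le: "\<And>z h. cmod z < 1 \<Longrightarrow> cmod z * norm (T z h) \<le> norm h"
    and z: "cmod z < 1"
  shows "norm (T z h) \<le> norm h"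
proof -
  have holo: "(\<lambda>z. cinner (T z h) g) holomorphic_on ball 0 1" for g
    using T by (simp add: weakly_holomorphic_def)
  have nonzero: "cmod (cinner (T w h) g) \<le> norm h * norm g" if w: "cmod w < 1" "w \<noteq> 0" for w g
  proof (cases "norm h * norm g = 0")
    case True
    have "norm (T w h) = 0 \<or> norm g = 0"
      using le[OF w(1), of h] w(2) True by (auto simp: mult_le_0_iff)
    then show ?thesis by auto
  next
    case False
    define c where "c = norm h * norm g"
    have c: "c > 0" using False by (simp add: c_def less_le)
    have bound: "cmod (v * cinner (T v h) g) \<le> c" if "cmod v < 1" for v
    proof -
      have "cmod (v * cinner (T v h) g) \<le> cmod v * (norm (T v h) * norm g)"
        unfolding norm_mult by (intro mult_left_mono cauchy_schwarz) simp
      also have "\<dots> \<le> norm h * norm g"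
        unfolding mult.assoc[symmetric] by (intro mult_right_mono le that) simp
      finally show ?thesis by (simp add: c_def)
    qed
    \<comment> \<open>The Schwarz lemma asks for values strictly inside the disc, so the
      normalization uses every b > c, and b then decreases to c.\<close>
    have "cmod (cinner (T w h) g) \<le> b" if "b > c" for b
    proof -
      have b: "b > 0" using that c by simp
      define f where "f v = v * cinner (T v h) g / b" for v
      have "cmod (f w) \<le> cmod w"
      proof (rule Schwarz_Lemma(1)[OF _ _ _ w(1)])
        show "f holomorphic_on ball 0 1"
          unfolding f_def using b by (intro holomorphic_intros holo) auto
        show "f 0 = 0" by (simp add: f_def)
        fix v assume "cmod v < 1"
        from bound[OF this] show "cmod (f v) < 1"
          using that b by (simp add: f_def norm_divide)
      qed
      then have "cmod w * cmod (cinner (T w h) g) \<le> cmod w * b"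
        using b by (simp add: f_def norm_divide norm_mult divide_le_eq)
      then show ?thesis using w(2) by simp
    qed
    then show ?thesis unfolding c_def[symmetric] by (rule dense_ge)
  qed
  have "cmod (cinner (T z h) g) \<le> norm h * norm g" for g
  proof (cases "z = 0")
    case True
    have "((\<lambda>w. cinner (T w h) g) \<longlongrightarrow> cinner (T 0 h) g) (at 0)"
      using holomorphic_on_imp_continuous_on[OF holo]
      by (simp add: continuous_on_eq_continuous_at isCont_def)
    then have lim: "((\<lambda>w. cmod (cinner (T w h) g)) \<longlongrightarrow> cmod (cinner (T 0 h) g)) (at 0)"
      by (rule tendsto_norm)
    have "eventually (\<lambda>w::complex. w \<in> ball 0 1 - {0}) (at 0)"
      by (rule eventually_at_in_open) auto
    then have "eventually (\<lambda>w. cmod (cinner (T w h) g) \<le> norm h * norm g) (at 0)"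
      by eventually_elim (auto intro: nonzero)
    from tendsto_upperbound[OF lim this] True show ?thesis by simp
  qed (use nonzero z in blast)
  from this[of "T z h"] have "(norm (T z h))\<^sup>2 \<le> norm h * norm (T z h)"
    by (simp add: cinner_self norm_power)
  then show ?thesis
    by (cases "norm (T z h) = 0") (auto simp: power2_eq_square mult_le_cancel_right)
qed

section \<open>Contractive extensions of the isometry\<close>

text \<open>Coefficients belong to indices and not to vectors, because \<open>x\<close> need not be
  injective.\<close>

lemma span_image_lessThan:
  "cspan (x ` {..<n}) = range (\<lambda>\<alpha>. \<Sum>k<n. \<alpha> k *\<^sub>C x k)" (is "?L = ?R")
  for x :: "nat \<Rightarrow> 'h::complex_inner"
proof
  show "?L \<subseteq> ?R"
  proof (rule complex_vector.span_minimal)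
    show "x ` {..<n} \<subseteq> ?R"
    proof clarify
      fix k assume "k < n"
      then have "(\<Sum>i<n. (if i = k then 1 else 0) *\<^sub>C x i) = x k"
        by (simp add: if_distrib[of "\<lambda>c. c *\<^sub>C _"] cong: if_cong)
      from this[symmetric] show "x k \<in> ?R"
        by (intro range_eqI[where x = "\<lambda>i. if i = k then 1 else 0"])
    qed
    show "complex_vector.subspace ?R"
      unfolding complex_vector.subspace_def
    proof (intro conjI ballI allI)
      have "0 = (\<Sum>k<n. 0 *\<^sub>C x k)" by simp
      then show "0 \<in> ?R" by (intro range_eqI[where x = "\<lambda>_. 0"])
      fix u v c assume "u \<in> ?R" "v \<in> ?R"
      then obtain \<alpha> \<beta> where \<alpha>: "u = (\<Sum>k<n. \<alpha> k *\<^sub>C x k)" and \<beta>: "v = (\<Sum>k<n. \<beta> k *\<^sub>C x k)"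
        by blast
      have "u + v = (\<Sum>k<n. (\<alpha> k + \<beta> k) *\<^sub>C x k)"
        by (simp add: \<alpha> \<beta> scaleC_add_left sum.distrib)
      then show "u + v \<in> ?R" by (intro range_eqI[where x = "\<lambda>k. \<alpha> k + \<beta> k"])
      have "c *\<^sub>C u = (\<Sum>k<n. (c * \<alpha> k) *\<^sub>C x k)"
        by (simp add: \<alpha> complex_vector.scale_sum_right scaleC_scaleC)
      then show "c *\<^sub>C u \<in> ?R" by (intro range_eqI[where x = "\<lambda>k. c * \<alpha> k"])
    qed
  qed
  show "?R \<subseteq> ?L"
  proof clarify
    fix \<alpha> :: "nat \<Rightarrow> complex"
    show "(\<Sum>k<n. \<alpha> k *\<^sub>C x k) \<in> ?L"
      by (rule complex_vector.span_sum, rule complex_vector.span_scale, rule complex_vector.span_base) simp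
  qed
qed

section \<open>The orthogonal sum of an isometry and a contraction\<close>

lemma oplus_add:
  assumes "complex_vector.subspace U" "u \<in> U" "v \<in> orth_compl U"
  shows "oplus U A \<Phi> (u + v) = A u + \<Phi> v"
  unfolding oplus_def
proof (rule the_equality)
  show "\<exists>u'\<in>U. \<exists>v'\<in>orth_compl U. u + v = u' + v' \<and> A u + \<Phi> v = A u' + \<Phi> v'"
    using assms by blast
  fix w assume "\<exists>u'\<in>U. \<exists>v'\<in>orth_compl U. u + v = u' + v' \<and> w = A u' + \<Phi> v'"
  then obtain u' v' where "u' \<in> U" "v' \<in> orth_compl U" "u + v = u' + v'" "w = A u' + \<Phi> v'"
    by blast
  with orth_decomposition_unique[OF assms(1,2) \<open>u' \<in> U\<close> assms(3)] show "w = A u + \<Phi> v"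
    by blast
qed

locale isometry_extension =
  fixes X :: "'h::complex_inner set" and U and A \<Phi> :: "'h \<Rightarrow> 'h"
  defines "U \<equiv> cspan X"
  assumes finite_X: "finite X"
    and A_lin: "clinear_on U A" and A_iso: "\<And>u. u \<in> U \<Longrightarrow> norm (A u) = norm u"
    and \<Phi>: "\<Phi> \<in> contractions (orth_compl U) (orth_compl (A ` U))"
begin

lemma subspace_U: "complex_vector.subspace U"
  unfolding U_def by (rule complex_vector.subspace_span)

lemma decomposition: "\<exists>u v. u \<in> U \<and> v \<in> orth_compl U \<and> h = u + v"
  using orth_decomposition[OF finite_X, of h] unfolding U_def by (metis add.commute diff_add_cancel)

lemma \<Phi>_props:
  shows \<Phi>_lin: "clinear_on (orth_compl U) \<Phi>"
    and \<Phi>_maps: "v \<in> orth_compl U \<Longrightarrow> \<Phi> v \<in> orth_compl (A ` U)"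
    and \<Phi>_le: "v \<in> orth_compl U \<Longrightarrow> norm (\<Phi> v) \<le> norm v"
  using \<Phi> unfolding contractions_def by auto

lemma oplus_linear: "clinear_on UNIV (oplus U A \<Phi>)"
  unfolding clinear_on_def
proof (intro conjI ballI allI)
  fix h k :: 'h and a
  obtain u v where h: "u \<in> U" "v \<in> orth_compl U" "h = u + v" using decomposition by blast
  obtain u' v' where k: "u' \<in> U" "v' \<in> orth_compl U" "k = u' + v'" using decomposition by blast
  note sub = subspace_U subspace_orth_compl[of U]
  have "h + k = (u + u') + (v + v')" by (simp add: h k)
  moreover have "u + u' \<in> U" "v + v' \<in> orth_compl U"
    using sub h k by (simp_all add: complex_vector.subspace_add)
  ultimately have "oplus U A \<Phi> (h + k) = A (u + u') + \<Phi> (v + v')"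
    by (simp only: oplus_add[OF subspace_U])
  also have "\<dots> = oplus U A \<Phi> h + oplus U A \<Phi> k"
    using A_lin \<Phi>_lin h k by (simp add: oplus_add[OF subspace_U] clinear_on_def)
  finally show "oplus U A \<Phi> (h + k) = oplus U A \<Phi> h + oplus U A \<Phi> k" .
  have "a *\<^sub>C h = a *\<^sub>C u + a *\<^sub>C v" by (simp add: h scaleC_add_right)
  moreover have "a *\<^sub>C u \<in> U" "a *\<^sub>C v \<in> orth_compl U"
    using sub h by (simp_all add: complex_vector.subspace_scale)
  ultimately have "oplus U A \<Phi> (a *\<^sub>C h) = A (a *\<^sub>C u) + \<Phi> (a *\<^sub>C v)"
    by (simp only: oplus_add[OF subspace_U])
  also have "\<dots> = a *\<^sub>C oplus U A \<Phi> h"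
    using A_lin \<Phi>_lin h by (simp add: oplus_add[OF subspace_U] clinear_on_def scaleC_add_right)
  finally show "oplus U A \<Phi> (a *\<^sub>C h) = a *\<^sub>C oplus U A \<Phi> h" .
qed

text \<open>Pythagoras on both sides: u is orthogonal to v, and \<open>A u\<close> to
  \<open>\<Phi> v\<close>, since \<open>\<Phi>\<close> maps into the complement of the range of
  \<open>A\<close>.\<close>

lemma oplus_contraction: "norm (oplus U A \<Phi> h) \<le> norm h"
proof -
  obtain u v where h: "u \<in> U" "v \<in> orth_compl U" "h = u + v" using decomposition by blast
  have "cinner (\<Phi> v) (A u) = 0"
    using \<Phi>_maps[OF h(2)] h(1) by (auto simp: orth_compl_def)
  then have 1: "cinner (A u) (\<Phi> v) = 0" by (metis cinner_commute complex_cnj_zero)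
  have "cinner v u = 0" using h by (auto simp: orth_compl_def)
  then have 2: "cinner u v = 0" by (metis cinner_commute complex_cnj_zero)
  have "(norm (oplus U A \<Phi> h))\<^sup>2 = (norm u)\<^sup>2 + (norm (\<Phi> v))\<^sup>2"
    using h by (simp add: oplus_add[OF subspace_U] norm_add_sq 1 A_iso)
  also have "\<dots> \<le> (norm u)\<^sup>2 + (norm v)\<^sup>2"
    using \<Phi>_le[OF h(2)] by (simp add: power_mono)
  also have "\<dots> = (norm h)\<^sup>2" by (simp add: h norm_add_sq 2)
  finally show ?thesis by (rule power2_le_imp_le) simp
qed

lemma oplus_left: "u \<in> U \<Longrightarrow> oplus U A \<Phi> u = A u"
  using oplus_add[OF subspace_U, of u 0 A \<Phi>] \<Phi>_lin complex_vector.subspace_0[OF subspace_orth_compl[of U]]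
  by (auto simp: clinear_on_def) (metis add_0_right scaleC_zero_right scaleC_zero_left)

lemma oplus_right: "v \<in> orth_compl U \<Longrightarrow> oplus U A \<Phi> v = \<Phi> v"
proof -
  assume v: "v \<in> orth_compl U"
  have "A 0 = 0"
    using A_iso[of 0] complex_vector.subspace_0[OF subspace_U] by simp
  then show ?thesis
    using oplus_add[OF subspace_U complex_vector.subspace_0[OF subspace_U] v, of A \<Phi>] by simp
qed

end

section \<open>The shift isometry of a block Toeplitz Gram matrix\<close>

locale toeplitz_model = finite_hilbert E for E :: "'h::chilbert_space set" +
  fixes N d :: nat and x :: "nat \<Rightarrow> 'h"
  assumes N_pos: "1 \<le> N"
    and gram_shift: "\<And>n m. n < d * N \<Longrightarrow> m < d * N \<Longrightarrow> cinner (x (n + N)) (x (m + N)) = cinner (x n) (x m)"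
    and span_x: "cspan (x ` {..<(d + 1) * N}) = UNIV"
begin

abbreviation "DA \<equiv> A_dom N d x"
abbreviation "A \<equiv> A_op N d x"

lemma DA_eq: "DA = range (\<lambda>\<alpha>. \<Sum>k<d * N. \<alpha> k *\<^sub>C x k)"
  unfolding A_dom_def by (rule span_image_lessThan)

text \<open>The Toeplitz structure is used through \<open>gram_shift\<close>: raising both indices
  by one block leaves the Gram matrix unchanged, so the shift of coefficients preserves inner
  products.\<close>

lemma shift_cinner:
  "cinner (\<Sum>k<d * N. \<alpha> k *\<^sub>C x (k + N)) (\<Sum>k<d * N. \<beta> k *\<^sub>C x (k + N))
    = cinner (\<Sum>k<d * N. \<alpha> k *\<^sub>C x k) (\<Sum>k<d * N. \<beta> k *\<^sub>C x k)"
  unfolding cinner_simps by (intro sum.cong refl) (simp add: gram_shift)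

lemma shift_norm: "norm (\<Sum>k<d * N. \<alpha> k *\<^sub>C x (k + N)) = norm (\<Sum>k<d * N. \<alpha> k *\<^sub>C x k)"
proof -
  have "(norm (\<Sum>k<d * N. \<alpha> k *\<^sub>C x (k + N)))\<^sup>2 = (norm (\<Sum>k<d * N. \<alpha> k *\<^sub>C x k))\<^sup>2"
    using shift_cinner[of \<alpha> \<alpha>] unfolding cinner_self by (simp only: of_real_eq_iff)
  then show ?thesis by (simp add: power2_eq_iff_nonneg)
qed

text \<open>Well-definedness of \<open>A\<close>: two coefficient families of the same vector differ
  by a null combination, and the isometric shift sends it to a vector of norm 0.\<close>

lemma A_sum: "A (\<Sum>k<d * N. \<alpha> k *\<^sub>C x k) = (\<Sum>k<d * N. \<alpha> k *\<^sub>C x (k + N))"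
  unfolding A_op_def
proof (rule the_equality)
  show "\<exists>\<beta>. (\<Sum>k<d * N. \<alpha> k *\<^sub>C x k) = (\<Sum>k<d * N. \<beta> k *\<^sub>C x k) \<and>
      (\<Sum>k<d * N. \<alpha> k *\<^sub>C x (k + N)) = (\<Sum>k<d * N. \<beta> k *\<^sub>C x (k + N))"
    by blast
  fix w assume "\<exists>\<beta>. (\<Sum>k<d * N. \<alpha> k *\<^sub>C x k) = (\<Sum>k<d * N. \<beta> k *\<^sub>C x k) \<and>
      w = (\<Sum>k<d * N. \<beta> k *\<^sub>C x (k + N))"
  then obtain \<beta> where \<beta>: "(\<Sum>k<d * N. \<alpha> k *\<^sub>C x k) = (\<Sum>k<d * N. \<beta> k *\<^sub>C x k)"
    "w = (\<Sum>k<d * N. \<beta> k *\<^sub>C x (k + N))" by blast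
  have "norm (w - (\<Sum>k<d * N. \<alpha> k *\<^sub>C x (k + N))) = norm (\<Sum>k<d * N. (\<beta> k - \<alpha> k) *\<^sub>C x (k + N))"
    by (simp add: \<beta>(2) complex_vector.scale_left_diff_distrib sum_subtractf)
  also have "\<dots> = norm (\<Sum>k<d * N. (\<beta> k - \<alpha> k) *\<^sub>C x k)" by (rule shift_norm)
  also have "\<dots> = 0"
    by (simp add: \<beta>(1) complex_vector.scale_left_diff_distrib sum_subtractf)
  finally show "w = (\<Sum>k<d * N. \<alpha> k *\<^sub>C x (k + N))" by simp
qed

lemma A_linear: "clinear_on DA A"
  unfolding clinear_on_def
proof (intro conjI ballI allI)
  fix u v a assume "u \<in> DA" "v \<in> DA"
  then obtain \<alpha> \<beta> where u: "u = (\<Sum>k<d * N. \<alpha> k *\<^sub>C x k)" and v: "v = (\<Sum>k<d * N. \<beta> k *\<^sub>C x k)"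
    unfolding DA_eq by blast
  have "u + v = (\<Sum>k<d * N. (\<alpha> k + \<beta> k) *\<^sub>C x k)"
    by (simp add: u v scaleC_add_left sum.distrib)
  then have "A (u + v) = (\<Sum>k<d * N. (\<alpha> k + \<beta> k) *\<^sub>C x (k + N))" by (simp only: A_sum)
  then show "A (u + v) = A u + A v"
    by (simp add: u v A_sum scaleC_add_left sum.distrib)
  have "a *\<^sub>C u = (\<Sum>k<d * N. (a * \<alpha> k) *\<^sub>C x k)"
    by (simp add: u complex_vector.scale_sum_right scaleC_scaleC)
  then have "A (a *\<^sub>C u) = (\<Sum>k<d * N. (a * \<alpha> k) *\<^sub>C x (k + N))" by (simp only: A_sum)
  then show "A (a *\<^sub>C u) = a *\<^sub>C A u"
    by (simp add: u A_sum complex_vector.scale_sum_right scaleC_scaleC)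
qed

lemma A_isometry: "u \<in> DA \<Longrightarrow> norm (A u) = norm u"
  unfolding DA_eq by (auto simp: A_sum shift_norm)

lemma x_in_DA: "k < d * N \<Longrightarrow> x k \<in> DA"
  unfolding A_dom_def by (rule complex_vector.span_base) simp

lemma A_x:
  assumes "k < d * N"
  shows "A (x k) = x (k + N)"
proof -
  have *: "(\<Sum>i<d * N. (if i = k then 1 else 0) *\<^sub>C y i) = y k" for y :: "nat \<Rightarrow> 'h"
    using assms by (simp add: if_distrib[of "\<lambda>c. c *\<^sub>C _"] cong: if_cong)
  have "A (\<Sum>i<d * N. (if i = k then 1 else 0) *\<^sub>C x i) = (\<Sum>i<d * N. (if i = k then 1 else 0) *\<^sub>C x (i + N))"
    by (rule A_sum)
  then show ?thesis unfolding * by simp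
qed

lemma linear_eq_on_x:
  assumes "clinear_on UNIV S" "clinear_on UNIV T" "\<And>n. n < (d + 1) * N \<Longrightarrow> S (x n) = T (x n)"
  shows "S h = T h"
proof -
  obtain \<alpha> where "h = (\<Sum>n<(d + 1) * N. \<alpha> n *\<^sub>C x n)"
    using span_x unfolding span_image_lessThan by blast
  then show ?thesis
    using assms(3) by (simp add: clinear_sum[OF assms(1)] clinear_sum[OF assms(2)] clinear_scale[OF assms(1)]
        clinear_scale[OF assms(2)])
qed

lemma eq_on_x:
  assumes "\<And>m. m < (d + 1) * N \<Longrightarrow> cinner u (x m) = cinner v (x m)"
  shows "u = v"
proof (rule cinner_left_eqI)
  fix h
  obtain \<beta> where "h = (\<Sum>n<(d + 1) * N. \<beta> n *\<^sub>C x n)"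
    using span_x unfolding span_image_lessThan by blast
  then show "cinner u h = cinner v h"
    using assms by (simp add: cinner_simps)
qed

end

section \<open>The resolvent of a parameter\<close>

locale parameter = toeplitz_model E N d x
  for E :: "'h::chilbert_space set" and N d x +
  fixes \<Phi> :: "complex \<Rightarrow> 'h \<Rightarrow> 'h"
  assumes \<Phi>: "\<Phi> \<in> parameters N d x"
begin

definition "T z = oplus DA A (\<Phi> z)"

abbreviation "R \<equiv> disc_resolvent DA A \<Phi>"

lemma extension:
  assumes "cmod z < 1"
  shows "isometry_extension (x ` {..<d * N}) A (\<Phi> z)"
proof
  have "\<Phi> z \<in> contractions (orth_compl DA) (orth_compl (A ` DA))"
    using \<Phi> assms unfolding parameters_def analytic_contractions_def A_ran_def by auto
  then show "\<Phi> z \<in> contractions (orth_compl (cspan (x ` {..<d * N})))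
      (orth_compl (A ` cspan (x ` {..<d * N})))"
    by (simp only: A_dom_def)
qed (use A_linear A_isometry in \<open>simp_all add: A_dom_def\<close>)

lemma T_props:
  assumes "cmod z < 1"
  shows T_linear: "clinear_on UNIV (T z)" and T_contraction: "norm (T z h) \<le> norm h"
    and T_DA: "u \<in> DA \<Longrightarrow> T z u = A u" and T_compl: "v \<in> orth_compl DA \<Longrightarrow> T z v = \<Phi> z v"
  using isometry_extension.oplus_linear[OF extension[OF assms]]
    isometry_extension.oplus_contraction[OF extension[OF assms]]
    isometry_extension.oplus_left[OF extension[OF assms]]
    isometry_extension.oplus_right[OF extension[OF assms]]
  by (simp_all add: T_def A_dom_def)

lemma T_x: "cmod z < 1 \<Longrightarrow> n < d * N \<Longrightarrow> T z (x n) = x (n + N)"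
  by (simp add: T_DA x_in_DA A_x)

lemma T_holomorphic: "weakly_holomorphic T"
  unfolding weakly_holomorphic_def
proof (intro allI)
  fix h g :: 'h
  obtain u where u: "u \<in> DA" "h - u \<in> orth_compl DA"
    using orth_decomposition[of "x ` {..<d * N}" h] unfolding A_dom_def by blast
  have "op_analytic_on (ball 0 1) (orth_compl DA) (orth_compl (A_ran N d x)) \<Phi>"
    using \<Phi> by (simp add: parameters_def analytic_contractions_def)
  from holomorphic_if_op_analytic[OF this u(2)]
  have "(\<lambda>z. cinner (A u) g + cinner (\<Phi> z (h - u)) g) holomorphic_on ball 0 1"
    by (intro holomorphic_intros)
  then show "(\<lambda>z. cinner (T z h) g) holomorphic_on ball 0 1"
  proof (rule holomorphic_transform)
    fix z :: complex assume "z \<in> ball 0 1"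
    then have z: "cmod z < 1" by simp
    have "T z h = T z (u + (h - u))" by simp
    also have "\<dots> = A u + \<Phi> z (h - u)"
      unfolding clinear_add[OF T_linear[OF z]] by (simp only: T_DA[OF z u(1)] T_compl[OF z u(2)])
    finally show "cinner (A u) g + cinner (\<Phi> z (h - u)) g = cinner (T z h) g"
      by (simp add: cinner_add_left)
  qed
qed

lemma bij_resolvent:
  assumes "cmod z < 1"
  shows "bij (\<lambda>h. h - z *\<^sub>C T z h)"
proof (rule bij_identity_minus_contraction[where c = "cmod z"])
  fix u v
  have "norm (z *\<^sub>C T z u - z *\<^sub>C T z v) = cmod z * norm (T z (u - v))"
    by (simp add: clinear_diff[OF T_linear[OF assms]] complex_vector.scale_right_diff_distrib[symmetric])
  then show "norm (z *\<^sub>C T z u - z *\<^sub>C T z v) \<le> cmod z * norm (u - v)"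
    using T_contraction[OF assms, of "u - v"] by (simp add: mult_left_mono)
qed (use assms in auto)

lemma R_eq: "R z = inv_into UNIV (\<lambda>h. h - z *\<^sub>C T z h)"
  by (simp add: disc_resolvent_def T_def)

lemma R_right: "cmod z < 1 \<Longrightarrow> R z g - z *\<^sub>C T z (R z g) = g"
  unfolding R_eq using surj_f_inv_f[OF bij_is_surj[OF bij_resolvent]] by blast

lemma R_left: "cmod z < 1 \<Longrightarrow> R z (h - z *\<^sub>C T z h) = h"
  unfolding R_eq using inv_f_f[OF bij_is_inj[OF bij_resolvent]] by blast

lemma R_linear:
  assumes "cmod z < 1"
  shows "clinear_on UNIV (R z)"
  unfolding R_eq
proof (rule clinear_inv[OF _ bij_resolvent[OF assms]])
  show "clinear_on UNIV (\<lambda>h. h - z *\<^sub>C T z h)"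
    using T_linear[OF assms] unfolding clinear_on_def
    by (simp add: scaleC_add_right complex_vector.scale_right_diff_distrib scaleC_scaleC mult.commute)
qed

lemma R_zero: "R 0 h = h"
  using R_right[of 0 h] by simp

lemma R_positive:
  assumes "cmod z < 1"
  shows "(norm g)\<^sup>2 \<le> 2 * Re (cinner (R z g) g)"
proof -
  have "R z g - g = z *\<^sub>C T z (R z g)"
    using R_right[OF assms, of g] by (simp add: algebra_simps)
  then have "norm (R z g - g) \<le> 1 * norm (R z g)"
    using assms T_contraction[OF assms, of "R z g"] by (simp only: norm_scaleC) (intro mult_mono, auto)
  then show ?thesis by (simp add: resolvent_positive_iff)
qed

lemma R_bound:
  assumes "cmod z < 1"
  shows "norm (R z g) \<le> norm g / (1 - cmod z)"
proof -
  have "norm (R z g) = norm (g + z *\<^sub>C T z (R z g))"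
    using R_right[OF assms, of g] by (metis diff_add_cancel)
  also have "\<dots> \<le> norm g + cmod z * norm (R z g)"
    using norm_triangle_ineq[of g "z *\<^sub>C T z (R z g)"]
      mult_left_mono[OF T_contraction[OF assms, of "R z g"], of "cmod z"] by simp
  finally have "norm (R z g) * (1 - cmod z) \<le> norm g" by (simp add: algebra_simps)
  then show ?thesis using assms by (simp add: le_divide_eq)
qed

lemma R_holomorphic: "weakly_holomorphic R"
proof (rule weakly_holomorphic_inverse[where R = "\<lambda>z h. h - z *\<^sub>C T z h"])
  show "weakly_holomorphic (\<lambda>z h. h - z *\<^sub>C T z h)"
    using T_holomorphic unfolding weakly_holomorphic_def
    by (auto simp: cinner_diff_left cinner_scaleC_left intro!: holomorphic_intros)
  fix z :: complex assume z: "cmod z < 1"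
  show "clinear_on UNIV (\<lambda>h. h - z *\<^sub>C T z h)"
    using T_linear[OF z] unfolding clinear_on_def
    by (simp add: scaleC_add_right complex_vector.scale_right_diff_distrib scaleC_scaleC mult.commute)
  show "clinear_on UNIV (R z)" by (rule R_linear[OF z])
  show "R z (h - z *\<^sub>C T z h) = h" "R z h - z *\<^sub>C T z (R z h) = h" for h
    using R_left[OF z] R_right[OF z] by auto
  \<comment> \<open>A radius strictly between \<open>cmod z\<close> and 1, for a bound on
    \<open>R w\<close> that is uniform near z.\<close>
  define r where "r = (1 + cmod z) / 2"
  have r: "cmod z < r" "r < 1" using z by (simp_all add: r_def)
  have "eventually (\<lambda>w. w \<in> ball 0 r) (at z)"
    using r by (intro eventually_at_in_open') auto
  then have "eventually (\<lambda>w. \<forall>h. norm (R w h) \<le> 1 / (1 - r) * norm h) (at z)"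
  proof eventually_elim
    case (elim w)
    then have w: "cmod w < r" by simp
    show ?case
    proof
      fix h
      have "norm (R w h) \<le> norm h / (1 - cmod w)" using w r by (intro R_bound) auto
      also have "\<dots> \<le> norm h / (1 - r)" using w r by (intro divide_left_mono) auto
      finally show "norm (R w h) \<le> 1 / (1 - r) * norm h" by simp
    qed
  qed
  then show "\<exists>C. eventually (\<lambda>w. \<forall>h. norm (R w h) \<le> C * norm h) (at z)" by blast
qed

text \<open>On D(A) the operator T_z is the shift, whatever the parameter; hence E - z T_z sends
  \<open>x n\<close> to \<open>x n - z *\<^sub>C x (n + N)\<close>, and R_z inverts it.\<close>

lemma R_shift_left:
  assumes "cmod z < 1" "n < d * N"
  shows "R z (x n) = x n + z *\<^sub>C R z (x (n + N))"
proof -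
  have "x n = R z (x n - z *\<^sub>C x (n + N))"
    using R_left[OF assms(1), of "x n"] by (simp add: T_x assms)
  then show ?thesis
    by (simp add: clinear_diff[OF R_linear[OF assms(1)]] clinear_scale[OF R_linear[OF assms(1)]])
       (metis diff_add_cancel)
qed

text \<open>The counterpart in the second argument. \<open>T z\<close> is isometric on
  \<open>x m\<close>, so \<open>contraction_preserves_cinner\<close> moves the shift from
  \<open>x (m + N)\<close> back to \<open>x m\<close>.\<close>

lemma R_shift_right:
  assumes "cmod z < 1" "m < d * N"
  shows "cinner (R z h) (x (m + N)) = cinner h (x (m + N)) + z * cinner (R z h) (x m)"
proof -
  have "cinner (T z (R z h)) (T z (x m)) = cinner (R z h) (x m)"
    by (rule contraction_preserves_cinner[OF T_linear[OF assms(1)] T_contraction[OF assms(1)]])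
      (simp add: T_DA[OF assms(1)] x_in_DA assms A_isometry)
  then have "cinner (z *\<^sub>C T z (R z h)) (x (m + N)) = z * cinner (R z h) (x m)"
    by (simp add: T_x assms cinner_scaleC_left)
  moreover have "R z h = h + z *\<^sub>C T z (R z h)"
    using R_right[OF assms(1), of h] by (metis diff_add_cancel add.commute)
  ultimately show ?thesis by (metis cinner_add_left)
qed

end

text \<open>The two shift relations raise the indices blockwise, the left one after division by z.
  Once the resolvents agree, z T_z = E - R_z^{-1} gives equal T_z, again for z \<noteq> 0.
  Holomorphy closes the gap at 0, and restriction to the complement of D(A) recovers the
  parameter.\<close>

lemma parameter_unique:
  assumes p: "parameter E N d x \<Phi>" "parameter E N d x \<Psi>"
    and eq: "\<And>z k j. cmod z < 1 \<Longrightarrow> k < N \<Longrightarrow> j < N \<Longrightarrow>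
      cinner (disc_resolvent (A_dom N d x) (A_op N d x) \<Phi> z (x k)) (x j) =
      cinner (disc_resolvent (A_dom N d x) (A_op N d x) \<Psi> z (x k)) (x j)"
  shows "\<Phi> = \<Psi>"
proof -
  interpret P: parameter E N d x \<Phi> by (rule p(1))
  interpret Q: parameter E N d x \<Psi> by (rule p(2))
  have R_eq: "P.R z h = Q.R z h" if z: "cmod z < 1" "z \<noteq> 0" for z h
  proof -
    have 1: "cinner (P.R z (x n)) (x j) = cinner (Q.R z (x n)) (x j)" if "n < (d + 1) * N" "j < N" for n j
      using that
    proof (induction n rule: less_induct)
      case (less n)
      show ?case
      proof (cases "n < N")
        case True
        then show ?thesis using eq[OF z(1)] less by simp
      next
        case False
        define m where "m = n - N"
        have m: "n = m + N" "m < d * N" "m < n" using False less.prems P.N_pos by (auto simp: m_def)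
        have "z * cinner (P.R z (x n)) (x j) = cinner (P.R z (x m)) (x j) - cinner (x m) (x j)"
          unfolding P.R_shift_left[OF z(1) m(2)] m(1) by (simp add: cinner_add_left cinner_scaleC_left)
        also have "\<dots> = cinner (Q.R z (x m)) (x j) - cinner (x m) (x j)"
          using less.IH[OF m(3)] m less.prems by simp
        also have "\<dots> = z * cinner (Q.R z (x n)) (x j)"
          unfolding Q.R_shift_left[OF z(1) m(2)] m(1) by (simp add: cinner_add_left cinner_scaleC_left)
        finally show ?thesis using z(2) by simp
      qed
    qed
    have 2: "cinner (P.R z (x n)) (x m) = cinner (Q.R z (x n)) (x m)"
      if "n < (d + 1) * N" "m < (d + 1) * N" for n m
      using that(2)
    proof (induction m rule: less_induct)
      case (less m)
      show ?case
      proof (cases "m < N")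
        case True
        then show ?thesis using 1 that(1) by blast
      next
        case False
        define k where "k = m - N"
        have k: "m = k + N" "k < d * N" "k < m" using False less.prems P.N_pos by (auto simp: k_def)
        have "cinner (P.R z (x n)) (x k) = cinner (Q.R z (x n)) (x k)"
          using less.IH[OF k(3)] k less.prems by simp
        then show ?thesis
          unfolding k(1) P.R_shift_right[OF z(1) k(2)] Q.R_shift_right[OF z(1) k(2)] by simp
      qed
    qed
    show ?thesis
      by (rule P.linear_eq_on_x[OF P.R_linear[OF z(1)] Q.R_linear[OF z(1)]])
        (rule P.eq_on_x, rule 2)
  qed
  have T_eq: "P.T z h = Q.T z h" if z: "cmod z < 1" "z \<noteq> 0" for z h
  proof -
    define g where "g = h - z *\<^sub>C P.T z h"
    have "Q.R z g = h" using P.R_left[OF z(1), of h] R_eq[OF z] by (simp add: g_def)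
    then have "g = h - z *\<^sub>C Q.T z h" using Q.R_right[OF z(1), of g] by simp
    then have "z *\<^sub>C P.T z h = z *\<^sub>C Q.T z h" by (simp add: g_def)
    then show ?thesis using z(2) by simp
  qed
  have T0_eq: "P.T 0 h = Q.T 0 h" for h
  proof (rule cinner_left_eqI)
    fix g
    have lim: "((\<lambda>w. cinner (S w h) g) \<longlongrightarrow> cinner (S 0 h) g) (at 0)" if "weakly_holomorphic S" for S
    proof -
      have "(\<lambda>w. cinner (S w h) g) holomorphic_on ball 0 1"
        using that by (simp add: weakly_holomorphic_def)
      from holomorphic_on_imp_continuous_on[OF this] show ?thesis
        by (simp add: continuous_on_eq_continuous_at isCont_def)
    qed
    have "eventually (\<lambda>w::complex. w \<in> ball 0 1 - {0}) (at 0)"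
      by (rule eventually_at_in_open) auto
    then have "eventually (\<lambda>w. cinner (P.T w h) g = cinner (Q.T w h) g) (at 0)"
      by eventually_elim (simp add: T_eq)
    from Lim_transform_eventually[OF lim[OF P.T_holomorphic] this] lim[OF Q.T_holomorphic]
    show "cinner (P.T 0 h) g = cinner (Q.T 0 h) g"
      by (rule tendsto_unique[OF at_neq_bot])
  qed
  have ext: "\<Phi> \<in> ball 0 1 \<rightarrow>\<^sub>E contractions (orth_compl P.DA) (orth_compl (A_ran N d x))"
    "\<Psi> \<in> ball 0 1 \<rightarrow>\<^sub>E contractions (orth_compl P.DA) (orth_compl (A_ran N d x))"
    using P.\<Phi> Q.\<Phi> by (simp_all add: parameters_def analytic_contractions_def)
  show ?thesis
  proof (rule PiE_ext[OF ext])
    fix z :: complex assume zb: "z \<in> ball 0 1"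
    then have z: "cmod z < 1" by simp
    have "\<Phi> z \<in> orth_compl P.DA \<rightarrow>\<^sub>E orth_compl (A_ran N d x)"
      "\<Psi> z \<in> orth_compl P.DA \<rightarrow>\<^sub>E orth_compl (A_ran N d x)"
      using PiE_mem[OF ext(1) zb] PiE_mem[OF ext(2) zb] by (auto simp: contractions_def)
    then show "\<Phi> z = \<Psi> z"
    proof (rule PiE_ext)
      fix v assume "v \<in> orth_compl P.DA"
      then show "\<Phi> z v = \<Psi> z v"
        using T_eq[OF z, of v] T0_eq[of v] P.T_compl[OF z, of v] Q.T_compl[OF z, of v]
        by (cases "z = 0") simp_all
    qed
  qed
qed

section \<open>The solution generated by a parameter\<close>

lemma variation_le_bound:
  assumes V: "variation_le g a b V" and t: "a \<le> t" "t \<le> b"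
  shows "cmod (g t - g a) \<le> V"
proof -
  define p where "p = {(a, {a..t})} \<union> {(b, {t..b})}"
  have "p tagged_division_of ({a..t} \<union> {t..b})"
    unfolding p_def using t
    by (intro tagged_division_Un tagged_division_of_self_real) auto
  moreover have "{a..t} \<union> {t..b} = {a..b}" using t by auto
  ultimately have p: "p tagged_division_of {a..b}" by simp
  have "cmod (g t - g a) = (case (a, {a..t}) of (s, K) \<Rightarrow> cmod (g (Sup K) - g (Inf K)))"
    using t by simp
  also have "\<dots> \<le> (\<Sum>(s, K)\<in>p. cmod (g (Sup K) - g (Inf K)))"
    by (rule member_le_sum) (auto simp: p_def)
  also have "\<dots> \<le> V" using V p by (simp add: variation_le_def)
  finally show ?thesis .
qed

lemma stieltjes_integral_lincomb:
  assumes "\<And>i. i \<in> A \<Longrightarrow> has_stieltjes_integral f (g i) a b (I i)"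
  shows "has_stieltjes_integral f (\<lambda>t. \<Sum>i\<in>A. c i * g i t) a b (\<Sum>i\<in>A. c i * I i)"
  by (rule stieltjes_integral_sum_integrator, rule stieltjes_integral_scale(2)) (rule assms)

lemma stieltjes_resolvent_eq:
  assumes V: "variation_le g 0 (2 * pi) V" "variation_le g' 0 (2 * pi) V'"
    and zero: "g 0 = 0" "g' 0 = 0"
    and left: "\<And>t. 0 < t \<Longrightarrow> t \<le> 2 * pi \<Longrightarrow> (g \<longlongrightarrow> g t) (at_left t)"
      "\<And>t. 0 < t \<Longrightarrow> t \<le> 2 * pi \<Longrightarrow> (g' \<longlongrightarrow> g' t) (at_left t)"
    and z: "\<And>z. cmod z \<noteq> 1 \<Longrightarrow> has_stieltjes_integral (\<lambda>t. 1 / (1 - z * cis t)) g 0 (2 * pi) (I z)"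
      "\<And>z. cmod z \<noteq> 1 \<Longrightarrow> has_stieltjes_integral (\<lambda>t. 1 / (1 - z * cis t)) g' 0 (2 * pi) (I z)"
    and t: "0 \<le> t" "t \<le> 2 * pi"
  shows "g t = g' t"
proof -
  \<comment> \<open>The difference is written as a sum over two indices with weights 1 and -1, so
    that the facts on linear combinations apply to it.\<close>
  let ?f = "\<lambda>(i::bool) t. if i then g t else g' t" and ?c = "\<lambda>i::bool. if i then 1 else - 1 :: complex"
  have sum: "(\<Sum>i\<in>{True, False}. ?c i * ?f i t) = g t - g' t" for t by simp
  have V'': "variation_le (\<lambda>t. g t - g' t) 0 (2 * pi)
      (\<Sum>i\<in>{True, False}. cmod (?c i) * (if i then V else V'))"
    unfolding sum[symmetric] by (rule variation_le_sum) (use V in auto)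
  have "g t - g' t = 0"
  proof (rule stieltjes_resolvent_uniqueness[OF V'' _ _ _ _ t])
    fix t assume t: "0 < t" "t \<le> 2 * pi"
    show "((\<lambda>t. g t - g' t) \<longlongrightarrow> g t - g' t) (at_left t)"
      by (rule tendsto_diff[OF left(1)[OF t] left(2)[OF t]])
  next
    fix t assume "0 \<le> t" "t \<le> 2 * pi"
    from variation_le_bound[OF V'' this] zero
    show "cmod (g t - g' t) \<le> (\<Sum>i\<in>{True, False}. cmod (?c i) * (if i then V else V'))"
      by (simp only: diff_zero)
  next
    fix z assume "cmod z \<noteq> 1"
    note zz = z(1)[OF this] z(2)[OF this]
    have "has_stieltjes_integral (\<lambda>t. 1 / (1 - z * cis t)) (\<lambda>t. \<Sum>i\<in>{True, False}. ?c i * ?f i t) 0 (2 * pi)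
        (\<Sum>i\<in>{True, False}. ?c i * I z)"
    proof (rule stieltjes_integral_lincomb)
      fix i
      show "has_stieltjes_integral (\<lambda>t. 1 / (1 - z * cis t)) (?f i) 0 (2 * pi) (I z)"
        using zz by (cases i) simp_all
    qed
    then show "has_stieltjes_integral (\<lambda>t. 1 / (1 - z * cis t)) (\<lambda>t. g t - g' t) 0 (2 * pi) 0"
      unfolding sum by simp
  qed (simp add: zero)
  then show ?thesis by simp
qed

text \<open>The scalar form of the reflection rule for the resolvent: with u = z e^{it}, 1 / (1 - u)
  = 1 - 1 / (1 - 1/u), and 1/u is the conjugate of e^{it} / cnj z.\<close>

lemma stieltjes_resolvent_outside:
  assumes z: "cmod z > 1"
    and one: "has_stieltjes_integral (\<lambda>t. 1) g a b J"
    and inner: "has_stieltjes_integral (\<lambda>t. 1 / (1 - 1 / cnj z * cis t)) (\<lambda>t. cnj (g t)) a b I"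
  shows "has_stieltjes_integral (\<lambda>t. 1 / (1 - z * cis t)) g a b (J - cnj I)"
proof -
  have "has_stieltjes_integral (\<lambda>t. 1 - cnj (1 / (1 - 1 / cnj z * cis t))) g a b (J - cnj I)"
    using stieltjes_integral_diff[OF one] stieltjes_integral_cnj[OF inner] by simp
  moreover have "1 - cnj (1 / (1 - 1 / cnj z * cis t)) = 1 / (1 - z * cis t)" for t
  proof -
    define u where "u = z * cis t"
    have "cmod u > 1" using z by (simp add: u_def norm_mult)
    then have u: "u \<noteq> 0" "u \<noteq> 1" by auto
    have "z \<noteq> 0" using z by auto
    then have "1 / z * cnj (cis t) = 1 / u"
      by (simp add: u_def cis_cnj divide_inverse cis_inverse)
    then have "cnj (1 / (1 - 1 / cnj z * cis t)) = 1 / (1 - 1 / u)" by simp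
    also have "1 - \<dots> = 1 / (1 - u)" using u by (simp add: divide_simps)
    finally show ?thesis by (simp add: u_def)
  qed
  ultimately show ?thesis by simp
qed

text \<open>Weighted by c, the expansion at u + c v carries the factors c, c^2 and c^2 cnj c on the
  unwanted terms, and c cnj c = 1 on (G u, v). Over the fourth roots of unity the former sum to
  0.\<close>

lemma polarization:
  assumes G: "clinear_on UNIV G"
  shows "(\<Sum>a<4::nat. (1 / 4 * \<i> ^ a) * cinner (G (u + \<i> ^ a *\<^sub>C v)) (u + \<i> ^ a *\<^sub>C v)) = cinner (G u) v"
proof -
  have eq: "c * cinner (G (u + c *\<^sub>C v)) (u + c *\<^sub>C v) = c * cinner (G u) u + c * c * cinner (G v) u
      + c * cnj c * cinner (G u) v + c * c * cnj c * cinner (G v) v" for c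
    by (simp add: clinear_add[OF G] clinear_scale[OF G] cinner_simps algebra_simps)
  have "(\<Sum>a<4::nat. (1 / 4 * \<i> ^ a) * cinner (G (u + \<i> ^ a *\<^sub>C v)) (u + \<i> ^ a *\<^sub>C v))
    = 1 / 4 * (\<Sum>a<4::nat. \<i> ^ a * cinner (G (u + \<i> ^ a *\<^sub>C v)) (u + \<i> ^ a *\<^sub>C v))"
    by (simp add: sum_distrib_left mult.assoc)
  also have "\<dots> = cinner (G u) v"
    unfolding eq by (simp add: eval_nat_numeral algebra_simps)
  finally show ?thesis .
qed

text \<open>The usual form at w becomes this one for v = cnj w. In this arrangement it matches the
  expansion of (G h, h) for h = \<Sum> v_k x_k.\<close>

lemma pos_semidef_iff:
  assumes B: "B \<in> carrier_mat N N"
  shows "pos_semidef B \<longleftrightarrow> (\<forall>v. 0 \<le> (\<Sum>k<N. \<Sum>j<N. v k * cnj (v j) * B $$ (k, j)))"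
proof -
  have form: "(B *\<^sub>v w) \<bullet>c w = (\<Sum>k<N. \<Sum>j<N. cnj (w $ k) * w $ j * B $$ (k, j))"
    if w: "w \<in> carrier_vec N" for w
  proof -
    have "(B *\<^sub>v w) \<bullet>c w = (\<Sum>k<N. (\<Sum>j<N. B $$ (k, j) * w $ j) * cnj (w $ k))"
      using B w by (auto simp: scalar_prod_def atLeast0LessThan intro!: sum.cong)
    then show ?thesis
      by (simp add: sum_distrib_left sum_distrib_right mult_ac)
  qed
  show ?thesis
  proof
    assume "pos_semidef B"
    then have pos: "0 \<le> (B *\<^sub>v w) \<bullet>c w" if "w \<in> carrier_vec N" for w
      using B that unfolding pos_semidef_def by auto
    show "\<forall>v. 0 \<le> (\<Sum>k<N. \<Sum>j<N. v k * cnj (v j) * B $$ (k, j))"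
    proof
      fix v :: "nat \<Rightarrow> complex"
      define w where "w = Matrix.vec N (\<lambda>k. cnj (v k))"
      have w: "w \<in> carrier_vec N" by (simp add: w_def)
      have "(\<Sum>k<N. \<Sum>j<N. v k * cnj (v j) * B $$ (k, j)) = (B *\<^sub>v w) \<bullet>c w"
        unfolding form[OF w] by (intro sum.cong refl) (simp add: w_def)
      with pos[OF w] show "0 \<le> (\<Sum>k<N. \<Sum>j<N. v k * cnj (v j) * B $$ (k, j))" by simp
    qed
  next
    assume *: "\<forall>v. 0 \<le> (\<Sum>k<N. \<Sum>j<N. v k * cnj (v j) * B $$ (k, j))"
    have "0 \<le> (B *\<^sub>v w) \<bullet>c w" if "w \<in> carrier_vec N" for w
      unfolding form[OF that] using *[rule_format, of "\<lambda>k. cnj (w $ k)"] by simp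
    with B show "pos_semidef B" unfolding pos_semidef_def by blast
  qed
qed

section \<open>Adjoints and the resolvent outside the disc\<close>

context finite_hilbert
begin

lemma adj_op: "clinear_on UNIV T \<Longrightarrow> cinner h (adj_op T g) = cinner (T h) g"
  for T :: "'h \<Rightarrow> 'h"
  by (rule adj_op_cinner[OF finite_E orthonormal_E span_E])

lemma adj_op_left: "clinear_on UNIV T \<Longrightarrow> cinner (adj_op T g) h = cnj (cinner (T h) g)"
  for T :: "'h \<Rightarrow> 'h"
  by (subst cinner_commute) (simp add: adj_op)

lemma adj_op_linear:
  fixes T :: "'h \<Rightarrow> 'h"
  assumes "clinear_on UNIV T"
  shows "clinear_on UNIV (adj_op T)"
  unfolding clinear_on_def
proof (intro conjI ballI allI)
  fix u v :: 'h and a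
  show "adj_op T (u + v) = adj_op T u + adj_op T v"
    by (rule cinner_left_eqI) (simp add: adj_op_left[OF assms] cinner_simps)
  show "adj_op T (a *\<^sub>C u) = a *\<^sub>C adj_op T u"
    by (rule cinner_left_eqI) (simp add: adj_op_left[OF assms] cinner_simps)
qed

end

context parameter
begin

abbreviation "G \<equiv> gen_resolvent DA A \<Phi>"

lemma outside_param: "cmod z > 1 \<Longrightarrow> cmod (1 / cnj z) < 1"
proof -
  assume z: "cmod z > 1"
  then have "0 < cmod z" by linarith
  with z show ?thesis by (simp add: norm_divide)
qed

lemma G_inside: "cmod z < 1 \<Longrightarrow> G z = R z"
  by (simp add: gen_resolvent_def)

lemma G_outside: "cmod z > 1 \<Longrightarrow> G z h = h - adj_op (R (1 / cnj z)) h"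
  by (simp add: gen_resolvent_def)

lemma G_linear:
  assumes "cmod z \<noteq> 1"
  shows "clinear_on UNIV (G z)"
proof (cases "cmod z < 1")
  case True
  then show ?thesis by (simp add: G_inside R_linear)
next
  case False
  with assms have z: "cmod z > 1" by simp
  have *: "clinear_on UNIV (adj_op (R (1 / cnj z)))"
    by (rule adj_op_linear[OF R_linear[OF outside_param[OF z]]])
  show ?thesis
    unfolding clinear_on_def
    by (simp add: G_outside[OF z] clinear_add[OF *] clinear_scale[OF *]
        complex_vector.scale_right_diff_distrib)
qed

text \<open>Outside the disc the resolvent contains the adjoint of R at the reflected point, whose
  entry at (u, v) is the conjugate of the entry of R at (v, u); hence the second hypothesis on
  \<open>cnj (g t)\<close>.\<close>

lemma stieltjes_G:
  assumes g: "\<And>z. cmod z < 1 \<Longrightarrow> has_stieltjes_integral (\<lambda>t. 1 / (1 - z * cis t)) g a b (cinner (R z u) v)"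
    and g': "\<And>z. cmod z < 1 \<Longrightarrow>
      has_stieltjes_integral (\<lambda>t. 1 / (1 - z * cis t)) (\<lambda>t. cnj (g t)) a b (cinner (R z v) u)"
    and z: "cmod z \<noteq> 1"
  shows "has_stieltjes_integral (\<lambda>t. 1 / (1 - z * cis t)) g a b (cinner (G z u) v)"
proof (cases "cmod z < 1")
  case True
  then show ?thesis using g by (simp add: G_inside)
next
  case False
  with z have z: "cmod z > 1" by simp
  have one: "has_stieltjes_integral (\<lambda>t. 1) g a b (cinner u v)"
    using g[of 0] by (simp add: R_zero)
  have "has_stieltjes_integral (\<lambda>t. 1 / (1 - z * cis t)) g a b
      (cinner u v - cnj (cinner (R (1 / cnj z) v) u))"
    by (rule stieltjes_resolvent_outside[OF z one g'[OF outside_param[OF z]]])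
  then show ?thesis
    by (simp add: G_outside[OF z] cinner_diff_left adj_op_left[OF R_linear[OF outside_param[OF z]]])
qed

lemma spectral_function_exists:
  "\<exists>\<phi>::real \<Rightarrow> real. \<phi> 0 = 0 \<and> (\<forall>u v. u \<le> v \<longrightarrow> \<phi> u \<le> \<phi> v) \<and>
    (\<forall>t. (\<phi> \<longlongrightarrow> \<phi> t) (at_left t)) \<and>
    (\<forall>z. cmod z \<noteq> 1 \<longrightarrow> has_stieltjes_integral (\<lambda>t. 1 / (1 - z * cis t))
      (\<lambda>t. complex_of_real (\<phi> t)) 0 (2 * pi) (cinner (G z h) h))"
proof -
  have "\<exists>\<phi>::real \<Rightarrow> real. \<phi> 0 = 0 \<and> (\<forall>u v. u \<le> v \<longrightarrow> \<phi> u \<le> \<phi> v) \<and>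
    (\<forall>t. (\<phi> \<longlongrightarrow> \<phi> t) (at_left t)) \<and>
    (\<forall>z. cmod z < 1 \<longrightarrow> has_stieltjes_integral (\<lambda>t. 1 / (1 - z * cis t))
      (\<lambda>t. complex_of_real (\<phi> t)) 0 (2 * pi) (cinner (R z h) h))"
  \<comment> \<open>The Herglotz normalization divides by the squared norm of h, so h = 0 is
    represented by the zero function.\<close>
  proof (cases "h = 0")
    case True
    have "has_stieltjes_integral f (\<lambda>t. complex_of_real 0) 0 (2 * pi) 0" for f
      using stieltjes_integral_sum_integrator[of "{}" f] by simp
    then show ?thesis
      using True by (intro exI[of _ "\<lambda>_. 0"]) simp
  next
    case False
    show ?thesis
    proof (rule herglotz_representation[where c = "(norm h)\<^sup>2"])
      show "(\<lambda>z. cinner (R z h) h) holomorphic_on ball 0 1"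
        using R_holomorphic by (simp add: weakly_holomorphic_def)
      show "cinner (R 0 h) h = complex_of_real ((norm h)\<^sup>2)"
        unfolding R_zero by (rule cinner_self)
      show "0 < (norm h)\<^sup>2" using False by simp
      show "(norm h)\<^sup>2 \<le> 2 * Re (cinner (R z h) h)" if "cmod z < 1" for z
        by (rule R_positive[OF that])
    qed
  qed
  then obtain \<phi> :: "real \<Rightarrow> real" where \<phi>: "\<phi> 0 = 0" "\<forall>u v. u \<le> v \<longrightarrow> \<phi> u \<le> \<phi> v"
    "\<forall>t. (\<phi> \<longlongrightarrow> \<phi> t) (at_left t)"
    "\<And>z. cmod z < 1 \<Longrightarrow> has_stieltjes_integral (\<lambda>t. 1 / (1 - z * cis t))
      (\<lambda>t. complex_of_real (\<phi> t)) 0 (2 * pi) (cinner (R z h) h)"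
    by blast
  have "has_stieltjes_integral (\<lambda>t. 1 / (1 - z * cis t))
      (\<lambda>t. complex_of_real (\<phi> t)) 0 (2 * pi) (cinner (G z h) h)" if "cmod z \<noteq> 1" for z
    by (rule stieltjes_G[OF \<phi>(4) _ that]) (simp_all add: \<phi>(4))
  with \<phi>(1-3) show ?thesis by (intro exI[of _ \<phi>]) simp
qed

text \<open>\<open>R_shift_left\<close> is precisely the relation required by
  \<open>resolvent_kernel_shift\<close>, with value \<open>x n\<close> at z = 0. After n steps, the
  kernel at z = 0 is the n-th moment.\<close>

lemma moment_recursion:
  assumes V: "variation_le g 0 (2 * pi) V"
    and z: "\<And>z. cmod z < 1 \<Longrightarrow> has_stieltjes_integral (\<lambda>t. 1 / (1 - z * cis t)) g 0 (2 * pi)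
      (cinner (R z (x k)) (x j))"
    and k: "k < N" and "n \<le> d"
  shows "has_stieltjes_integral (\<lambda>t. cis (real n * t)) g 0 (2 * pi) (cinner (x (n * N + k)) (x j))"
proof -
  have "\<forall>z. cmod z < 1 \<longrightarrow> has_stieltjes_integral (\<lambda>t. cis t ^ n / (1 - z * cis t)) g 0 (2 * pi)
      (cinner (R z (x (n * N + k))) (x j))"
    using \<open>n \<le> d\<close>
  proof (induction n)
    case 0
    then show ?case using z by simp
  next
    case (Suc n)
    \<comment> \<open>The shift relation holds only for indices below \<open>d * N\<close>, which
      limits the recursion to the first d moments.\<close>
    have "Suc n * N \<le> d * N" using Suc.prems by (rule mult_le_mono1)
    then have less: "n * N + k < d * N" using k by simp
    show ?case
    proof (intro allI impI)
      fix z :: complex assume z: "cmod z < 1"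
      show "has_stieltjes_integral (\<lambda>t. cis t ^ Suc n / (1 - z * cis t)) g 0 (2 * pi)
          (cinner (R z (x (Suc n * N + k))) (x j))"
      proof (rule resolvent_kernel_shift[OF V _ _ _ _ z])
        fix w :: complex assume w: "cmod w < 1"
        show "has_stieltjes_integral (\<lambda>t. cis t ^ n / (1 - w * cis t)) g 0 (2 * pi)
            (cinner (R w (x (n * N + k))) (x j))"
          using Suc w by simp
        show "cinner (R w (x (n * N + k))) (x j)
            = cinner (R 0 (x (n * N + k))) (x j) + w * cinner (R w (x (Suc n * N + k))) (x j)"
          unfolding R_shift_left[OF w less] R_zero
          by (simp add: cinner_add_left cinner_scaleC_left ac_simps)
      next
        have "(\<lambda>w. cinner (R w (x (Suc n * N + k))) (x j)) holomorphic_on ball 0 1"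
          using R_holomorphic by (simp add: weakly_holomorphic_def)
        from holomorphic_on_imp_continuous_on[OF this]
        show "((\<lambda>w. cinner (R w (x (Suc n * N + k))) (x j)) \<longlongrightarrow>
            cinner (R 0 (x (Suc n * N + k))) (x j)) (at 0)"
          by (simp add: continuous_on_eq_continuous_at isCont_def)
      qed simp
    qed
  qed
  from this[rule_format, of 0] show ?thesis
    by (simp add: R_zero Complex.DeMoivre)
qed

text \<open>Polarization of independently chosen scalar functions does not show that M has positive
  increments. This comes from uniqueness: the quadratic form of M at v and the spectral function of
  \<Sum> v_k x_k have equal resolvent integrals, hence coincide, and the latter is monotone.\<close>

lemma generated_solution_exists:
  assumes S: "\<And>n. n \<le> d \<Longrightarrow> S n \<in> carrier_mat N N"
    and moments: "\<And>n k j. n \<le> d \<Longrightarrow> k < N \<Longrightarrow> j < N \<Longrightarrow> cinner (x (n * N + k)) (x j) = S n $$ (k, j)"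
  shows "\<exists>M \<in> moment_solutions N d S. generates N d x \<Phi> M"
proof -
  obtain \<phi> :: "'h \<Rightarrow> real \<Rightarrow> real" where \<phi>: "\<And>h. \<phi> h 0 = 0" "\<And>h u v. u \<le> v \<Longrightarrow> \<phi> h u \<le> \<phi> h v"
    "\<And>h t. (\<phi> h \<longlongrightarrow> \<phi> h t) (at_left t)"
    "\<And>h z. cmod z \<noteq> 1 \<Longrightarrow> has_stieltjes_integral (\<lambda>t. 1 / (1 - z * cis t))
      (\<lambda>t. complex_of_real (\<phi> h t)) 0 (2 * pi) (cinner (G z h) h)"
    using spectral_function_exists by metis
  define y where "y k j a = x k + \<i> ^ a *\<^sub>C x j" for k j and a :: nat
  \<comment> \<open>The weights of \<open>polarization\<close>, so that the resolvent integrals of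
    \<open>m k j\<close> are the entries (G_z x_k, x_j).\<close>
  define m where "m k j t = (\<Sum>a<4::nat. (1 / 4 * \<i> ^ a) * complex_of_real (\<phi> (y k j a) t))" for k j t
  have m_left: "((\<lambda>s. m k j s) \<longlongrightarrow> m k j t) (at_left t)" for k j t
    unfolding m_def by (intro tendsto_sum tendsto_mult tendsto_const tendsto_of_real \<phi>(3))
  have m_zero: "m k j 0 = 0" for k j by (simp add: m_def \<phi>(1))
  have m_dominated: "cmod (m k j v - m k j u) \<le> (\<Sum>a<4::nat. \<phi> (y k j a) v) - (\<Sum>a<4::nat. \<phi> (y k j a) u)"
    if "u \<le> v" for k j u v
  proof -
    have "m k j v - m k j u = (\<Sum>a<4::nat. (1 / 4 * \<i> ^ a) * complex_of_real (\<phi> (y k j a) v - \<phi> (y k j a) u))"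
      by (simp add: m_def sum_subtractf[symmetric] right_diff_distrib)
    also have "cmod \<dots> \<le> (\<Sum>a<4::nat. \<phi> (y k j a) v - \<phi> (y k j a) u)"
    proof (rule sum_norm_le)
      fix a :: nat
      have "0 \<le> \<phi> (y k j a) v - \<phi> (y k j a) u" using \<phi>(2)[OF that] by simp
      then show "cmod ((1 / 4 * \<i> ^ a) * complex_of_real (\<phi> (y k j a) v - \<phi> (y k j a) u))
          \<le> \<phi> (y k j a) v - \<phi> (y k j a) u"
        by (simp add: norm_mult norm_power norm_divide del: of_real_diff)
    qed
    finally show ?thesis by (simp add: sum_subtractf)
  qed
  have m_V: "\<exists>V. variation_le (m k j) 0 (2 * pi) V" for k j
    using variation_le_dominated[of 0 "2 * pi" "m k j" "\<lambda>t. \<Sum>a<4::nat. \<phi> (y k j a) t"] m_dominated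
    by auto
  have m_G: "has_stieltjes_integral (\<lambda>t. 1 / (1 - z * cis t)) (m k j) 0 (2 * pi) (cinner (G z (x k)) (x j))"
    if z: "cmod z \<noteq> 1" for z k j
  proof -
    have "has_stieltjes_integral (\<lambda>t. 1 / (1 - z * cis t)) (m k j) 0 (2 * pi)
        (\<Sum>a<4::nat. (1 / 4 * \<i> ^ a) * cinner (G z (y k j a)) (y k j a))"
      unfolding m_def by (rule stieltjes_integral_lincomb) (rule \<phi>(4)[OF z])
    then show ?thesis
      unfolding y_def polarization[OF G_linear[OF z]] .
  qed
  define q where "q v t = (\<Sum>k<N. v k * (\<Sum>j<N. cnj (v j) * m k j t))" for v :: "nat \<Rightarrow> complex" and t
  \<comment> \<open>Sesquilinearity of (G_z h, h) in the coefficients v gives both functions the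
    same resolvent integrals.\<close>
  have q_eq: "q v t = complex_of_real (\<phi> (\<Sum>k<N. v k *\<^sub>C x k) t)" if t: "0 \<le> t" "t \<le> 2 * pi" for v t
  proof -
    let ?h = "\<Sum>k<N. v k *\<^sub>C x k"
    obtain V where V: "\<And>k j. variation_le (m k j) 0 (2 * pi) (V k j)"
      using m_V by metis
    have V1: "variation_le (q v) 0 (2 * pi) (\<Sum>k<N. cmod (v k) * (\<Sum>j<N. cmod (cnj (v j)) * V k j))"
      unfolding q_def by (rule variation_le_sum, rule variation_le_sum) (rule V)
    have V2: "variation_le (\<lambda>t. complex_of_real (\<phi> ?h t)) 0 (2 * pi) (\<phi> ?h (2 * pi) - \<phi> ?h 0)"
    proof (rule variation_le_dominated)
      fix u v' :: real assume "u \<le> v'"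
      then show "cmod (complex_of_real (\<phi> ?h v') - complex_of_real (\<phi> ?h u)) \<le> \<phi> ?h v' - \<phi> ?h u"
        using \<phi>(2)[of u v' ?h] by (simp flip: of_real_diff)
    qed simp
    show ?thesis
    proof (rule stieltjes_resolvent_eq[OF V1 V2 _ _ _ _ _ _ t])
      show "q v 0 = 0" by (simp add: q_def m_zero)
      show "complex_of_real (\<phi> ?h 0) = 0" by (simp add: \<phi>(1))
      fix t
      show "(q v \<longlongrightarrow> q v t) (at_left t)"
        unfolding q_def by (intro tendsto_sum tendsto_mult tendsto_const m_left)
      show "((\<lambda>t. complex_of_real (\<phi> ?h t)) \<longlongrightarrow> complex_of_real (\<phi> ?h t)) (at_left t)"
        by (rule tendsto_of_real[OF \<phi>(3)])
    next
      fix z :: complex assume z: "cmod z \<noteq> 1"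
      show "has_stieltjes_integral (\<lambda>t. 1 / (1 - z * cis t)) (\<lambda>t. complex_of_real (\<phi> ?h t)) 0 (2 * pi)
          (cinner (G z ?h) ?h)"
        by (rule \<phi>(4)[OF z])
      have "has_stieltjes_integral (\<lambda>t. 1 / (1 - z * cis t)) (q v) 0 (2 * pi)
          (\<Sum>k<N. v k * (\<Sum>j<N. cnj (v j) * cinner (G z (x k)) (x j)))"
        unfolding q_def by (rule stieltjes_integral_lincomb, rule stieltjes_integral_lincomb) (rule m_G[OF z])
      also have "(\<Sum>k<N. v k * (\<Sum>j<N. cnj (v j) * cinner (G z (x k)) (x j))) = cinner (G z ?h) ?h"
        unfolding clinear_sum[OF G_linear[OF z]] clinear_scale[OF G_linear[OF z]] cinner_sum_left cinner_scaleC_left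
        by (simp only: cinner_sum_right cinner_scaleC_right)
      finally show "has_stieltjes_integral (\<lambda>t. 1 / (1 - z * cis t)) (q v) 0 (2 * pi) (cinner (G z ?h) ?h)" .
    qed
  qed
  define M where "M = (\<lambda>t\<in>{0..2 * pi}. Matrix.mat N N (\<lambda>(k, j). m k j t))"
  have M_entry: "M t $$ (k, j) = m k j t" if "0 \<le> t" "t \<le> 2 * pi" "k < N" "j < N" for t k j
    using that by (simp add: M_def)
  have M_carrier: "M \<in> {0..2 * pi} \<rightarrow>\<^sub>E carrier_mat N N"
    by (auto simp: M_def)
  have M_zero: "M 0 = 0\<^sub>m N N"
    by (rule eq_matI) (auto simp: M_def m_zero)
  have M_left: "left_cont_mat N M"
    unfolding left_cont_mat_def
  proof (intro allI impI ballI)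
    fix k j t assume kj: "k < N" "j < N" and t: "t \<in> {0<..2 * pi}"
    have "eventually (\<lambda>s. s \<in> {0<..<t}) (at_left t)"
      using t by (intro eventually_at_left_real) auto
    then have "eventually (\<lambda>s. m k j s = M s $$ (k, j)) (at_left t)"
      by (rule eventually_mono) (use t kj in \<open>auto simp: M_entry\<close>)
    from Lim_transform_eventually[OF m_left this] show "((\<lambda>s. M s $$ (k, j)) \<longlongrightarrow> M t $$ (k, j)) (at_left t)"
      using t kj by (simp add: M_entry)
  qed
  have "M \<in> moment_solutions N d S"
    unfolding moment_solutions_def
  proof (intro CollectI conjI M_carrier M_zero M_left ballI allI impI)
    fix s t :: real assume st: "s \<in> {0..2 * pi}" "t \<in> {0..2 * pi}" "s \<le> t"
    then have carrier: "M t \<in> carrier_mat N N" "M s \<in> carrier_mat N N" using M_carrier by auto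
    have "0 \<le> (\<Sum>k<N. \<Sum>j<N. v k * cnj (v j) * (M t - M s) $$ (k, j))" for v
    proof -
      have "(\<Sum>k<N. \<Sum>j<N. v k * cnj (v j) * (M t - M s) $$ (k, j)) = q v t - q v s"
        using carrier st
        by (simp add: q_def sum_distrib_left sum_subtractf[symmetric] right_diff_distrib M_entry mult.assoc)
      also have "\<dots> = complex_of_real (\<phi> (\<Sum>k<N. v k *\<^sub>C x k) t - \<phi> (\<Sum>k<N. v k *\<^sub>C x k) s)"
        using st by (simp add: q_eq)
      finally show ?thesis using \<phi>(2)[OF st(3)] by (simp add: less_eq_complex_def)
    qed
    then show "pos_semidef (M t - M s)"
      using carrier by (subst pos_semidef_iff[where N = N]) auto
  next
    fix n k j assume nkj: "n \<le> d" "k < N" "j < N"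
    obtain V where V: "variation_le (m k j) 0 (2 * pi) V" using m_V by blast
    have "has_stieltjes_integral (\<lambda>t. cis (real n * t)) (m k j) 0 (2 * pi) (cinner (x (n * N + k)) (x j))"
    proof (rule moment_recursion[OF V _ nkj(2,1)])
      fix z :: complex assume "cmod z < 1"
      then show "has_stieltjes_integral (\<lambda>t. 1 / (1 - z * cis t)) (m k j) 0 (2 * pi) (cinner (R z (x k)) (x j))"
        using m_G[of z k j] by (simp add: G_inside)
    qed
    then show "has_stieltjes_integral (\<lambda>t. exp (\<i> * of_nat n * of_real t)) (\<lambda>t. M t $$ (k, j)) 0 (2 * pi)
        (S n $$ (k, j))"
      unfolding moments[OF nkj]
      by (rule stieltjes_integral_cong) (use nkj in \<open>simp_all add: M_entry cis_conv_exp mult.assoc\<close>)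
  qed
  moreover have "generates N d x \<Phi> M"
    unfolding generates_def bv_mat_functions_def
  proof (intro conjI CollectI M_carrier M_zero M_left allI impI)
    fix k j assume kj: "k < N" "j < N"
    show "bounded_variation (\<lambda>t. M t $$ (k, j)) 0 (2 * pi)"
      by (rule bounded_variation_dominated[where \<phi> = "\<lambda>t. \<Sum>a<4::nat. \<phi> (y k j a) t"])
        (use m_dominated[of _ _ k j] kj in \<open>simp_all add: M_entry\<close>)
    fix z :: complex assume "cmod z \<noteq> 1"
    from m_G[OF this, of k j]
    show "has_stieltjes_integral (\<lambda>t. 1 / (1 - z * exp (\<i> * of_real t))) (\<lambda>t. M t $$ (k, j)) 0 (2 * pi)
        (cinner (G z (x k)) (x j))"
      by (rule stieltjes_integral_cong) (use kj in \<open>simp_all add: M_entry cis_conv_exp\<close>)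
  qed
  ultimately show ?thesis by blast
qed

end

lemma generated_unique:
  assumes "generates N d x \<Phi> M" "generates N d x \<Phi> M'"
  shows "M = M'"
proof -
  have bv: "M \<in> bv_mat_functions N" "M' \<in> bv_mat_functions N"
    using assms by (auto simp: generates_def)
  have ext: "M \<in> {0..2 * pi} \<rightarrow>\<^sub>E carrier_mat N N" "M' \<in> {0..2 * pi} \<rightarrow>\<^sub>E carrier_mat N N"
    using bv by (auto simp: bv_mat_functions_def)
  show ?thesis
  proof (rule PiE_ext[OF ext])
    fix t :: real assume t: "t \<in> {0..2 * pi}"
    have carrier: "M t \<in> carrier_mat N N" "M' t \<in> carrier_mat N N" using ext t by auto
    show "M t = M' t"
    proof (rule eq_matI)
      fix k j assume "k < dim_row (M' t)" "j < dim_col (M' t)"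
      then have kj: "k < N" "j < N" using carrier by auto
      obtain V where V: "variation_le (\<lambda>t. M t $$ (k, j)) 0 (2 * pi) V"
        using bv(1) kj variation_le_if_bounded_variation unfolding bv_mat_functions_def by blast
      obtain V' where V': "variation_le (\<lambda>t. M' t $$ (k, j)) 0 (2 * pi) V'"
        using bv(2) kj variation_le_if_bounded_variation unfolding bv_mat_functions_def by blast
      show "M t $$ (k, j) = M' t $$ (k, j)"
      proof (rule stieltjes_resolvent_eq[OF V V'])
        show "M 0 $$ (k, j) = 0" "M' 0 $$ (k, j) = 0"
          using bv kj by (simp_all add: bv_mat_functions_def)
        show "((\<lambda>s. M s $$ (k, j)) \<longlongrightarrow> M t $$ (k, j)) (at_left t)"
          "((\<lambda>s. M' s $$ (k, j)) \<longlongrightarrow> M' t $$ (k, j)) (at_left t)" if "0 < t" "t \<le> 2 * pi" for t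
          using bv kj that by (simp_all add: bv_mat_functions_def left_cont_mat_def)
        show "has_stieltjes_integral (\<lambda>t. 1 / (1 - z * cis t)) (\<lambda>t. M t $$ (k, j)) 0 (2 * pi)
            (cinner (gen_resolvent (A_dom N d x) (A_op N d x) \<Phi> z (x k)) (x j))"
          "has_stieltjes_integral (\<lambda>t. 1 / (1 - z * cis t)) (\<lambda>t. M' t $$ (k, j)) 0 (2 * pi)
            (cinner (gen_resolvent (A_dom N d x) (A_op N d x) \<Phi> z (x k)) (x j))" if "cmod z \<noteq> 1" for z
          using assms kj that by (simp_all add: generates_def cis_conv_exp)
      qed (use t in auto)
    qed (use carrier in auto)
  qed
qed

section \<open>The parameter of a solution\<close>

lemma sum_two_units:
  fixes X :: "nat \<Rightarrow> complex"
  assumes "k < N" "j < N"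
  shows "(\<Sum>i<N. ((if i = k then 1 else 0) + c * (if i = j then 1 else 0)) * X i) = X k + c * X j"
proof -
  have "(\<Sum>i<N. ((if i = k then 1 else 0) + c * (if i = j then 1 else 0)) * X i)
      = (\<Sum>i<N. (if i = k then X i else 0)) + (\<Sum>i<N. (if i = j then c * X i else 0))"
    unfolding sum.distrib[symmetric] by (intro sum.cong refl) (simp add: distrib_right)
  then show ?thesis using assms by simp
qed

section \<open>Entries of a positive Hermitian form\<close>

context
  fixes N :: nat and D :: "nat \<Rightarrow> nat \<Rightarrow> complex"
  assumes pos: "\<And>v. 0 \<le> (\<Sum>k<N. \<Sum>j<N. v k * cnj (v j) * D k j)"
begin

text \<open>The form at e_k + c e_j; for k = j the test vector is (1 + c) e_k and the identity
  persists.\<close>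

lemma positive_form_two:
  assumes "k < N" "j < N"
  shows "0 \<le> D k k + c * cnj c * D j j + (cnj c * D k j + c * D j k)"
proof -
  define v where "v i = (if i = k then 1 else 0) + c * (if i = j then 1 else 0)" for i
  have cnj_v: "cnj (v i) = (if i = k then 1 else 0) + cnj c * (if i = j then 1 else 0)" for i
    by (simp add: v_def)
  have "(\<Sum>i<N. \<Sum>l<N. v i * cnj (v l) * D i l) = (\<Sum>i<N. v i * (\<Sum>l<N. cnj (v l) * D i l))"
    by (simp add: sum_distrib_left mult.assoc)
  also have "\<dots> = (D k k + cnj c * D k j) + c * (D j k + cnj c * D j j)"
    unfolding cnj_v sum_two_units[OF assms] unfolding v_def by (rule sum_two_units[OF assms])
  finally show ?thesis
    using pos[of v] by (simp add: algebra_simps)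
qed

lemma positive_form_diag: "k < N \<Longrightarrow> 0 \<le> D k k"
  using positive_form_two[of k k 0] by simp

text \<open>Reality of the form at c = 1 relates the imaginary parts of the two entries, at c = \<i>
  their real parts.\<close>

lemma positive_form_hermitian:
  assumes "k < N" "j < N"
  shows "D j k = cnj (D k j)"
proof -
  have "Im (D k k) = 0" "Im (D j j) = 0"
    using positive_form_diag assms by (simp_all add: less_eq_complex_def)
  then show ?thesis
    using positive_form_two[OF assms, of 1] positive_form_two[OF assms, of \<i>]
    by (simp add: less_eq_complex_def complex_eq_iff)
qed

text \<open>The trace is a coarser bound than the geometric mean of two diagonal entries, but it is
  additive, so applied to increments it gives one dominating function for all entries.\<close>

lemma positive_form_bound:
  assumes "k < N" "j < N"
  shows "cmod (D k j) \<le> (\<Sum>i<N. Re (D i i))"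
proof -
  have diag: "Re (D i i) \<le> (\<Sum>i<N. Re (D i i))" if "i < N" for i
    by (rule member_le_sum) (use that positive_form_diag in \<open>auto simp: less_eq_complex_def\<close>)
  have "2 * cmod (D k j) \<le> Re (D k k) + Re (D j j)"
  proof (cases "D k j = 0")
    case True
    then show ?thesis using positive_form_diag assms by (auto simp: less_eq_complex_def)
  next
    case False
    \<comment> \<open>The phase that turns the mixed terms of the form into
      \<open>- 2 * cmod (D k j)\<close>.\<close>
    define c where "c = - D k j / cmod (D k j)"
    have norm: "cmod c = 1" using False by (simp add: c_def norm_divide)
    then have cc: "c * cnj c = 1" using complex_norm_square[of c] by simp
    have "cnj c * D k j = - complex_of_real (cmod (D k j))"
    proof -
      have "cnj c * D k j = - (D k j * cnj (D k j)) / cmod (D k j)" by (simp add: c_def mult.commute)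
      also have "\<dots> = - complex_of_real (cmod (D k j))"
        unfolding complex_norm_square[symmetric] using False by (simp add: power2_eq_square)
      finally show ?thesis .
    qed
    moreover have "c * D j k = cnj (cnj c * D k j)"
      by (simp add: positive_form_hermitian[OF assms])
    ultimately have "0 \<le> D k k + D j j - 2 * complex_of_real (cmod (D k j))"
      using positive_form_two[OF assms, of c] by (simp add: cc)
    then show ?thesis by (simp add: less_eq_complex_def)
  qed
  then show ?thesis using diag[OF assms(1)] diag[OF assms(2)] by linarith
qed

end

text \<open>An affine function bounded below on the whole line has slope 0. This does the work of
  Cauchy-Schwarz for a possibly degenerate positive form at a null vector.\<close>

lemma affine_nonneg_imp_zero:
  assumes "\<And>t::real. 0 \<le> Z + complex_of_real t * w"
  shows "w = 0"
proof -
  have Re: "0 \<le> Re Z + t * Re w" and Im: "Im Z + t * Im w = 0" for t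
    using assms[of t] by (auto simp: less_eq_complex_def)
  have "Im w = 0" using Im[of 0] Im[of 1] by simp
  moreover have "Re w = 0"
  proof (rule ccontr)
    assume "Re w \<noteq> 0"
    then have "(- Re Z - 1) / Re w * Re w = - Re Z - 1" by simp
    then show False using Re[of "(- Re Z - 1) / Re w"] by linarith
  qed
  ultimately show ?thesis by (simp add: complex_eq_iff)
qed

lemma resolvent_kernel_bound:
  assumes "cmod z < 1" "cmod u = 1"
  shows "1 - cmod z \<le> cmod (1 - z * u)" "1 - z * u \<noteq> 0"
proof -
  show "1 - cmod z \<le> cmod (1 - z * u)"
    using norm_triangle_ineq2[of 1 "z * u"] assms by (simp add: norm_mult)
  then show "1 - z * u \<noteq> 0" using assms(1) by auto
qed

text \<open>Differentiation under the integral. The error of the difference quotient has integrand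
  (w - z) e^{2it} / ((1 - w e^{it}) (1 - z e^{it})^2) times \<open>e t\<close>, bounded by |w - z| /
  (1 - r)^3 uniformly in t.\<close>

lemma stieltjes_resolvent_holomorphic:
  assumes V: "variation_le g a b V"
    and h: "\<And>z. cmod z < 1 \<Longrightarrow> has_stieltjes_integral (\<lambda>t. 1 / (1 - z * cis t) * e t) g a b (h z)"
    and h': "\<And>z. cmod z < 1 \<Longrightarrow> has_stieltjes_integral (\<lambda>t. cis t / (1 - z * cis t)\<^sup>2 * e t) g a b (h' z)"
    and e: "\<And>t. cmod (e t) = 1"
  shows "h holomorphic_on ball 0 1"
  unfolding holomorphic_on_open[OF open_ball]
proof
  fix z :: complex assume zb: "z \<in> ball 0 1"
  then have z: "cmod z < 1" by simp
  define r where "r = (1 + cmod z) / 2"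
  have r: "cmod z < r" "r < 1" using z by (simp_all add: r_def)
  have "V \<ge> 0" by (rule variation_le_nonneg[OF V])
  have near: "eventually (\<lambda>w. w \<in> ball 0 r - {z}) (at z)"
    using r by (intro eventually_at_in_open) auto
  have bound: "cmod ((h w - h z) / (w - z) - h' z) \<le> cmod (w - z) * (1 / (1 - r) ^ 3 * V)"
    if "w \<in> ball 0 r - {z}" for w
  proof -
    have w: "cmod w < r" "w \<noteq> z" "cmod w < 1" using that r by auto
    have "has_stieltjes_integral (\<lambda>t. inverse (w - z) * (1 / (1 - w * cis t) * e t - 1 / (1 - z * cis t) * e t)
        - cis t / (1 - z * cis t)\<^sup>2 * e t) g a b (inverse (w - z) * (h w - h z) - h' z)"
      by (rule stieltjes_integral_diff[OF stieltjes_integral_scale(1)[OF stieltjes_integral_diff[OF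
              h[OF w(3)] h[OF z]]] h'[OF z]])
    moreover have "inverse (w - z) * (1 / (1 - w * cis t) * e t - 1 / (1 - z * cis t) * e t)
        - cis t / (1 - z * cis t)\<^sup>2 * e t
        = (w - z) * (cis t)\<^sup>2 / ((1 - w * cis t) * (1 - z * cis t)\<^sup>2) * e t" for t
    proof -
      have alg: "inverse \<delta> * (1 / p * y - 1 / q * y) - u / q\<^sup>2 * y = \<delta> * u\<^sup>2 / (p * q\<^sup>2) * y"
        if \<delta>: "q - p = \<delta> * u" "\<delta> \<noteq> 0" and pq: "p \<noteq> 0" "q \<noteq> 0" for \<delta> p q u y :: complex
      proof -
        have "1 / p * y - 1 / q * y = (q - p) / (p * q) * y"
          using pq by (simp add: field_simps)
        then have "inverse \<delta> * (1 / p * y - 1 / q * y) = u / (p * q) * y"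
          unfolding \<delta>(1) using \<delta>(2) by simp
        also have "u / (p * q) * y - u / q\<^sup>2 * y = u * (q - p) / (p * q\<^sup>2) * y"
        proof -
          have "u / (p * q) = u * q / (p * q\<^sup>2)" "u / q\<^sup>2 = u * p / (p * q\<^sup>2)"
            using pq by (simp_all add: power2_eq_square)
          then show ?thesis by (simp only: left_diff_distrib[symmetric] diff_divide_distrib[symmetric] right_diff_distrib[symmetric])
        qed
        finally show ?thesis unfolding \<delta>(1) by (simp add: power2_eq_square mult_ac)
      qed
      show ?thesis
      proof (rule alg)
        show "(1 - z * cis t) - (1 - w * cis t) = (w - z) * cis t" by (simp add: algebra_simps)
      qed (use resolvent_kernel_bound(2) w z in \<open>simp_all\<close>)
    qed
    ultimately have int: "has_stieltjes_integral
        (\<lambda>t. (w - z) * (cis t)\<^sup>2 / ((1 - w * cis t) * (1 - z * cis t)\<^sup>2) * e t) g a b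
        (inverse (w - z) * (h w - h z) - h' z)"
      by simp
    have "cmod (inverse (w - z) * (h w - h z) - h' z) \<le> (cmod (w - z) * (1 / (1 - r) ^ 3)) * V"
    proof (rule stieltjes_integral_bound[OF int V])
      fix t
      have p: "1 - r \<le> cmod (1 - w * cis t)" "1 - r \<le> cmod (1 - z * cis t)"
        using resolvent_kernel_bound(1)[of w "cis t"] resolvent_kernel_bound(1)[of z "cis t"] w r z by auto
      have "(1 - r) ^ 3 = (1 - r) * (1 - r)\<^sup>2" by (simp add: power3_eq_cube power2_eq_square)
      also have "\<dots> \<le> cmod (1 - w * cis t) * (cmod (1 - z * cis t))\<^sup>2"
        using p r by (intro mult_mono power_mono) auto
      finally have le: "(1 - r) ^ 3 \<le> cmod (1 - w * cis t) * (cmod (1 - z * cis t))\<^sup>2" .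
      have "cmod ((w - z) * (cis t)\<^sup>2 / ((1 - w * cis t) * (1 - z * cis t)\<^sup>2) * e t)
          = cmod (w - z) / (cmod (1 - w * cis t) * (cmod (1 - z * cis t))\<^sup>2)"
        by (simp add: norm_mult norm_divide norm_power e)
      also have "\<dots> \<le> cmod (w - z) / (1 - r) ^ 3"
        using le r by (intro divide_left_mono mult_pos_pos) (auto intro: less_le_trans[OF zero_less_power])
      finally show "cmod ((w - z) * (cis t)\<^sup>2 / ((1 - w * cis t) * (1 - z * cis t)\<^sup>2) * e t)
          \<le> cmod (w - z) * (1 / (1 - r) ^ 3)" by simp
    qed (use r in simp)
    then show ?thesis by (simp add: divide_inverse mult.commute mult.left_commute)
  qed
  have "((\<lambda>w. (h w - h z) / (w - z) - h' z) \<longlongrightarrow> 0) (at z)"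
  proof (rule Lim_null_comparison)
    show "eventually (\<lambda>w. norm ((h w - h z) / (w - z) - h' z) \<le> cmod (w - z) * (1 / (1 - r) ^ 3 * V)) (at z)"
      using near by (rule eventually_mono) (rule bound)
    have "((\<lambda>w. cmod (w - z) * (1 / (1 - r) ^ 3 * V)) \<longlongrightarrow> cmod (z - z) * (1 / (1 - r) ^ 3 * V)) (at z)"
      by (intro tendsto_mult tendsto_const tendsto_norm tendsto_diff tendsto_ident_at)
    then show "((\<lambda>w. cmod (w - z) * (1 / (1 - r) ^ 3 * V)) \<longlongrightarrow> 0) (at z)" by simp
  qed
  then have "((\<lambda>w. (h w - h z) / (w - z)) \<longlongrightarrow> h' z) (at z)"
    by (rule LIM_zero_cancel)
  then show "\<exists>f'. (h has_field_derivative f') (at z)"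
    unfolding has_field_derivative_iff by blast
qed

section \<open>The integrals defined by a solution\<close>

locale moment_model = toeplitz_model E N d x
  for E :: "'h::chilbert_space set" and N d x +
  fixes m :: "nat \<Rightarrow> nat \<Rightarrow> real \<Rightarrow> complex"
  assumes m_pos: "\<And>v s t. 0 \<le> s \<Longrightarrow> s \<le> t \<Longrightarrow> t \<le> 2 * pi \<Longrightarrow>
      0 \<le> (\<Sum>k<N. \<Sum>j<N. v k * cnj (v j) * (m k j t - m k j s))"
    and m_zero: "\<And>k j. k < N \<Longrightarrow> j < N \<Longrightarrow> m k j 0 = 0"
    and m_left: "\<And>k j t. k < N \<Longrightarrow> j < N \<Longrightarrow> 0 < t \<Longrightarrow> t \<le> 2 * pi \<Longrightarrow> (m k j \<longlongrightarrow> m k j t) (at_left t)"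
    and m_moment: "\<And>n k j. n \<le> d \<Longrightarrow> k < N \<Longrightarrow> j < N \<Longrightarrow>
      has_stieltjes_integral (\<lambda>t. cis (real n * t)) (m k j) 0 (2 * pi) (cinner (x (n * N + k)) (x j))"
begin

lemma m_hermitian:
  assumes "k < N" "j < N" "0 \<le> t" "t \<le> 2 * pi"
  shows "m j k t = cnj (m k j t)"
  using positive_form_hermitian[where N = N and D = "\<lambda>k j. m k j t - m k j 0" and k = k and j = j] m_pos[of 0 t] m_zero assms
  by simp

text \<open>The trace of the matrix function: one monotone function whose increments dominate those
  of all entries.\<close>

definition "total_mass t = (\<Sum>i<N. Re (m i i t))"

lemma m_dominated:
  assumes "k < N" "j < N" "0 \<le> s" "s \<le> t" "t \<le> 2 * pi"
  shows "cmod (m k j t - m k j s) \<le> total_mass t - total_mass s"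
  using positive_form_bound[where N = N and D = "\<lambda>k j. m k j t - m k j s" and k = k and j = j] m_pos[of s t] assms
  by (simp add: total_mass_def sum_subtractf)

lemma m_variation:
  assumes "k < N" "j < N"
  shows "variation_le (m k j) 0 (2 * pi) (total_mass (2 * pi) - total_mass 0)"
  by (rule variation_le_dominated) (simp_all add: m_dominated assms)

text \<open>Only monotone integrators have integrals at this point. \<open>q c\<close> is the form
  of M at e_k + c e_j, hence real and increasing, and polarization over the fourth roots of unity
  recovers \<open>m k j\<close>.\<close>

lemma m_integrable:
  assumes kj: "k < N" "j < N" and f: "continuous_on UNIV f"
  shows "\<exists>I. has_stieltjes_integral f (m k j) 0 (2 * pi) I"
proof -
  define q where "q c t = m k k t + c * cnj c * m j j t + (cnj c * m k j t + c * m j k t)" for c t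
  have q_pos: "0 \<le> q c t - q c s" if "0 \<le> s" "s \<le> t" "t \<le> 2 * pi" for c s t
    using positive_form_two[where N = N and D = "\<lambda>k j. m k j t - m k j s" and k = k and j = j and c = c] m_pos[OF that] kj
    by (simp add: q_def algebra_simps)
  have q_zero: "q c 0 = 0" for c by (simp add: q_def m_zero kj)
  have q_real: "q c t = complex_of_real (Re (q c t))" if "0 \<le> t" "t \<le> 2 * pi" for c t
    using q_pos[of 0 t c] that q_zero by (simp add: less_eq_complex_def complex_eq_iff)
  have "\<exists>I. has_stieltjes_integral f (q c) 0 (2 * pi) I" for c
  proof -
    have "\<exists>I. has_stieltjes_integral f (\<lambda>t. complex_of_real (Re (q c t))) 0 (2 * pi) I"
    proof (rule stieltjes_integral_exists[OF _ f])
      show "Re (q c u) \<le> Re (q c v)" if "0 \<le> u" "u \<le> v" "v \<le> 2 * pi" for u v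
        using q_pos[OF that, of c] by (simp add: less_eq_complex_def)
      show "((\<lambda>t. Re (q c t)) \<longlongrightarrow> Re (q c t)) (at_left t)" if "0 < t" "t \<le> 2 * pi" for t
        unfolding q_def
        by (intro tendsto_Re tendsto_add tendsto_mult tendsto_const m_left kj that)
    qed simp
    then obtain I where I: "has_stieltjes_integral f (\<lambda>t. complex_of_real (Re (q c t))) 0 (2 * pi) I"
      by blast
    have "has_stieltjes_integral f (q c) 0 (2 * pi) I"
      by (rule stieltjes_integral_cong[OF I]) (simp_all add: q_real[symmetric])
    then show ?thesis by blast
  qed
  then obtain I where I: "\<And>c. has_stieltjes_integral f (q c) 0 (2 * pi) (I c)" by metis
  have "has_stieltjes_integral f (\<lambda>t. \<Sum>a<4::nat. (1 / 4 * \<i> ^ a) * q (\<i> ^ a) t) 0 (2 * pi)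
      (\<Sum>a<4::nat. (1 / 4 * \<i> ^ a) * I (\<i> ^ a))"
    by (rule stieltjes_integral_lincomb) (rule I)
  moreover have "(\<Sum>a<4::nat. (1 / 4 * \<i> ^ a) * q (\<i> ^ a) t) = m k j t" for t
    by (simp add: eval_nat_numeral q_def algebra_simps)
  ultimately show ?thesis by auto
qed

definition "L k j f = (THE I. has_stieltjes_integral f (m k j) 0 (2 * pi) I)"

lemma has_L:
  assumes "k < N" "j < N" "continuous_on UNIV f"
  shows "has_stieltjes_integral f (m k j) 0 (2 * pi) (L k j f)"
proof -
  obtain I where I: "has_stieltjes_integral f (m k j) 0 (2 * pi) I"
    using m_integrable[OF assms] by blast
  then have "L k j f = I"
    unfolding L_def using stieltjes_integral_unique by blast
  with I show ?thesis by simp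
qed

lemma L_eqI: "has_stieltjes_integral f (m k j) 0 (2 * pi) I \<Longrightarrow> L k j f = I"
  unfolding L_def using stieltjes_integral_unique by blast

text \<open>The form of multiplication by \<open>f\<close> on vector trigonometric polynomials, where the index
  \<open>n = k * N + s\<close> stands for the function \<open>cis (k * t)\<close> in the component \<open>s\<close>.\<close>

definition "K = (d + 1) * N"

definition phase :: "nat \<Rightarrow> nat \<Rightarrow> real \<Rightarrow> complex"
  where "phase n r t = cis ((real (n div N) - real (r div N)) * t)"

definition B :: "(real \<Rightarrow> complex) \<Rightarrow> nat \<Rightarrow> nat \<Rightarrow> complex"
  where "B f n r = L (n mod N) (r mod N) (\<lambda>t. f t * phase n r t)"

definition F :: "(real \<Rightarrow> complex) \<Rightarrow> (nat \<Rightarrow> complex) \<Rightarrow> (nat \<Rightarrow> complex) \<Rightarrow> complex"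
  where "F f \<alpha> \<beta> = (\<Sum>n<K. \<Sum>r<K. \<alpha> n * cnj (\<beta> r) * B f n r)"

lemma mod_less: "n mod N < N"
  using N_pos by simp

lemma continuous_phase: "continuous_on UNIV f \<Longrightarrow> continuous_on UNIV (\<lambda>t. f t * phase n r t)"
  unfolding phase_def by (intro continuous_intros)

lemma has_B:
  "continuous_on UNIV f \<Longrightarrow>
    has_stieltjes_integral (\<lambda>t. f t * phase n r t) (m (n mod N) (r mod N)) 0 (2 * pi) (B f n r)"
  unfolding B_def by (intro has_L mod_less continuous_phase)

lemma B_eqI:
  "has_stieltjes_integral (\<lambda>t. f t * phase n r t) (m (n mod N) (r mod N)) 0 (2 * pi) I \<Longrightarrow> B f n r = I"
  unfolding B_def by (rule L_eqI)

lemma B_scale: "continuous_on UNIV f \<Longrightarrow> B (\<lambda>t. c * f t) n r = c * B f n r"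
  by (rule B_eqI) (simp only: mult.assoc stieltjes_integral_scale(1)[OF has_B])

lemma B_diff: "continuous_on UNIV f \<Longrightarrow> continuous_on UNIV g \<Longrightarrow> B (\<lambda>t. f t - g t) n r = B f n r - B g n r"
  by (rule B_eqI) (simp only: left_diff_distrib stieltjes_integral_diff[OF has_B has_B])

lemma phase_split: "phase n r t = cis (real (n div N) * t) * cnj (cis (real (r div N) * t))"
  unfolding phase_def cis_cnj cis_mult by (rule arg_cong[where f = cis]) (simp add: algebra_simps)

lemma B_cnj:
  assumes f: "continuous_on UNIV f"
  shows "B (\<lambda>t. cnj (f t)) n r = cnj (B f r n)"
proof (rule B_eqI)
  show "has_stieltjes_integral (\<lambda>t. cnj (f t) * phase n r t) (m (n mod N) (r mod N)) 0 (2 * pi) (cnj (B f r n))"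
  proof (rule stieltjes_integral_cong[OF stieltjes_integral_cnj[OF has_B[OF f, of r n]]])
    fix t :: real assume t: "0 \<le> t" "t \<le> 2 * pi"
    show "cnj (f t * phase r n t) = cnj (f t) * phase n r t"
    proof -
      have "cnj (phase r n t) = phase n r t"
        unfolding phase_def cis_cnj by (rule arg_cong[where f = cis]) (simp add: algebra_simps)
      then show ?thesis by simp
    qed
    show "cnj (m (r mod N) (n mod N) t) = m (n mod N) (r mod N) t"
      by (rule m_hermitian[OF mod_less mod_less t, symmetric])
  qed
qed

text \<open>Adding \<open>N\<close> moves an index to the next block and keeps its component, so
  multiplication by e^{it} acts as the block shift.\<close>

lemma B_shift: "B (\<lambda>t. f t * cis t) n r = B f (n + N) r"
proof -
  have "(n + N) div N = n div N + 1" "(n + N) mod N = n mod N" using N_pos by simp_all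
  then have "cis t * phase n r t = phase (n + N) r t" for t
    unfolding phase_def cis_mult by (intro arg_cong[where f = cis]) (simp add: algebra_simps)
  then have "(\<lambda>t. f t * cis t * phase n r t) = (\<lambda>t. f t * phase (n + N) r t)"
    by (simp only: mult.assoc)
  then show ?thesis by (simp add: B_def)
qed

text \<open>Shifting both arguments back r blocks; all indices met on the way stay below
  \<open>d * N\<close>, as \<open>gram_shift\<close> requires.\<close>

lemma gram_reduce:
  "r \<le> p \<Longrightarrow> p \<le> d \<Longrightarrow> k < N \<Longrightarrow> j < N \<Longrightarrow>
    cinner (x (p * N + k)) (x (r * N + j)) = cinner (x ((p - r) * N + k)) (x j)"
proof (induction r arbitrary: p)
  case (Suc r)
  then obtain p' where p': "p = Suc p'" by (cases p) auto
  have "p' * N + N \<le> d * N" "r * N + N \<le> d * N"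
    using Suc.prems p' mult_le_mono1[of "Suc p'" d N] mult_le_mono1[of "Suc r" d N] by auto
  then have "p' * N + k < d * N" "r * N + j < d * N" using Suc.prems by linarith+
  from gram_shift[OF this]
  have "cinner (x (p * N + k)) (x (Suc r * N + j)) = cinner (x (p' * N + k)) (x (r * N + j))"
    by (simp add: p' ac_simps)
  also have "\<dots> = cinner (x ((p' - r) * N + k)) (x j)"
    using Suc.prems p' by (intro Suc.IH) auto
  finally show ?case by (simp add: p')
qed simp

text \<open>Here the moment conditions enter: the form of the function 1 is the Gram matrix of the
  \<open>x n\<close>. Non-negative frequencies are moments up to a common block shift, negative ones
  follow by Hermitian symmetry.\<close>

lemma B_one:
  assumes "n < K" "r < K"
  shows "B (\<lambda>_. 1) n r = cinner (x n) (x r)"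
proof -
  have *: "B (\<lambda>_. 1) n r = cinner (x n) (x r)" if "r div N \<le> n div N" "n < K" for n r
  proof (rule B_eqI)
    have "n div N < d + 1" using that(2) unfolding K_def by (rule less_mult_imp_div_less)
    then have le: "n div N \<le> d" by simp
    have "cinner (x n) (x r) = cinner (x (n div N * N + n mod N)) (x (r div N * N + r mod N))"
      by simp
    also have "\<dots> = cinner (x ((n div N - r div N) * N + n mod N)) (x (r mod N))"
      by (rule gram_reduce[OF that(1) le mod_less mod_less])
    finally have eq: "cinner (x n) (x r) = cinner (x ((n div N - r div N) * N + n mod N)) (x (r mod N))" .
    have "n div N - r div N \<le> d" using le by simp
    from m_moment[OF this mod_less mod_less, of n r]
    show "has_stieltjes_integral (\<lambda>t. 1 * phase n r t) (m (n mod N) (r mod N)) 0 (2 * pi) (cinner (x n) (x r))"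
      unfolding eq phase_def using that(1) by (simp add: of_nat_diff)
  qed
  show ?thesis
  proof (cases "r div N \<le> n div N")
    case True
    then show ?thesis using * assms by blast
  next
    case False
    then have "B (\<lambda>_. 1) r n = cinner (x r) (x n)" using * assms by simp
    then show ?thesis
      using B_cnj[of "\<lambda>_. 1" n r] cinner_commute[of "x n" "x r"] by simp
  qed
qed

lemma F_scale: "continuous_on UNIV f \<Longrightarrow> F (\<lambda>t. c * f t) \<alpha> \<beta> = c * F f \<alpha> \<beta>"
  by (simp add: F_def B_scale sum_distrib_left mult.left_commute)

lemma F_diff: "continuous_on UNIV f \<Longrightarrow> continuous_on UNIV g \<Longrightarrow>
    F (\<lambda>t. f t - g t) \<alpha> \<beta> = F f \<alpha> \<beta> - F g \<alpha> \<beta>"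
  by (simp add: F_def B_diff right_diff_distrib sum_subtractf)

lemma F_cnj: "continuous_on UNIV f \<Longrightarrow> F (\<lambda>t. cnj (f t)) \<alpha> \<beta> = cnj (F f \<beta> \<alpha>)"
  unfolding F_def by (subst sum.swap) (simp add: B_cnj mult_ac)

lemma F_one: "F (\<lambda>_. 1) \<alpha> \<beta> = cinner (\<Sum>n<K. \<alpha> n *\<^sub>C x n) (\<Sum>n<K. \<beta> n *\<^sub>C x n)"
  unfolding F_def cinner_sum_left cinner_scaleC_left
  by (simp add: cinner_sum_right cinner_scaleC_right B_one sum_distrib_left mult.assoc)

lemma F_add_left: "F f (\<lambda>n. \<alpha> n + c * \<alpha>' n) \<beta> = F f \<alpha> \<beta> + c * F f \<alpha>' \<beta>"
  by (simp add: F_def distrib_right sum.distrib sum_distrib_left mult.assoc)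

lemma F_add_right: "F f \<alpha> (\<lambda>n. \<beta> n + c * \<beta>' n) = F f \<alpha> \<beta> + cnj c * F f \<alpha> \<beta>'"
  by (simp add: F_def distrib_left distrib_right sum.distrib sum_distrib_left mult_ac)

lemma F_sum_left: "F f (\<lambda>n. \<Sum>e\<in>E. c e * \<alpha> e n) \<beta> = (\<Sum>e\<in>E. c e * F f (\<alpha> e) \<beta>)"
  unfolding F_def sum_distrib_left sum_distrib_right
  by (subst sum.swap, subst (2) sum.swap) (simp add: sum.swap[of _ E] mult_ac)

lemma F_sum_right: "F f \<alpha> (\<lambda>n. \<Sum>e\<in>E. c e * \<beta> e n) = (\<Sum>e\<in>E. cnj (c e) * F f \<alpha> (\<beta> e))"
proof -
  have "F f \<alpha> (\<lambda>n. \<Sum>e\<in>E. c e * \<beta> e n) =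
      (\<Sum>n<K. \<Sum>r<K. \<Sum>e\<in>E. cnj (c e) * (\<alpha> n * cnj (\<beta> e r) * B f n r))"
    by (simp add: F_def sum_distrib_left sum_distrib_right mult_ac)
  also have "\<dots> = (\<Sum>n<K. \<Sum>e\<in>E. \<Sum>r<K. cnj (c e) * (\<alpha> n * cnj (\<beta> e r) * B f n r))"
    by (intro sum.cong refl sum.swap)
  also have "\<dots> = (\<Sum>e\<in>E. \<Sum>n<K. \<Sum>r<K. cnj (c e) * (\<alpha> n * cnj (\<beta> e r) * B f n r))"
    by (rule sum.swap)
  finally show ?thesis by (simp add: F_def sum_distrib_left)
qed

text \<open>Already the Stieltjes sums are non-negative: on each interval the double sum is f(t)
  times the form of the increment of M at one vector that depends on t. Positivity then passes to
  the limit of vanishing mesh.\<close>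

lemma F_positive:
  fixes f :: "real \<Rightarrow> real"
  assumes f: "continuous_on UNIV f" "\<And>t. 0 \<le> f t"
  shows "0 \<le> F (\<lambda>t. complex_of_real (f t)) \<alpha> \<alpha>"
proof -
  let ?K = "{..<K}"
  have cont: "continuous_on UNIV (\<lambda>t. complex_of_real (f t))" using f(1) by (rule continuous_on_of_real)
  define s where "s p = (\<Sum>n\<in>?K. \<Sum>r\<in>?K. \<alpha> n * cnj (\<alpha> r) *
      stieltjes_sum (\<lambda>t. complex_of_real (f t) * phase n r t) (m (n mod N) (r mod N)) p)" for p
  have lim: "(s \<longlongrightarrow> F (\<lambda>t. complex_of_real (f t)) \<alpha> \<alpha>) (mesh_filter 0 (2 * pi))"
    unfolding s_def F_def
    by (intro tendsto_sum tendsto_mult tendsto_const has_B[OF cont, unfolded has_stieltjes_integral_iff])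
  have pos: "0 \<le> s p" if p: "p tagged_division_of {0..2 * pi}" for p
  proof -
    have "s p = (\<Sum>n\<in>?K. \<Sum>r\<in>?K. \<Sum>(t, J)\<in>p. complex_of_real (f t) * ((\<alpha> n * cis (real (n div N) * t)) *
        cnj (\<alpha> r * cis (real (r div N) * t)) * (m (n mod N) (r mod N) (Sup J) - m (n mod N) (r mod N) (Inf J))))"
      unfolding s_def stieltjes_sum_def sum_distrib_left
      by (intro sum.cong refl) (auto simp: phase_split mult_ac)
    also have "\<dots> = (\<Sum>(t, J)\<in>p. complex_of_real (f t) * (\<Sum>n\<in>?K. \<Sum>r\<in>?K. (\<alpha> n * cis (real (n div N) * t)) *
        cnj (\<alpha> r * cis (real (r div N) * t)) * (m (n mod N) (r mod N) (Sup J) - m (n mod N) (r mod N) (Inf J))))"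
    proof -
      have swap: "(\<Sum>n\<in>?K. \<Sum>r\<in>?K. \<Sum>y\<in>p. Y n r y) = (\<Sum>y\<in>p. \<Sum>n\<in>?K. \<Sum>r\<in>?K. Y n r y)"
        for Y :: "nat \<Rightarrow> nat \<Rightarrow> real \<times> real set \<Rightarrow> complex"
      proof -
        have "(\<Sum>n\<in>?K. \<Sum>r\<in>?K. \<Sum>y\<in>p. Y n r y) = (\<Sum>n\<in>?K. \<Sum>y\<in>p. \<Sum>r\<in>?K. Y n r y)"
          by (rule sum.cong[OF refl], rule sum.swap)
        also have "\<dots> = (\<Sum>y\<in>p. \<Sum>n\<in>?K. \<Sum>r\<in>?K. Y n r y)"
          by (rule sum.swap)
        finally show ?thesis .
      qed
      show ?thesis
        unfolding sum_distrib_left split_def by (rule swap)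
    qed
    also have "0 \<le> \<dots>"
    proof (rule sum_nonneg, clarify)
      fix t J assume "(t, J) \<in> p"
      note J = tagged_division_interval[OF p this]
      define a where "a n = \<alpha> n * cis (real (n div N) * t)" for n
      define D where "D k j = m k j (Sup J) - m k j (Inf J)" for k j
      \<comment> \<open>The value at t of the k-th component of the vector trigonometric polynomial:
        all coefficients with the same residue modulo \<open>N\<close> are collected.\<close>
      define v where "v k = (\<Sum>n\<in>?K. if n mod N = k then a n else 0)" for k
      have group: "(\<Sum>n\<in>?K. b n * Y (n mod N)) = (\<Sum>k<N. (\<Sum>n\<in>?K. if n mod N = k then b n else 0) * Y k)"
        for b Y :: "nat \<Rightarrow> complex"
      proof -
        have "(\<Sum>k<N. (\<Sum>n\<in>?K. if n mod N = k then b n else 0) * Y k)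
            = (\<Sum>n\<in>?K. \<Sum>k<N. if n mod N = k then b n * Y k else 0)"
          unfolding sum_distrib_right by (subst sum.swap) (intro sum.cong refl, simp)
        also have "\<dots> = (\<Sum>n\<in>?K. b n * Y (n mod N))"
          by (intro sum.cong refl) (simp add: mod_less sum.delta')
        finally show ?thesis by simp
      qed
      have cnj_v: "cnj (v k) = (\<Sum>n\<in>?K. if n mod N = k then cnj (a n) else 0)" for k
        unfolding v_def cnj_sum by (intro sum.cong refl) simp
      have "(\<Sum>n\<in>?K. \<Sum>r\<in>?K. a n * cnj (a r) * D (n mod N) (r mod N))
          = (\<Sum>n\<in>?K. a n * (\<Sum>r\<in>?K. cnj (a r) * D (n mod N) (r mod N)))"
        by (simp add: sum_distrib_left mult.assoc)
      also have "\<dots> = (\<Sum>n\<in>?K. a n * (\<Sum>j<N. cnj (v j) * D (n mod N) j))"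
        unfolding group[of "\<lambda>r. cnj (a r)"] cnj_v ..
      also have "\<dots> = (\<Sum>k<N. v k * (\<Sum>j<N. cnj (v j) * D k j))"
        unfolding group[of a "\<lambda>k. \<Sum>j<N. cnj (v j) * D k j"] by (simp only: v_def)
      also have "\<dots> = (\<Sum>k<N. \<Sum>j<N. v k * cnj (v j) * D k j)"
        by (simp add: sum_distrib_left mult.assoc)
      also have "0 \<le> \<dots>"
        unfolding D_def by (rule m_pos) (use J in linarith)+
      finally have "0 \<le> (\<Sum>n\<in>?K. \<Sum>r\<in>?K. a n * cnj (a r) * D (n mod N) (r mod N))" .
      moreover have "0 \<le> complex_of_real (f t)" using f(2) by (simp add: less_eq_complex_def)
      ultimately show "0 \<le> complex_of_real (f t) * (\<Sum>n\<in>?K. \<Sum>r\<in>?K. (\<alpha> n * cis (real (n div N) * t)) *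
        cnj (\<alpha> r * cis (real (r div N) * t)) * (m (n mod N) (r mod N) (Sup J) - m (n mod N) (r mod N) (Inf J)))"
        unfolding a_def D_def by (rule mult_nonneg_nonneg[rotated])
    qed
    finally show ?thesis .
  qed
  have "0 \<le> Re (F (\<lambda>t. complex_of_real (f t)) \<alpha> \<alpha>)"
    by (rule tendsto_lowerbound[OF tendsto_Re[OF lim]], rule eventually_mesh_filterI)
      (use pos in \<open>simp_all add: less_eq_complex_def\<close>)
  moreover have "Im (F (\<lambda>t. complex_of_real (f t)) \<alpha> \<alpha>) = 0"
  proof (rule tendsto_unique[OF mesh_filter_neq_bot tendsto_Im[OF lim]])
    have "eventually (\<lambda>p. 0 = Im (s p)) (mesh_filter 0 (2 * pi))"
      by (rule eventually_mesh_filterI) (use pos in \<open>simp add: less_eq_complex_def\<close>)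
    then show "((\<lambda>p. Im (s p)) \<longlongrightarrow> 0) (mesh_filter 0 (2 * pi))"
      by (rule Lim_transform_eventually[OF tendsto_const])
  qed
  ultimately show ?thesis by (simp add: less_eq_complex_def)
qed

text \<open>From 0 \<le> f \<le> C the form of f lies between 0 and C times the inner product, so it
  vanishes on null combinations. A positive form that vanishes at a vector vanishes whenever that
  vector is one of its arguments. Hence multiplication by f has a well-defined compression to
  H.\<close>

lemma F_null_real:
  fixes f :: "real \<Rightarrow> real"
  assumes f: "continuous_on UNIV f" "\<And>t. 0 \<le> f t" "\<And>t. f t \<le> C"
    and null: "(\<Sum>n<K. \<alpha> n *\<^sub>C x n) = 0"
  shows "F (\<lambda>t. complex_of_real (f t)) \<alpha> \<beta> = 0" "F (\<lambda>t. complex_of_real (f t)) \<beta> \<alpha> = 0"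
proof -
  let ?f = "\<lambda>t. complex_of_real (f t)"
  have cont: "continuous_on UNIV ?f" using f(1) by (rule continuous_on_of_real)
  have "F (\<lambda>t. complex_of_real (C - f t)) \<alpha> \<alpha> = C * F (\<lambda>_. 1) \<alpha> \<alpha> - F ?f \<alpha> \<alpha>"
    using F_diff[of "\<lambda>_. complex_of_real C * 1" ?f \<alpha> \<alpha>] F_scale[of "\<lambda>_. 1" C \<alpha> \<alpha>] cont by simp
  also have "\<dots> = - F ?f \<alpha> \<alpha>" by (simp add: F_one null)
  finally have "0 \<le> - F ?f \<alpha> \<alpha>"
    using F_positive[of "\<lambda>t. C - f t" \<alpha>] f by (simp add: continuous_on_diff)
  with F_positive[OF f(1,2), of \<alpha>] have zero: "F ?f \<alpha> \<alpha> = 0"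
    by (simp add: less_eq_complex_def complex_eq_iff)
  \<comment> \<open>The form at \<beta> + t s \<alpha> has no quadratic term in t, because \<alpha>
    is null; the values s = 1 and s = \<i> separate the two mixed terms.\<close>
  have w: "cnj s * F ?f \<beta> \<alpha> + s * F ?f \<alpha> \<beta> = 0" for s
  proof (rule affine_nonneg_imp_zero)
    fix t :: real
    have "F ?f (\<lambda>n. \<beta> n + (t * s) * \<alpha> n) (\<lambda>n. \<beta> n + (t * s) * \<alpha> n)
        = F ?f \<beta> \<beta> + complex_of_real t * (cnj s * F ?f \<beta> \<alpha> + s * F ?f \<alpha> \<beta>)"
      unfolding F_add_left F_add_right by (simp add: zero algebra_simps)
    then show "0 \<le> F ?f \<beta> \<beta> + complex_of_real t * (cnj s * F ?f \<beta> \<alpha> + s * F ?f \<alpha> \<beta>)"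
      using F_positive[OF f(1,2)] by metis
  qed
  have 1: "F ?f \<beta> \<alpha> + F ?f \<alpha> \<beta> = 0" using w[of 1] by simp
  have "\<i> * (F ?f \<alpha> \<beta> - F ?f \<beta> \<alpha>) = 0" using w[of \<i>] by (simp add: algebra_simps)
  then have "F ?f \<alpha> \<beta> = F ?f \<beta> \<alpha>" by simp
  with 1 show "F ?f \<alpha> \<beta> = 0" "F ?f \<beta> \<alpha> = 0" by simp_all
qed

section \<open>Compressions of multiplication operators to H\<close>

definition good :: "(real \<Rightarrow> complex) \<Rightarrow> bool"
  where "good f \<longleftrightarrow> continuous_on UNIV f \<and> (\<exists>C. \<forall>t. cmod (f t) \<le> C)"

lemma good_continuous: "good f \<Longrightarrow> continuous_on UNIV f"
  by (simp add: good_def)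

lemma F_null:
  assumes f: "good f" and null: "(\<Sum>n<K. \<alpha> n *\<^sub>C x n) = 0"
  shows "F f \<alpha> \<beta> = 0" "F f \<beta> \<alpha> = 0"
proof -
  obtain C where C: "\<And>t. cmod (f t) \<le> C" and cont: "continuous_on UNIV f"
    using f unfolding good_def by blast
  \<comment> \<open>Then f = p - (C - \<i> C) - \<i> q with p and q between 0 and 2 C. The sign in q
    leaves only differences and scalings.\<close>
  define p where "p t = Re (f t) + C" for t
  define q where "q t = - Im (f t) + C" for t
  have cp: "continuous_on UNIV p" "continuous_on UNIV q"
    unfolding p_def q_def by (intro continuous_intros cont)+
  have pq: "0 \<le> p t" "p t \<le> 2 * C" "0 \<le> q t" "q t \<le> 2 * C" for t
    using abs_Re_le_cmod[of "f t"] abs_Im_le_cmod[of "f t"] C[of t] by (auto simp: p_def q_def abs_le_iff)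
  have one: "F (\<lambda>_. 1) \<alpha> \<beta> = 0" "F (\<lambda>_. 1) \<beta> \<alpha> = 0" by (simp_all add: F_one null)
  have eq: "F f \<gamma> \<delta> = (F (\<lambda>t. complex_of_real (p t)) \<gamma> \<delta> - (C - \<i> * C) * F (\<lambda>_. 1) \<gamma> \<delta>)
      - \<i> * F (\<lambda>t. complex_of_real (q t)) \<gamma> \<delta>" for \<gamma> \<delta>
  proof -
    have cc: "continuous_on UNIV (\<lambda>t. complex_of_real (p t))" "continuous_on UNIV (\<lambda>t. complex_of_real (q t))"
      "continuous_on UNIV (\<lambda>t::real. (C - \<i> * C) * 1)" "continuous_on UNIV (\<lambda>t::real. 1::complex)"
      by (simp_all add: continuous_on_of_real cp)
    have c1: "continuous_on UNIV (\<lambda>t. complex_of_real (p t) - (C - \<i> * C) * 1)"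
      by (rule continuous_on_diff[OF cc(1,3)])
    have c2: "continuous_on UNIV (\<lambda>t. \<i> * complex_of_real (q t))"
      by (rule continuous_on_mult_left[OF cc(2)])
    have "f = (\<lambda>t. (complex_of_real (p t) - (C - \<i> * C) * 1) - \<i> * complex_of_real (q t))"
      by (rule ext) (simp add: p_def q_def complex_eq_iff)
    then have "F f \<gamma> \<delta> = F (\<lambda>t. (complex_of_real (p t) - (C - \<i> * C) * 1) - \<i> * complex_of_real (q t)) \<gamma> \<delta>"
      by simp
    then show ?thesis
      unfolding F_diff[OF c1 c2] F_diff[OF cc(1,3)] F_scale[OF cc(2)] F_scale[OF cc(4)] .
  qed
  show "F f \<alpha> \<beta> = 0" "F f \<beta> \<alpha> = 0"
    unfolding eq one using F_null_real[OF cp(1) pq(1,2) null] F_null_real[OF cp(2) pq(3,4) null] by simp_all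
qed

definition coords :: "'h \<Rightarrow> nat \<Rightarrow> complex"
  where "coords h = (SOME \<alpha>. h = (\<Sum>n<K. \<alpha> n *\<^sub>C x n))"

lemma coords: "(\<Sum>n<K. coords h n *\<^sub>C x n) = h"
proof -
  have "\<exists>\<alpha>. h = (\<Sum>n<K. \<alpha> n *\<^sub>C x n)"
    using span_x unfolding span_image_lessThan K_def by blast
  from someI_ex[OF this] show ?thesis by (simp add: coords_def)
qed

text \<open>The operator whose matrix in the basis \<open>E\<close> is the form of f. Arbitrary
  coordinates are chosen for basis vectors only, so linearity holds by construction;
  \<open>Op_F\<close> shows that the choice does not matter.\<close>

definition Op :: "(real \<Rightarrow> complex) \<Rightarrow> 'h \<Rightarrow> 'h"
  where "Op f h = (\<Sum>e\<in>E. \<Sum>e'\<in>E. (cinner h e * F f (coords e) (coords e')) *\<^sub>C e')"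

lemma Op_linear: "clinear_on UNIV (Op f)"
  unfolding clinear_on_def Op_def
  by (simp add: cinner_add_left cinner_scaleC_left distrib_right scaleC_add_left sum.distrib
      complex_vector.scale_sum_right scaleC_scaleC mult.assoc)

lemma Op_F:
  assumes f: "good f"
  shows "cinner (Op f (\<Sum>n<K. \<alpha> n *\<^sub>C x n)) (\<Sum>n<K. \<beta> n *\<^sub>C x n) = F f \<alpha> \<beta>"
proof -
  \<comment> \<open>Coordinates of h that depend linearly on h, in contrast to
    \<open>coords h\<close>. They differ from any other coordinates by a null combination, to which
    \<open>F_null\<close> applies.\<close>
  define \<gamma> where "\<gamma> h n = (\<Sum>e\<in>E. cinner h e * coords e n)" for h n
  have \<gamma>: "(\<Sum>n<K. \<gamma> h n *\<^sub>C x n) = h" for h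
  proof -
    have "(\<Sum>n<K. \<gamma> h n *\<^sub>C x n) = (\<Sum>n<K. \<Sum>e\<in>E. cinner h e *\<^sub>C coords e n *\<^sub>C x n)"
      by (simp add: \<gamma>_def complex_vector.scale_sum_left scaleC_scaleC)
    also have "\<dots> = (\<Sum>e\<in>E. \<Sum>n<K. cinner h e *\<^sub>C coords e n *\<^sub>C x n)"
      by (rule sum.swap)
    also have "\<dots> = (\<Sum>e\<in>E. cinner h e *\<^sub>C e)"
      unfolding complex_vector.scale_sum_right[symmetric] coords ..
    finally show ?thesis unfolding expansion .
  qed
  have Op_\<gamma>: "cinner (Op f h) g = F f (\<gamma> h) (\<gamma> g)" for h g
  proof -
    have "F f (\<gamma> h) (\<gamma> g) = (\<Sum>e\<in>E. cinner h e * (\<Sum>e'\<in>E. cnj (cinner g e') * F f (coords e) (coords e')))"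
      unfolding \<gamma>_def F_sum_left F_sum_right ..
    also have "\<dots> = cinner (Op f h) g"
      by (simp add: Op_def cinner_sum_left cinner_scaleC_left sum_distrib_left mult_ac
          cinner_commute[of _ g, symmetric])
    finally show ?thesis by simp
  qed
  let ?h = "\<Sum>n<K. \<alpha> n *\<^sub>C x n" and ?g = "\<Sum>n<K. \<beta> n *\<^sub>C x n"
  have zero: "(\<Sum>n<K. (\<delta> n + (- 1) * \<gamma> (\<Sum>n<K. \<delta> n *\<^sub>C x n) n) *\<^sub>C x n) = 0" for \<delta>
    using \<gamma>[of "\<Sum>n<K. \<delta> n *\<^sub>C x n"]
    by (simp add: complex_vector.scale_left_diff_distrib sum_subtractf)
  have "F f \<alpha> \<beta> = F f (\<gamma> ?h) \<beta>"
    using F_null(1)[OF f zero[of \<alpha>], of \<beta>] unfolding F_add_left by simp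
  also have "\<dots> = F f (\<gamma> ?h) (\<gamma> ?g)"
    using F_null(2)[OF f zero[of \<beta>], of "\<gamma> ?h"] unfolding F_add_right by simp
  finally show ?thesis by (simp add: Op_\<gamma>)
qed

lemma Op_coords: "good f \<Longrightarrow> cinner (Op f h) g = F f (coords h) (coords g)"
  using Op_F[of f "coords h" "coords g"] by (simp add: coords)

lemma Op_x:
  assumes f: "good f" and nr: "n < K" "r < K"
  shows "cinner (Op f (x n)) (x r) = B f n r"
proof -
  have unit: "(\<Sum>i<K. (if i = k then 1 else 0) *\<^sub>C x i) = x k" if "k < K" for k
    using that by (simp add: if_distrib[of "\<lambda>c. c *\<^sub>C _"] cong: if_cong)
  have "cinner (Op f (x n)) (x r) = F f (\<lambda>i. if i = n then 1 else 0) (\<lambda>i. if i = r then 1 else 0)"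
    using Op_F[OF f, of "\<lambda>i. if i = n then 1 else 0" "\<lambda>i. if i = r then 1 else 0"]
    unfolding unit[OF nr(1)] unit[OF nr(2)] .
  also have "\<dots> = (\<Sum>i<K. \<Sum>l<K. if i = n then if l = r then B f i l else 0 else 0)"
    unfolding F_def by (intro sum.cong refl) simp
  also have "\<dots> = (\<Sum>i<K. if i = n then B f n r else 0)"
  proof (rule sum.cong[OF refl])
    fix i
    show "(\<Sum>l<K. if i = n then if l = r then B f i l else 0 else 0) = (if i = n then B f n r else 0)"
      using nr(2) by (cases "i = n") simp_all
  qed
  also have "\<dots> = B f n r" using nr(1) by simp
  finally show ?thesis .
qed

section \<open>The compressed resolvent\<close>

definition kernel :: "complex \<Rightarrow> real \<Rightarrow> complex"
  where "kernel z t = 1 / (1 - z * cis t)"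

lemma kernel_continuous: "cmod z < 1 \<Longrightarrow> continuous_on UNIV (kernel z)"
  unfolding kernel_def by (intro continuous_intros) (use resolvent_kernel_bound(2) in auto)

lemma good_kernel:
  assumes "cmod z < 1"
  shows "good (kernel z)" "good (\<lambda>t. kernel z t * cis t)"
proof -
  have bound: "cmod (kernel z t) \<le> 1 / (1 - cmod z)" for t
    using resolvent_kernel_bound[of z "cis t"] assms
    by (simp add: kernel_def norm_divide frac_le)
  have cont: "continuous_on UNIV (\<lambda>t. kernel z t * cis t)"
    by (intro continuous_on_mult kernel_continuous assms continuous_intros)
  show "good (kernel z)" "good (\<lambda>t. kernel z t * cis t)"
    unfolding good_def using kernel_continuous[OF assms] cont bound
    by (auto simp: norm_mult intro!: exI[of _ "1 / (1 - cmod z)"])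
qed

abbreviation "R z \<equiv> Op (kernel z)"
abbreviation "Q z \<equiv> Op (\<lambda>t. kernel z t * cis t)"

text \<open>A pointwise identity of kernels. It rewrites E - R_z^{-1} as z Q_z R_z^{-1}, so the
  factor z splits off without a division.\<close>

lemma R_minus_Q:
  assumes z: "cmod z < 1"
  shows "R z h - z *\<^sub>C Q z h = h"
proof (rule cinner_left_eqI)
  fix g
  note c1 = good_continuous[OF good_kernel(1)[OF z]] and c2 = good_continuous[OF good_kernel(2)[OF z]]
  have "kernel z t - z * (kernel z t * cis t) = 1" for t
    using resolvent_kernel_bound(2)[OF z, of "cis t"] by (simp add: kernel_def divide_simps)
  then have "(\<lambda>_. 1) = (\<lambda>t. kernel z t - z * (kernel z t * cis t))" by simp
  then have "F (\<lambda>_. 1) (coords h) (coords g)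
      = F (\<lambda>t. kernel z t - z * (kernel z t * cis t)) (coords h) (coords g)" by simp
  also have "\<dots> = F (kernel z) (coords h) (coords g) - z * F (\<lambda>t. kernel z t * cis t) (coords h) (coords g)"
    unfolding F_diff[OF c1 continuous_on_mult_left[OF c2]] F_scale[OF c2] ..
  finally show "cinner (R z h - z *\<^sub>C Q z h) g = cinner h g"
    by (simp add: cinner_diff_left cinner_scaleC_left Op_coords good_kernel z F_one coords)
qed

lemma Q_shift:
  assumes z: "cmod z < 1" and n: "n < d * N"
  shows "Q z (x n) = R z (x (n + N))"
proof (rule eq_on_x)
  fix r assume "r < (d + 1) * N"
  then have "r < K" by (simp only: K_def)
  moreover have "n < K" "n + N < K" using n by (simp_all add: K_def)
  ultimately show "cinner (Q z (x n)) (x r) = cinner (R z (x (n + N))) (x r)"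
    by (simp add: Op_x good_kernel z B_shift)
qed

text \<open>\<open>2 * Re (kernel z t) - 1\<close> is the Poisson kernel (1 - |z|^2) / |1 - z
  e^{it}|^2; positivity of the form carries its sign over to the compression.\<close>

lemma R_coercive:
  assumes z: "cmod z < 1"
  shows "(norm h)\<^sup>2 \<le> 2 * Re (cinner (R z h) h)"
proof -
  let ?\<alpha> = "coords h"
  note c = kernel_continuous[OF z]
  define p where "p t = 2 * Re (kernel z t) - 1" for t
  have cp: "continuous_on UNIV p"
    unfolding p_def by (intro continuous_intros c)
  have "0 \<le> p t" for t
  proof -
    define w where "w = 1 - z * cis t"
    have w: "w \<noteq> 0" using resolvent_kernel_bound(2)[OF z, of "cis t"] by (simp add: w_def)
    have "norm (1 - w) \<le> norm (1 :: complex)" using z by (simp add: w_def norm_mult)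
    then have "(cmod w)\<^sup>2 \<le> 2 * Re (cinner 1 w)" by (simp only: resolvent_positive_iff)
    then have "(cmod w)\<^sup>2 \<le> 2 * Re w" by (simp add: cinner_complex_def)
    moreover have "Re (1 / w) = Re w / (cmod w)\<^sup>2" by (simp add: Re_divide cmod_power2)
    ultimately show ?thesis using w by (simp add: p_def kernel_def w_def[symmetric] le_divide_eq)
  qed
  from F_positive[OF cp this, of ?\<alpha>]
  have "0 \<le> F (\<lambda>t. complex_of_real (p t)) ?\<alpha> ?\<alpha>" .
  also have "(\<lambda>t. complex_of_real (p t)) = (\<lambda>t. (kernel z t - (- 1) * cnj (kernel z t)) - 1)"
    by (rule ext) (simp add: p_def complex_eq_iff)
  also have "F \<dots> ?\<alpha> ?\<alpha> = F (kernel z) ?\<alpha> ?\<alpha> - (- 1) * cnj (F (kernel z) ?\<alpha> ?\<alpha>) - F (\<lambda>_. 1) ?\<alpha> ?\<alpha>"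
  proof -
    have c2: "continuous_on UNIV (\<lambda>t. cnj (kernel z t))" by (intro continuous_intros c)
    note c3 = continuous_on_mult_left[OF c2, of "- 1"]
    note c4 = continuous_on_diff[OF c c3]
    show ?thesis
      unfolding F_diff[OF c4 continuous_on_const] F_diff[OF c c3] F_scale[OF c2] F_cnj[OF c] ..
  qed
  also have "\<dots> = cinner (R z h) h + cnj (cinner (R z h) h) - cinner h h"
    by (simp add: Op_coords good_kernel z F_one coords)
  finally show ?thesis by (simp add: less_eq_complex_def cinner_self)
qed

lemma Op_holomorphic:
  assumes B: "\<And>n r. (\<lambda>z. B (f z) n r) holomorphic_on ball 0 1" and good: "\<And>z. cmod z < 1 \<Longrightarrow> good (f z)"
  shows "weakly_holomorphic (\<lambda>z. Op (f z))"
  unfolding weakly_holomorphic_def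
proof (intro allI)
  fix u g
  have "(\<lambda>z. F (f z) (coords u) (coords g)) holomorphic_on ball 0 1"
    unfolding F_def by (intro holomorphic_intros B)
  then show "(\<lambda>z. cinner (Op (f z) u) g) holomorphic_on ball 0 1"
    by (rule holomorphic_transform) (simp add: Op_coords good)
qed

lemma B_kernel_holomorphic: "(\<lambda>z. B (kernel z) n r) holomorphic_on ball 0 1"
proof (rule stieltjes_resolvent_holomorphic[OF m_variation[OF mod_less mod_less]])
  fix z :: complex assume z: "cmod z < 1"
  show "has_stieltjes_integral (\<lambda>t. 1 / (1 - z * cis t) * phase n r t) (m (n mod N) (r mod N)) 0 (2 * pi)
      (B (kernel z) n r)"
    using has_B[OF kernel_continuous[OF z]] by (simp add: kernel_def)
  have "continuous_on UNIV (\<lambda>t. cis t / (1 - z * cis t)\<^sup>2)"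
    by (intro continuous_intros) (use resolvent_kernel_bound(2)[OF z] in auto)
  then show "has_stieltjes_integral (\<lambda>t. cis t / (1 - z * cis t)\<^sup>2 * phase n r t) (m (n mod N) (r mod N)) 0 (2 * pi)
      (B (\<lambda>t. cis t / (1 - z * cis t)\<^sup>2) n r)"
    by (rule has_B)
qed (simp add: phase_def)

lemma R_holomorphic: "weakly_holomorphic R"
  by (rule Op_holomorphic[OF B_kernel_holomorphic good_kernel(1)])

lemma Q_holomorphic: "weakly_holomorphic Q"
  by (rule Op_holomorphic) (simp_all add: B_shift B_kernel_holomorphic good_kernel)

lemma R_bij:
  assumes "cmod z < 1"
  shows "bij (R z)"
proof -
  obtain C where C: "\<And>h. norm (R z h) \<le> C * norm h"
    using bounded_if_linear[OF Op_linear] by blast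
  show ?thesis by (rule coercive_bij[OF Op_linear C R_coercive[OF assms]])
qed

section \<open>The contractive extension and its parameter\<close>

definition "S z = inv_into UNIV (R z)"
text \<open>For z \<noteq> 0 this is (E - R_z^{-1}) / z. The form with \<open>Q\<close> also covers
  z = 0 and is visibly holomorphic once \<open>S\<close> is.\<close>

definition "T z h = Q z (S z h)"

lemma R_S: "cmod z < 1 \<Longrightarrow> R z (S z h) = h"
  unfolding S_def by (rule surj_f_inv_f[OF bij_is_surj[OF R_bij]])

lemma S_R: "cmod z < 1 \<Longrightarrow> S z (R z h) = h"
  unfolding S_def by (rule inv_f_f[OF bij_is_inj[OF R_bij]])

lemma S_linear: "cmod z < 1 \<Longrightarrow> clinear_on UNIV (S z)"
  unfolding S_def by (rule clinear_inv[OF Op_linear R_bij])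

lemma T_linear: "cmod z < 1 \<Longrightarrow> clinear_on UNIV (T z)"
  using S_linear[of z] Op_linear[of "\<lambda>t. kernel z t * cis t"] unfolding clinear_on_def T_def by simp

lemma S_eq: "cmod z < 1 \<Longrightarrow> h - z *\<^sub>C T z h = S z h"
  using R_minus_Q[of z "S z h"] by (simp add: T_def R_S)

lemma T_scaled_le:
  assumes z: "cmod z < 1"
  shows "cmod z * norm (T z h) \<le> norm h"
proof -
  have "(norm (S z h))\<^sup>2 \<le> 2 * Re (cinner h (S z h))"
    using R_coercive[OF z, of "S z h"] by (simp add: R_S z)
  then have "norm (h - S z h) \<le> norm h" by (simp only: resolvent_positive_iff)
  also have "h - S z h = z *\<^sub>C T z h" by (simp add: S_eq[OF z, symmetric])
  finally show ?thesis by simp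
qed

lemma S_holomorphic: "weakly_holomorphic S"
proof (rule weakly_holomorphic_inverse[OF R_holomorphic Op_linear S_linear])
  fix z :: complex assume z: "cmod z < 1"
  have "eventually (\<lambda>w. w \<in> ball 0 1) (at z)"
    using z by (intro eventually_at_in_open') auto
  \<comment> \<open>S_w = E - w T_w is the identity minus a contraction by
    \<open>T_scaled_le\<close>, hence the bound 2 on the whole disc.\<close>
  then have "eventually (\<lambda>w. \<forall>h. norm (S w h) \<le> 2 * norm h) (at z)"
  proof eventually_elim
    case (elim w)
    then have w: "cmod w < 1" by simp
    show ?case
    proof
      fix h
      have "norm (S w h) \<le> norm h + norm (w *\<^sub>C T w h)"
        unfolding S_eq[OF w, symmetric] by (rule norm_triangle_ineq4)
      then show "norm (S w h) \<le> 2 * norm h" using T_scaled_le[OF w, of h] by simp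
    qed
  qed
  then show "\<exists>C. eventually (\<lambda>w. \<forall>h. norm (S w h) \<le> C * norm h) (at z)" by blast
qed (simp_all add: S_R R_S)

lemma T_holomorphic: "weakly_holomorphic T"
proof -
  have "T = (\<lambda>z h. Q z (S z h))" by (intro ext) (simp add: T_def)
  then show ?thesis using weakly_holomorphic_comp[OF Q_holomorphic Op_linear S_holomorphic] by simp
qed

lemma T_contraction: "cmod z < 1 \<Longrightarrow> norm (T z h) \<le> norm h"
  by (rule schwarz_contraction[OF T_holomorphic T_scaled_le])

text \<open>The shift relation of the compressed resolvent, R_z (x_n - z x_{n+N}) = x_n, gives S_z
  x_n = x_n - z x_{n+N}. Applying Q_z leaves R_z x_{n+N} - z Q_z x_{n+N}, which is x_{n+N}.\<close>

lemma T_x: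
  assumes z: "cmod z < 1" and n: "n < d * N"
  shows "T z (x n) = x (n + N)"
proof -
  have "R z (x n - z *\<^sub>C x (n + N)) = x n"
    using R_minus_Q[OF z, of "x n"]
    by (simp add: clinear_diff[OF Op_linear] clinear_scale[OF Op_linear] Q_shift[OF z n])
  then have "S z (x n) = x n - z *\<^sub>C x (n + N)"
    using S_R[OF z, of "x n - z *\<^sub>C x (n + N)"] by simp
  then show ?thesis
    using R_minus_Q[OF z, of "x (n + N)"]
    by (simp add: T_def clinear_diff[OF Op_linear] clinear_scale[OF Op_linear] Q_shift[OF z n])
qed

lemma T_DA:
  assumes z: "cmod z < 1" and u: "u \<in> DA"
  shows "T z u = A u"
proof -
  obtain \<alpha> where "u = (\<Sum>k<d * N. \<alpha> k *\<^sub>C x k)" using u unfolding DA_eq by blast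
  then show ?thesis
    by (simp add: A_sum clinear_sum[OF T_linear[OF z]] clinear_scale[OF T_linear[OF z]] T_x[OF z])
qed

text \<open>T_z is a contraction and isometric on D(A), so it preserves inner products with vectors
  of D(A), and orthogonality in particular.\<close>

lemma T_maps:
  assumes z: "cmod z < 1" and v: "v \<in> orth_compl DA"
  shows "T z v \<in> orth_compl (A_ran N d x)"
  unfolding orth_compl_def A_ran_def
proof clarify
  fix u assume u: "u \<in> DA"
  have "cinner (T z v) (T z u) = cinner v u"
    by (rule contraction_preserves_cinner[OF T_linear[OF z] T_contraction[OF z]])
      (simp add: T_DA[OF z u] A_isometry[OF u])
  also have "\<dots> = 0" using u v by (simp add: orth_compl_def)
  finally show "cinner (T z v) (A u) = 0" by (simp add: T_DA[OF z u])
qed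

text \<open>The parameter is T_z restricted to the complement of D(A). On D(A) both T_z and the
  orthogonal sum agree with A, so the sum is T_z again and its resolvent is the compressed kernel,
  whose first block consists of the integrals of M.\<close>

lemma generating_parameter_exists:
  "\<exists>\<Phi> \<in> parameters N d x. \<forall>z k j. cmod z \<noteq> 1 \<longrightarrow> k < N \<longrightarrow> j < N \<longrightarrow>
    has_stieltjes_integral (\<lambda>t. 1 / (1 - z * cis t)) (m k j) 0 (2 * pi)
      (cinner (gen_resolvent DA A \<Phi> z (x k)) (x j))"
proof -
  define \<Phi> where "\<Phi> = (\<lambda>z\<in>ball 0 1. restrict (T z) (orth_compl DA))"
  have \<Phi>_eq: "\<Phi> z v = T z v" if "cmod z < 1" "v \<in> orth_compl DA" for z v
    using that by (simp add: \<Phi>_def)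
  have par: "\<Phi> \<in> parameters N d x"
    unfolding parameters_def analytic_contractions_def
  proof (intro CollectI conjI)
    show "\<Phi> \<in> ball 0 1 \<rightarrow>\<^sub>E contractions (orth_compl DA) (orth_compl (A_ran N d x))"
    proof (rule PiE_I)
      fix z :: complex assume "z \<in> ball 0 1"
      then have z: "cmod z < 1" by simp
      have sub: "complex_vector.subspace (orth_compl DA)" by (rule subspace_orth_compl)
      have "clinear_on (orth_compl DA) (\<Phi> z)"
        using T_linear[OF z] sub unfolding clinear_on_def
        by (simp add: \<Phi>_eq[OF z] complex_vector.subspace_add complex_vector.subspace_scale)
      moreover have "\<Phi> z \<in> orth_compl DA \<rightarrow>\<^sub>E orth_compl (A_ran N d x)"
        using z T_maps[OF z] by (auto simp: \<Phi>_def)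
      ultimately show "\<Phi> z \<in> contractions (orth_compl DA) (orth_compl (A_ran N d x))"
        unfolding contractions_def using T_contraction[OF z] by (simp add: \<Phi>_eq[OF z])
    qed (simp add: \<Phi>_def)
    show "op_analytic_on (ball 0 1) (orth_compl DA) (orth_compl (A_ran N d x)) \<Phi>"
      by (rule op_analytic_if_weakly_holomorphic[OF T_holomorphic T_linear T_maps \<Phi>_eq])
  qed
  interpret P: parameter E N d x \<Phi>
    by unfold_locales (rule par)
  have PT: "P.T z h = T z h" if z: "cmod z < 1" for z h
  proof -
    obtain u where u: "u \<in> DA" "h - u \<in> orth_compl DA"
      using orth_decomposition[of "x ` {..<d * N}" h] unfolding A_dom_def by blast
    have "P.T z (u + (h - u)) = T z (u + (h - u))"
      unfolding clinear_add[OF P.T_linear[OF z]] clinear_add[OF T_linear[OF z]]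
      by (simp only: P.T_DA[OF z u(1)] P.T_compl[OF z u(2)] T_DA[OF z u(1)] \<Phi>_eq[OF z u(2)])
    then show ?thesis by simp
  qed
  have PR: "P.R z h = R z h" if z: "cmod z < 1" for z h
  proof -
    have "R z h - z *\<^sub>C P.T z (R z h) = h"
      unfolding PT[OF z] S_eq[OF z] by (rule S_R[OF z])
    then show ?thesis using P.R_left[OF z, of "R z h"] by simp
  qed
  have inner: "has_stieltjes_integral (\<lambda>t. 1 / (1 - z * cis t)) (m k j) 0 (2 * pi) (cinner (P.R z (x k)) (x j))"
    if z: "cmod z < 1" and kj: "k < N" "j < N" for z k j
  proof -
    have lt: "k < K" "j < K" using kj by (auto simp: K_def)
    have "has_stieltjes_integral (\<lambda>t. kernel z t * phase k j t) (m (k mod N) (j mod N)) 0 (2 * pi)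
        (cinner (R z (x k)) (x j))"
      unfolding Op_x[OF good_kernel(1)[OF z] lt] by (rule has_B[OF kernel_continuous[OF z]])
    then show ?thesis
      using kj by (simp add: PR[OF z] kernel_def phase_def)
  qed
  \<comment> \<open>M is Hermitian, so conjugating the entry (k, j) gives the entry (j, k), as the
    reflection to |z| > 1 requires.\<close>
  have "has_stieltjes_integral (\<lambda>t. 1 / (1 - z * cis t)) (m k j) 0 (2 * pi) (cinner (P.G z (x k)) (x j))"
    if z: "cmod z \<noteq> 1" and kj: "k < N" "j < N" for z k j
  proof (rule P.stieltjes_G[OF inner[OF _ kj] _ z])
    fix w :: complex assume w: "cmod w < 1"
    show "has_stieltjes_integral (\<lambda>t. 1 / (1 - w * cis t)) (\<lambda>t. cnj (m k j t)) 0 (2 * pi)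
        (cinner (P.R w (x j)) (x k))"
    proof (rule stieltjes_integral_cong[OF inner[OF w kj(2,1)]])
      fix t :: real assume "0 \<le> t" "t \<le> 2 * pi"
      then show "m j k t = cnj (m k j t)" by (rule m_hermitian[OF kj])
    qed simp
  qed
  with par show ?thesis by blast
qed

end

section \<open>The correspondence between parameters and solutions\<close>

theorem theorem4:
  fixes N d :: nat
    and S :: "nat \<Rightarrow> complex mat"
    and x :: "nat \<Rightarrow> 'h::chilbert_space"
  assumes "N \<ge> 1" and "d \<ge> 1"
    and "\<And>n. n \<le> d \<Longrightarrow> S n \<in> carrier_mat N N"
    and "pos_semidef (block_toeplitz N d S)"
    and "\<And>n m. n < (d + 1) * N \<Longrightarrow> m < (d + 1) * N \<Longrightarrow>
           cinner (x n) (x m) = block_toeplitz N d S $$ (n, m)"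
    and "cspan (x ` {..<(d + 1) * N}) = UNIV"
  shows "(\<forall>M \<in> moment_solutions N d S. \<exists>\<Phi> \<in> parameters N d x. generates N d x \<Phi> M) \<and>
    (\<forall>\<Phi> \<in> parameters N d x. \<exists>!M. generates N d x \<Phi> M) \<and>
    (\<forall>\<Phi> \<in> parameters N d x. \<forall>M. generates N d x \<Phi> M \<longrightarrow> M \<in> moment_solutions N d S) \<and>
    bij_betw (\<lambda>\<Phi>. THE M. generates N d x \<Phi> M) (parameters N d x) (moment_solutions N d S)"
proof -
  obtain E :: "'h set" where E: "finite E" "orthonormal E" "cspan E = UNIV"
    using orthonormal_basis_exists[of "x ` {..<(d + 1) * N}"] assms(6) by auto
  have gram: "cinner (x n) (x m) = moment_ext S (int (n div N) - int (m div N)) $$ (n mod N, m mod N)"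
    if "n < (d + 1) * N" "m < (d + 1) * N" for n m
    using assms(5)[OF that] that by (simp add: block_toeplitz_def)
  interpret toeplitz_model E N d x
  proof
    fix n m assume nm: "n < d * N" "m < d * N"
    then have lt: "n + N < (d + 1) * N" "m + N < (d + 1) * N" "n < (d + 1) * N" "m < (d + 1) * N"
      by auto
    \<comment> \<open>Both block numbers grow by 1, and a Toeplitz entry depends only on their
      difference and the residues.\<close>
    show "cinner (x (n + N)) (x (m + N)) = cinner (x n) (x m)"
      unfolding gram[OF lt(1,2)] gram[OF lt(3,4)] using assms(1) by simp
  qed (use assms E in auto)
  have moments: "cinner (x (n * N + k)) (x j) = S n $$ (k, j)" if "n \<le> d" "k < N" "j < N" for n k j
  proof -
    have "n * N + k < Suc n * N" using that by simp
    also have "\<dots> \<le> (d + 1) * N" using that by (intro mult_le_mono1) simp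
    finally have "n * N + k < (d + 1) * N" "j < (d + 1) * N" using that by auto
    from gram[OF this] show ?thesis using that by (simp add: moment_ext_def)
  qed
  have ex_M: "\<exists>M \<in> moment_solutions N d S. generates N d x \<Phi> M" if "\<Phi> \<in> parameters N d x" for \<Phi>
  proof -
    interpret parameter E N d x \<Phi> by unfold_locales (rule that)
    show ?thesis by (rule generated_solution_exists[OF assms(3) moments])
  qed
  have ex_\<Phi>: "\<exists>\<Phi> \<in> parameters N d x. generates N d x \<Phi> M" if M: "M \<in> moment_solutions N d S" for M
  proof -
    have carrier: "M t \<in> carrier_mat N N" if "0 \<le> t" "t \<le> 2 * pi" for t
      using M that by (auto simp: moment_solutions_def)
    interpret moment_model E N d x "\<lambda>k j t. M t $$ (k, j)"
    proof
      fix v :: "nat \<Rightarrow> complex" and s t :: real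
      assume st: "0 \<le> s" "s \<le> t" "t \<le> 2 * pi"
      then have c: "M s \<in> carrier_mat N N" "M t \<in> carrier_mat N N" by (auto intro!: carrier)
      have "pos_semidef (M t - M s)"
        using M st by (simp add: moment_solutions_def)
      moreover have "M t - M s \<in> carrier_mat N N" using c by auto
      ultimately have "0 \<le> (\<Sum>k<N. \<Sum>j<N. v k * cnj (v j) * (M t - M s) $$ (k, j))"
        using pos_semidef_iff by blast
      then show "0 \<le> (\<Sum>k<N. \<Sum>j<N. v k * cnj (v j) * (M t $$ (k, j) - M s $$ (k, j)))"
        using c by simp
    next
      fix k j assume kj: "k < N" "j < N"
      then show "M 0 $$ (k, j) = 0" using M by (simp add: moment_solutions_def)
      show "((\<lambda>t. M t $$ (k, j)) \<longlongrightarrow> M t $$ (k, j)) (at_left t)" if "0 < t" "t \<le> 2 * pi" for t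
        using M kj that by (simp add: moment_solutions_def left_cont_mat_def)
      fix n assume n: "n \<le> d"
      then have "has_stieltjes_integral (\<lambda>t. exp (\<i> * of_nat n * of_real t)) (\<lambda>t. M t $$ (k, j)) 0 (2 * pi)
          (S n $$ (k, j))"
        using M kj by (simp add: moment_solutions_def)
      then show "has_stieltjes_integral (\<lambda>t. cis (real n * t)) (\<lambda>t. M t $$ (k, j)) 0 (2 * pi)
          (cinner (x (n * N + k)) (x j))"
        using moments[OF n kj] by (simp add: cis_conv_exp mult.assoc)
    qed
    obtain \<Phi> where \<Phi>: "\<Phi> \<in> parameters N d x"
      "\<And>z k j. cmod z \<noteq> 1 \<Longrightarrow> k < N \<Longrightarrow> j < N \<Longrightarrow>
        has_stieltjes_integral (\<lambda>t. 1 / (1 - z * cis t)) (\<lambda>t. M t $$ (k, j)) 0 (2 * pi)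
          (cinner (gen_resolvent (A_dom N d x) (A_op N d x) \<Phi> z (x k)) (x j))"
      using generating_parameter_exists by blast
    \<comment> \<open>Bounded variation of the entries is part of \<open>generates\<close>; for a
      solution it follows from domination by the trace.\<close>
    have "bounded_variation (\<lambda>t. M t $$ (k, j)) 0 (2 * pi)" if "k < N" "j < N" for k j
      by (rule bounded_variation_dominated[where \<phi> = total_mass]) (simp_all add: m_dominated that)
    then have "M \<in> bv_mat_functions N"
      using M by (simp add: bv_mat_functions_def moment_solutions_def)
    then have "generates N d x \<Phi> M"
      using \<Phi>(2) by (simp add: generates_def cis_conv_exp)
    with \<Phi>(1) show ?thesis by blast
  qed
  have unique_M: "M = M'" if "generates N d x \<Phi> M" "generates N d x \<Phi> M'" for \<Phi> M M'
    by (rule generated_unique[OF that])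
  \<comment> \<open>Integrals against the same M have equal values, so the first blocks of the two
    resolvents agree in the disc.\<close>
  have unique_\<Phi>: "\<Phi> = \<Psi>"
    if par: "\<Phi> \<in> parameters N d x" "\<Psi> \<in> parameters N d x" and gen: "generates N d x \<Phi> M" "generates N d x \<Psi> M"
    for \<Phi> \<Psi> M
  proof (rule parameter_unique)
    show "parameter E N d x \<Phi>" "parameter E N d x \<Psi>"
      by (unfold_locales; rule par)+
    fix z k j assume z: "cmod z < 1" and kj: "k < N" "j < N"
    have "cinner (gen_resolvent DA A \<Phi> z (x k)) (x j) = cinner (gen_resolvent DA A \<Psi> z (x k)) (x j)"
    proof (rule stieltjes_integral_unique)
      have z': "cmod z \<noteq> 1" using z by simp
      show "has_stieltjes_integral (\<lambda>t. 1 / (1 - z * exp (\<i> * of_real t))) (\<lambda>t. M t $$ (k, j)) 0 (2 * pi)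
          (cinner (gen_resolvent DA A \<Phi> z (x k)) (x j))"
        using gen(1) z' kj unfolding generates_def by blast
      show "has_stieltjes_integral (\<lambda>t. 1 / (1 - z * exp (\<i> * of_real t))) (\<lambda>t. M t $$ (k, j)) 0 (2 * pi)
          (cinner (gen_resolvent DA A \<Psi> z (x k)) (x j))"
        using gen(2) z' kj unfolding generates_def by blast
    qed
    then show "cinner (disc_resolvent DA A \<Phi> z (x k)) (x j) = cinner (disc_resolvent DA A \<Psi> z (x k)) (x j)"
      using z by (simp add: gen_resolvent_def)
  qed
  have the_M: "(THE M. generates N d x \<Phi> M) = M" if "generates N d x \<Phi> M" for \<Phi> M
    using that unique_M by blast
  have "bij_betw (\<lambda>\<Phi>. THE M. generates N d x \<Phi> M) (parameters N d x) (moment_solutions N d S)"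
    unfolding bij_betw_def
  proof
    show "inj_on (\<lambda>\<Phi>. THE M. generates N d x \<Phi> M) (parameters N d x)"
    proof (rule inj_onI)
      fix \<Phi> \<Psi> assume par: "\<Phi> \<in> parameters N d x" "\<Psi> \<in> parameters N d x"
        and eq: "(THE M. generates N d x \<Phi> M) = (THE M. generates N d x \<Psi> M)"
      obtain M M' where "generates N d x \<Phi> M" "generates N d x \<Psi> M'"
        using ex_M par by blast
      with eq the_M show "\<Phi> = \<Psi>" using unique_\<Phi>[OF par] by metis
    qed
    show "(\<lambda>\<Phi>. THE M. generates N d x \<Phi> M) ` parameters N d x = moment_solutions N d S"
    proof (intro equalityI subsetI)
      fix M assume "M \<in> (\<lambda>\<Phi>. THE M. generates N d x \<Phi> M) ` parameters N d x"
      then obtain \<Phi> where "\<Phi> \<in> parameters N d x" "M = (THE M. generates N d x \<Phi> M)" by blast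
      with ex_M[of \<Phi>] the_M show "M \<in> moment_solutions N d S" by metis
    next
      fix M assume "M \<in> moment_solutions N d S"
      with ex_\<Phi> obtain \<Phi> where \<Phi>: "\<Phi> \<in> parameters N d x" "generates N d x \<Phi> M" by blast
      from the_M[OF \<Phi>(2)] \<Phi>(1) show "M \<in> (\<lambda>\<Phi>. THE M. generates N d x \<Phi> M) ` parameters N d x"
        by (intro image_eqI[of _ _ \<Phi>]) simp_all
    qed
  qed
  moreover have "\<forall>\<Phi> \<in> parameters N d x. \<exists>!M. generates N d x \<Phi> M"
    using ex_M unique_M by blast
  moreover have "\<forall>\<Phi> \<in> parameters N d x. \<forall>M. generates N d x \<Phi> M \<longrightarrow> M \<in> moment_solutions N d S"
    using ex_M unique_M by blast
  ultimately show ?thesis using ex_\<Phi> by blast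
qed

end
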